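(* For each Borel $E\subseteq\mathbb R^2$, the map $t\mapsto\mathbb P((t,Z(t))\in E)$ is Borel measurable. In particular, each positive random variable $T$ can be coupled with a random variable $Z(T)$, unique in that the joint law of $(T,Z(T))$ is determined by $$P\bigl((T,Z(T))\in\cdot\bigr)=\int\mathbb P\bigl((t,Z(t))\in\cdot\bigr)\,P(T\in dt),$$ and, assuming $T$ to be independent of $Z_n$, $$Z_n(T)\underset{n\to\infty}{\overset{\mathrm{law}}\longrightarrow}Z(T).$$ Moreover, for each $t>0$ the cascade relation $$Z(t)\overset{\mathrm{law}}=\sum_{i=1}^b b^{-2}Z(T_i)$$ holds, where $Z(T_1),\dots,Z(T_b)$ are i.i.d. copies of the random variable $Z(T)$ for $T$ Compound Poisson-Exponential with parameter $t$.
   Context: Fix an integer $b\ge2$. $\mathbb T_n$ is the regular rooted tree of depth $n$ with forward degree $b$ (every vertex at distance less than $n$ from the root has exactly $b$ children), $\varrho$ is its root, $\mathbb L_n$ is the set of its $b^n$ leaves. $\{X_t\}_{t\ge0}$ is the continuous-time random walk on $\mathbb T_n$ with unit transition rate across each edge, $P^\varrho$ is its law started at $\varrho$. Let $\ell_t(x):=\int_0^t1_{\{X_s=x\}}\,ds$, $\tilde\tau_\varrho(t):=\inf\{s\ge0:\ell_s(\varrho)>t\}$, $L_t(x):=\ell_{\tilde\tau_\varrho(t)}(x)$. For $t>0$ set $$Z_n(t):=b^{-2n}\sum_{x\in\mathbb L_n}\bigl(n\sqrt{\log b}-\sqrt{L_t(x)}\bigr)^+L_t(x)^{1/4}e^{2\sqrt{\log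 b}\sqrt{L_t(x)}},$$ and let $Z(t)$, with law $\mathbb P$, be the (a.s.-finite, non-negative) weak limit of $Z_n(t)$ under $P^\varrho$ as $n\to\infty$, whose existence is another theorem of the paper. By convention $Z_n(0)=Z(0)=0$. A random variable is Compound Poisson-Exponential with parameter $t$ if it has the law of $\sum_{i=1}^{N(t)}U_i$ with $N(t)$ Poisson with parameter $t$ and $\{U_i\}_{i\ge1}$ i.i.d. Exponentials with parameter $1$, independent of $N(t)$. *)

theory Defs
  imports "HOL-Probability.Probability"
begin

text \<open>
  A vertex of the \<open>b\<close>-ary tree of depth \<open>n\<close> is the list of the child labels (in \<open>{..<b}\<close>) met on
  the way from the root, so the root is \<open>[]\<close> and the children of \<open>v\<close> are the lists \<open>v @ [i]\<close>.
\<close>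

definition tree_vertices :: "nat \<Rightarrow> nat \<Rightarrow> nat list set" where
  "tree_vertices b n = {v. set v \<subseteq> {..<b} \<and> length v \<le> n}"

definition tree_leaves :: "nat \<Rightarrow> nat \<Rightarrow> nat list set" where
  "tree_leaves b n = {v. set v \<subseteq> {..<b} \<and> length v = n}"

definition tree_nbrs :: "nat \<Rightarrow> nat \<Rightarrow> nat list \<Rightarrow> nat list set" where
  "tree_nbrs b n v = {w \<in> tree_vertices b n. \<exists>i. w = v @ [i] \<or> v = w @ [i]}"

text \<open>
  The walk is given through its jump chain \<open>Y\<close> and holding times \<open>S\<close>: unit rate across each edge
  means that the holding time at \<open>v\<close> is exponential with parameter the degree of \<open>v\<close>, and that the
  next vertex is uniform among the neighbours of \<open>v\<close>. For \<open>n = 0\<close> the root has no neighbours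
  and no process satisfies this definition; it is meant for \<open>n \<ge> 1\<close>.
\<close>

definition tree_walk ::
  "nat \<Rightarrow> nat \<Rightarrow> 'a measure \<Rightarrow> (real \<Rightarrow> 'a \<Rightarrow> nat list) \<Rightarrow> bool" where
  "tree_walk b n M X \<longleftrightarrow> prob_space M \<and>
    (\<exists>(Y :: nat \<Rightarrow> 'a \<Rightarrow> nat list) (S :: nat \<Rightarrow> 'a \<Rightarrow> real).
      (\<forall>k. Y k \<in> measurable M (count_space (tree_vertices b n))) \<and>
      (\<forall>k. S k \<in> borel_measurable M) \<and>
      (\<forall>\<omega>\<in>space M. (\<forall>k. 0 < S k \<omega>) \<and> filterlim (\<lambda>k. \<Sum>i<k. S i \<omega>) at_top sequentially) \<and>
      (\<forall>k (v :: nat \<Rightarrow> nat list) (s :: nat \<Rightarrow> real). (\<forall>i\<le>k. 0 \<le> s i) \<longrightarrow>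
        measure M {\<omega>\<in>space M. \<forall>i\<le>k. Y i \<omega> = v i \<and> s i < S i \<omega>} =
          (if v 0 = [] then 1 else 0) *
          (\<Prod>i<k. if v (Suc i) \<in> tree_nbrs b n (v i) then 1 / real (card (tree_nbrs b n (v i))) else 0) *
          (\<Prod>i\<le>k. exp (- real (card (tree_nbrs b n (v i))) * s i))) \<and>
      (\<forall>\<omega>\<in>space M. \<forall>t\<ge>0. \<forall>k.
        (\<Sum>i<k. S i \<omega>) \<le> t \<and> t < (\<Sum>i<Suc k. S i \<omega>) \<longrightarrow> X t \<omega> = Y k \<omega>))"

definition occupation_time :: "(real \<Rightarrow> 'a \<Rightarrow> nat list) \<Rightarrow> real \<Rightarrow> nat list \<Rightarrow> 'a \<Rightarrow> real" where
  "occupation_time X t x \<omega> = (LINT s:{0..t}|lborel. indicator {x} (X s \<omega>))"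

definition inverse_local_time :: "(real \<Rightarrow> 'a \<Rightarrow> nat list) \<Rightarrow> real \<Rightarrow> 'a \<Rightarrow> real" where
  "inverse_local_time X t \<omega> = Inf {s. 0 \<le> s \<and> t < occupation_time X s [] \<omega>}"

definition local_time :: "(real \<Rightarrow> 'a \<Rightarrow> nat list) \<Rightarrow> real \<Rightarrow> nat list \<Rightarrow> 'a \<Rightarrow> real" where
  "local_time X t x \<omega> = occupation_time X (inverse_local_time X t \<omega>) x \<omega>"

definition Zn :: "nat \<Rightarrow> nat \<Rightarrow> (real \<Rightarrow> 'a \<Rightarrow> nat list) \<Rightarrow> real \<Rightarrow> 'a \<Rightarrow> real" where
  "Zn b n X t \<omega> =
    (if t = 0 then 0
     else (1 / real b ^ (2 * n)) *
       (\<Sum>x\<in>tree_leaves b n.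
          max 0 (real n * sqrt (ln (real b)) - sqrt (local_time X t x \<omega>)) *
          local_time X t x \<omega> powr (1 / 4) *
          exp (2 * sqrt (ln (real b)) * sqrt (local_time X t x \<omega>))))"

text \<open>The random variable \<open>T\<close> is independent of the process \<open>(W t)\<close>, \<open>t \<ge> 0\<close>.\<close>

definition indep_of_process ::
  "'a measure \<Rightarrow> ('a \<Rightarrow> real) \<Rightarrow> (real \<Rightarrow> 'a \<Rightarrow> real) \<Rightarrow> bool" where
  "indep_of_process M T W \<longleftrightarrow>
    prob_space.indep_set M
      (sets (vimage_algebra (space M) T borel))
      (sets (vimage_algebra (space M) (\<lambda>\<omega>. \<lambda>t\<in>{0..}. W t \<omega>) (Pi\<^sub>M {0..} (\<lambda>_. borel))))"

text \<open>
  \<open>Z\<close> is a version of \<open>Z(T)\<close> coupled with \<open>T\<close>, where \<open>\<zeta> t\<close> is the law of \<open>Z(t)\<close> for \<open>t \<ge> 0\<close>.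
  Compound Poisson-Exponential variables have an atom at \<open>0\<close>, so \<open>T\<close> is only asked to be
  non-negative.
\<close>

definition coupled ::
  "(real \<Rightarrow> real measure) \<Rightarrow> 'a measure \<Rightarrow> ('a \<Rightarrow> real) \<Rightarrow> ('a \<Rightarrow> real) \<Rightarrow> bool" where
  "coupled \<zeta> M T Z \<longleftrightarrow> prob_space M \<and>
    T \<in> borel_measurable M \<and> Z \<in> borel_measurable M \<and> (AE \<omega> in M. 0 \<le> T \<omega>) \<and>
    (\<forall>E\<in>sets (borel :: (real \<times> real) measure).
      emeasure M {\<omega>\<in>space M. (T \<omega>, Z \<omega>) \<in> E} =
        (\<integral>\<^sup>+t\<in>{0..}. emeasure (\<zeta> t) {z. (t, z) \<in> E} \<partial>distr M borel T))"

definition cpe_law :: "real \<Rightarrow> real measure" where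
  "cpe_law t =
    distr (measure_pmf (poisson_pmf t) \<Otimes>\<^sub>M (\<Pi>\<^sub>M i\<in>UNIV. density lborel (exponential_density 1)))
      borel (\<lambda>(N :: nat, U :: nat \<Rightarrow> real). \<Sum>i=1..N. U i)"

end

theory Submission
  imports Defs
begin

text \<open>
  Killing the walk at rate \<open>l x\<close> at each vertex \<open>x\<close> and integrating over an exponential amount of root
  local time turns the Laplace transform of the field \<open>L\<^sub>t\<close> into the Green function at the root, which
  on a tree is computed by a recursion over subtrees. Hence \<open>L\<^sub>t\<close> has Laplace transform
  \<open>exp (- t \<Phi>)\<close>, where \<open>\<Phi>\<close> is the sum over the children of the root of \<open>f / (1 + f)\<close> with \<open>f\<close> the
  exponent of the child's subtree. Since \<open>exp (- t f / (1 + f))\<close> is the Laplace transform at \<open>f\<close> of a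
  Compound Poisson-Exponential variable, the field on the tree of depth \<open>n + 1\<close> consists of
  independent fields on trees of depth \<open>n\<close> run up to independent times of that law.

  Consequently \<open>Z\<^sub>n\<^sub>+\<^sub>1(t)\<close> is \<open>b\<^sup>-\<^sup>2\<close> times a sum of independent copies of \<open>Z\<^sub>n(T)\<close>, except that the factor
  \<open>n \<surd>(log b) - \<surd>L\<close> is off by \<open>\<surd>(log b)\<close>. This is a relative error of order \<open>1 / K\<close> unless \<open>\<surd>L\<close> comes within
  distance \<open>K\<close> of \<open>(n + 1) \<surd>(log b)\<close> at some leaf, which has probability \<open>O(1 / n)\<close> by a first-moment
  bound. Letting first \<open>n\<close> and then \<open>K\<close> tend to infinity yields the cascade relation. The remaining
  claims are mixture arguments over the kernel \<open>t \<mapsto> law of Z(t)\<close>, a pointwise weak limit of measurable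
  kernels.
\<close>

section \<open>Measures determined by Laplace transforms\<close>

text \<open>The walk is known only through the joint law of its jump chain and holding times;
  everything has to be drawn from sums over finite histories. At a fixed root local time
  \<open>t\<close> such sums do not factor, at an exponential time they do. The fixed-time transform
  is recovered because an exponential clock of rate 1, tilted by \<open>exp (- k * t)\<close>, is an
  exponential clock of rate \<open>1 + k\<close>: the means at all these rates form a Laplace
  transform in \<open>t\<close>. It determines the function of \<open>t\<close> almost everywhere,
  and the local times off the root are right-continuous step functions of \<open>t\<close>. The
  convergence hypothesis concerns each fixed \<open>t\<close> separately, with no uniformity in
  \<open>t\<close> and no moments of the limit. Therefore the cascade is compared through
  characteristic functions, whose modulus is at most 1: averages over a random time pass to the
  limit by dominated convergence, and relative errors are absorbed into bounded continuous functions
  of Z_n(t).\<close>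

text \<open>The substitution \<open>u = exp (-y)\<close> carries the half-line to
  \<open>(0, 1]\<close> and turns the given integrals into moments. Bernstein polynomials then reach
  every continuous function of \<open>u\<close>, and ramps in \<open>u\<close> reach the
  distribution function. Integer rates suffice.\<close>

lemma laplace_determines_measure:
  fixes \<mu> \<nu> :: "real measure"
  assumes s: "sets \<mu> = sets borel" "sets \<nu> = sets borel"
    and f: "finite_measure \<mu>" "finite_measure \<nu>"
    and z: "emeasure \<mu> {..<0} = 0" "emeasure \<nu> {..<0} = 0"
    and eq: "\<And>k::nat. (\<integral>\<^sup>+y. ennreal (exp (- real k * y)) \<partial>\<mu>) = (\<integral>\<^sup>+y. ennreal (exp (- real k * y)) \<partial>\<nu>)"
  shows "\<mu> = \<nu>"
proof -
  interpret m: finite_measure \<mu> by fact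
  interpret n: finite_measure \<nu> by fact
  note [measurable_cong] = s
  have ae: "AE y in \<mu>. 0 \<le> y" "AE y in \<nu>. 0 \<le> y"
    by (rule AE_I[where N="{..<0}"]; use z s in force)+
  have bint: "integrable \<mu> (\<lambda>y. g (exp (-y)))" "integrable \<nu> (\<lambda>y. g (exp (-y)))"
    if [measurable]: "g \<in> borel_measurable borel" and "\<And>u. u \<in> {0..1} \<Longrightarrow> \<bar>g u\<bar> \<le> B" for g :: "real \<Rightarrow> real" and B
  proof -
    have "AE y in \<mu>. norm (g (exp (-y))) \<le> B" "AE y in \<nu>. norm (g (exp (-y))) \<le> B"
      using ae that(2) by auto
    then show "integrable \<mu> (\<lambda>y. g (exp (-y)))" "integrable \<nu> (\<lambda>y. g (exp (-y)))"
      by (auto intro!: m.integrable_const_bound[where B=B] n.integrable_const_bound[where B=B])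
  qed
  \<comment> \<open>Bernstein polynomials are combinations of these products; raising
    \<open>l\<close> by one gives a difference of two products with the lower
    \<open>l\<close>.\<close>
  have mono: "(\<integral>y. exp (-y) ^ k * (1 - exp (-y)) ^ l \<partial>\<mu>) = (\<integral>y. exp (-y) ^ k * (1 - exp (-y)) ^ l \<partial>\<nu>)" for k l :: nat
  proof (induction l arbitrary: k)
    case 0
    have e: "exp (-y) ^ k = exp (- real k * y)" for y :: real
      by (simp add: exp_of_nat_mult[symmetric])
    have "(\<integral>y. exp (- real k * y) \<partial>\<mu>) = (\<integral>y. exp (- real k * y) \<partial>\<nu>)"
      using eq[of k] by (subst (1 2) integral_eq_nn_integral) auto
    then show ?case by (simp add: e)
  next
    case (Suc l)
    have i: "integrable \<mu> (\<lambda>y. exp (-y) ^ k * (1 - exp (-y)) ^ l)"  "integrable \<nu> (\<lambda>y. exp (-y) ^ k * (1 - exp (-y)) ^ l)" for k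
      by (rule bint[where g="\<lambda>u. u ^ k * (1 - u) ^ l" and B=1];
          auto simp: abs_mult power_abs intro!: mult_le_one power_le_one)+
    have e: "exp (-y) ^ k * (1 - exp (-y)) ^ Suc l = exp (-y) ^ k * (1 - exp (-y)) ^ l - exp (-y) ^ Suc k * (1 - exp (-y)) ^ l" for y::real
      by (simp add: algebra_simps)
    show ?case unfolding e using i Suc by (simp del: power_Suc)
  qed
  have cont: "(\<integral>y. g (exp (-y)) \<partial>\<mu>) = (\<integral>y. g (exp (-y)) \<partial>\<nu>)" if g: "continuous_on UNIV g" for g :: "real \<Rightarrow> real"
  proof -
    have [measurable]: "g \<in> borel_measurable borel" using g by (rule borel_measurable_continuous_onI)
    have "continuous_on {0..1} g" using g continuous_on_subset by blast
    note W = Bernstein_Weierstrass[OF this]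
    have "bounded (g ` {0..1})"
      using \<open>continuous_on {0..1} g\<close> compact_continuous_image compact_imp_bounded by blast
    then obtain B where B: "\<And>u. u \<in> {0..1} \<Longrightarrow> \<bar>g u\<bar> \<le> B"
      by (force simp add: bounded_iff)
    define C where "C = measure \<mu> UNIV + measure \<nu> UNIV"
    have C: "C \<ge> 0" by (simp add: C_def)
    have "\<bar>(\<integral>y. g (exp (-y)) \<partial>\<mu>) - (\<integral>y. g (exp (-y)) \<partial>\<nu>)\<bar> \<le> e" if e: "e > 0" for e
    proof -
      obtain N where N: "\<And>x. x \<in> {0..1} \<Longrightarrow> \<bar>g x - (\<Sum>k\<le>N. g(k/N) * Bernstein N k x)\<bar> < e / (C + 1)"
        using W[of "e / (C + 1)"] e C by (auto simp: divide_pos_pos)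
      define p where "p x = (\<Sum>k\<le>N. g(k/N) * Bernstein N k x)" for x
      have [measurable]: "p \<in> borel_measurable borel" unfolding p_def Bernstein_def by measurable
      have pN: "\<And>x. x \<in> {0..1} \<Longrightarrow> \<bar>g x - p x\<bar> \<le> e / (C + 1)" using N by (force simp: p_def)
      have pb: "\<bar>p x\<bar> \<le> B + e / (C+1)" if "x \<in> {0..1}" for x using pN[OF that] B[OF that] by linarith
      have ig: "integrable \<mu> (\<lambda>y. g (exp (-y)))" "integrable \<nu> (\<lambda>y. g (exp (-y)))"
        by (rule bint[where g=g and B=B]; use B in simp)+
      have ip: "integrable \<mu> (\<lambda>y. p (exp (-y)))" "integrable \<nu> (\<lambda>y. p (exp (-y)))"
        by (rule bint[where g=p and B="B + e / (C+1)"]; use pb in simp)+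
      have bi: "integrable \<mu> (\<lambda>y. exp (-y) ^ k * (1 - exp (-y)) ^ l)" "integrable \<nu> (\<lambda>y. exp (-y) ^ k * (1 - exp (-y)) ^ l)" for k l
        by (rule bint[where g="\<lambda>u. u ^ k * (1 - u) ^ l" and B=1];
          auto simp: abs_mult power_abs intro!: mult_le_one power_le_one)+
      have pe: "p (exp (-y)) = (\<Sum>k\<le>N. g (k/N) * real (N choose k) * (exp (-y) ^ k * (1 - exp (-y)) ^ (N - k)))" for y
        by (simp add: p_def Bernstein_def mult_ac)
      have p: "(\<integral>y. p (exp (-y)) \<partial>\<mu>) = (\<integral>y. p (exp (-y)) \<partial>\<nu>)"
        unfolding pe using bi mono by (subst (1 2) Bochner_Integration.integral_sum) auto
      have 1: "\<bar>(\<integral>y. g (exp (-y)) \<partial>\<mu>) - (\<integral>y. p (exp (-y)) \<partial>\<mu>)\<bar> \<le> e / (C+1) * measure \<mu> UNIV"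
      proof -
        have "\<bar>\<integral>y. g (exp (-y)) - p (exp (-y)) \<partial>\<mu>\<bar> \<le> (\<integral>y. \<bar>g (exp (-y)) - p (exp (-y))\<bar> \<partial>\<mu>)" by simp
        also have "\<dots> \<le> (\<integral>y. e / (C+1) \<partial>\<mu>)"
          using ig ip ae pN by (intro integral_mono_AE) auto
        finally show ?thesis using ig ip sets_eq_imp_space_eq[OF s(1)] by (simp add: mult.commute)
      qed
      have 2: "\<bar>(\<integral>y. g (exp (-y)) \<partial>\<nu>) - (\<integral>y. p (exp (-y)) \<partial>\<nu>)\<bar> \<le> e / (C+1) * measure \<nu> UNIV"
      proof -
        have "\<bar>\<integral>y. g (exp (-y)) - p (exp (-y)) \<partial>\<nu>\<bar> \<le> (\<integral>y. \<bar>g (exp (-y)) - p (exp (-y))\<bar> \<partial>\<nu>)" by simp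
        also have "\<dots> \<le> (\<integral>y. e / (C+1) \<partial>\<nu>)"
          using ig ip ae pN by (intro integral_mono_AE) auto
        finally show ?thesis using ig ip sets_eq_imp_space_eq[OF s(2)] by (simp add: mult.commute)
      qed
      have "\<bar>(\<integral>y. g (exp (-y)) \<partial>\<mu>) - (\<integral>y. g (exp (-y)) \<partial>\<nu>)\<bar> \<le> e / (C+1) * C"
        using 1 2 p unfolding C_def distrib_left by linarith
      also have "\<dots> \<le> e" using e C by (simp add: field_simps)
      finally show ?thesis .
    qed
    then show ?thesis
      by (metis abs_ge_zero abs_zero dense_ge eq_iff_diff_eq_0 abs_eq_0 order_antisym)
  qed
  have "cdf \<mu> a = cdf \<nu> a" for a
  proof (cases "a < 0")
    case True
    then have "emeasure \<mu> {..a} \<le> emeasure \<mu> {..<0}" "emeasure \<nu> {..a} \<le> emeasure \<nu> {..<0}"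
      by (auto intro!: emeasure_mono simp: s)
    then show ?thesis using z by (simp add: cdf_def measure_def)
  next
    case False
    \<comment> \<open>A ramp of slope \<open>j\<close> in \<open>u = exp (-y)\<close>, equal to 1
      for \<open>y \<le> a\<close> and eventually 0 at each point beyond. Unlike the indicator it is
      continuous in \<open>u\<close>.\<close>
    define h where "h j u = min 1 (max 0 (1 + real j * (u - exp (-a))))" for j u
    have hc: "continuous_on UNIV (h j)" for j unfolding h_def by (intro continuous_intros)
    then have [measurable]: "h j \<in> borel_measurable borel" for j by (rule borel_measurable_continuous_onI)
    have lim: "(\<lambda>j. h j (exp (-y))) \<longlonglongrightarrow> indicator {..a} y" for y
    proof (cases "y \<le> a")
      case True
      then have "h j (exp (-y)) = 1" for j unfolding h_def by auto
      then show ?thesis using True by simp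
    next
      case False
      then have d: "exp (-a) - exp (-y) > 0" by simp
      obtain J where J: "1 / (exp (-a) - exp (-y)) < real J" using reals_Archimedean2 by blast
      have "h j (exp (-y)) = 0" if "j \<ge> J" for j
      proof -
        have "1 < real J * (exp (-a) - exp (-y))" using J d by (simp add: field_simps)
        also have "\<dots> \<le> real j * (exp (-a) - exp (-y))" using that d by (intro mult_right_mono) auto
        finally show ?thesis unfolding h_def by (simp add: algebra_simps)
      qed
      then have "\<forall>\<^sub>F j in sequentially. h j (exp (-y)) = 0" by (auto simp: eventually_sequentially)
      then show ?thesis using False by (simp add: tendsto_eventually)
    qed
    have "(\<lambda>j. \<integral>y. h j (exp (-y)) \<partial>\<mu>) \<longlonglongrightarrow> (\<integral>y. indicator {..a} y \<partial>\<mu>)"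
      by (rule integral_dominated_convergence[where w="\<lambda>_. 1"]) (auto simp: lim, auto simp: h_def)
    moreover have "(\<lambda>j. \<integral>y. h j (exp (-y)) \<partial>\<nu>) \<longlonglongrightarrow> (\<integral>y. indicator {..a} y \<partial>\<nu>)"
      by (rule integral_dominated_convergence[where w="\<lambda>_. 1"]) (auto simp: lim, auto simp: h_def)
    moreover have "(\<integral>y. h j (exp (-y)) \<partial>\<mu>) = (\<integral>y. h j (exp (-y)) \<partial>\<nu>)" for j by (rule cont[OF hc])
    ultimately have "(\<integral>y. indicator {..a} y \<partial>\<mu>) = (\<integral>y. indicator {..a} y \<partial>\<nu> :: real)"
      using LIMSEQ_unique by fastforce
    then show ?thesis using s by (simp add: cdf_def sets_eq_imp_space_eq)
  qed
  then show ?thesis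
    using f s by (intro cdf_unique') (auto simp: finite_borel_measure_def finite_borel_measure_axioms_def)
qed

text \<open>Tails form a generating pi-system. This is the form needed for the walk, whose law is
  given by tails of the holding times.\<close>

lemma tails_determine_measure:
  fixes \<mu> \<nu> :: "real measure"
  assumes s: "sets \<mu> = sets borel" "sets \<nu> = sets borel"
    and f: "finite_measure \<mu>" "finite_measure \<nu>"
    and eq: "\<And>s. emeasure \<mu> {s<..} = emeasure \<nu> {s<..}"
  shows "\<mu> = \<nu>"
proof (rule measure_eqI_generator_eq[where \<Omega>=UNIV and E="range greaterThan" and A="\<lambda>i. {- real i<..}"])
  show "Int_stable (range (greaterThan :: real \<Rightarrow> _))"
    by (auto simp: Int_stable_def image_iff intro: exI[of _ "max _ _"])
  show "sets \<mu> = sigma_sets UNIV (range greaterThan)" "sets \<nu> = sigma_sets UNIV (range greaterThan)"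
    unfolding s by (simp_all add: borel_Ioi)
  show "(\<Union>i. {- real i<..}) = UNIV"
    by (auto simp: minus_less_iff intro: reals_Archimedean2)
  show "emeasure \<mu> {- real i<..} \<noteq> \<infinity>" for i
    using f(1) by (simp add: finite_measure.emeasure_finite)
qed (auto simp: eq)

text \<open>
  The coordinates are released one at a time: with the other factors held fixed as a bounded
  density, the test functions of a single coordinate range over a class \<open>G\<close> that determines finite
  measures on the half-line.
\<close>

lemma joint_law_determined:
  fixes X :: "'i \<Rightarrow> 'a \<Rightarrow> real" and X' :: "'i \<Rightarrow> 'b \<Rightarrow> real"
  assumes I: "finite I"
    and det: "\<And>\<mu> \<nu>. sets \<mu> = sets borel \<Longrightarrow> sets \<nu> = sets borel \<Longrightarrow> finite_measure \<mu> \<Longrightarrow> finite_measure \<nu> \<Longrightarrow>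
      emeasure \<mu> {..<0} = 0 \<Longrightarrow> emeasure \<nu> {..<0} = 0 \<Longrightarrow>
      (\<And>g. g \<in> G \<Longrightarrow> (\<integral>\<^sup>+x. g x \<partial>\<mu>) = (\<integral>\<^sup>+x. g x \<partial>\<nu>)) \<Longrightarrow> \<mu> = \<nu>"
    and G: "\<And>g. g \<in> G \<Longrightarrow> g \<in> borel_measurable borel" "\<And>g x. g \<in> G \<Longrightarrow> 0 \<le> x \<Longrightarrow> g x \<le> (1 :: ennreal)"
    and M: "finite_measure M" and N: "finite_measure N"
    and X: "\<And>i. i \<in> I \<Longrightarrow> X i \<in> borel_measurable M" "\<And>i \<omega>. i \<in> I \<Longrightarrow> \<omega> \<in> space M \<Longrightarrow> 0 \<le> X i \<omega>"
    and X': "\<And>i. i \<in> I \<Longrightarrow> X' i \<in> borel_measurable N" "\<And>i. i \<in> I \<Longrightarrow> AE \<omega> in N. 0 \<le> X' i \<omega>"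
    and eq: "\<And>g. (\<And>i. i \<in> I \<Longrightarrow> g i \<in> G) \<Longrightarrow>
      (\<integral>\<^sup>+\<omega>. (\<Prod>i\<in>I. g i (X i \<omega>)) \<partial>M) = (\<integral>\<^sup>+\<omega>. (\<Prod>i\<in>I. g i (X' i \<omega>)) \<partial>N)"
    and f: "\<And>i. i \<in> I \<Longrightarrow> f i \<in> borel_measurable borel" "\<And>i x. i \<in> I \<Longrightarrow> f i x \<le> 1"
  shows "(\<integral>\<^sup>+\<omega>. (\<Prod>i\<in>I. f i (X i \<omega>)) \<partial>M) = (\<integral>\<^sup>+\<omega>. (\<Prod>i\<in>I. f i (X' i \<omega>)) \<partial>N)"
proof -
  \<comment> \<open>\<open>J\<close> collects the coordinates whose factor is already arbitrary; the
    others still carry test functions from \<open>G\<close>.\<close>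
  have "\<forall>f. (\<forall>i\<in>I. if i \<in> J then f i \<in> borel_measurable borel \<and> (\<forall>x. f i x \<le> 1) else f i \<in> G) \<longrightarrow>
    (\<integral>\<^sup>+\<omega>. (\<Prod>i\<in>I. f i (X i \<omega>)) \<partial>M) = (\<integral>\<^sup>+\<omega>. (\<Prod>i\<in>I. f i (X' i \<omega>)) \<partial>N)" if "J \<subseteq> I" for J
    using finite_subset[OF that I] that
  proof (induction J rule: finite_induct)
    case empty
    then show ?case using eq by auto
  next
    case (insert j J)
    show ?case
    proof (intro allI impI)
      fix f assume f: "\<forall>i\<in>I. if i \<in> insert j J then f i \<in> borel_measurable borel \<and> (\<forall>x. f i x \<le> 1) else f i \<in> G"
      have fm[measurable]: "f i \<in> borel_measurable borel" if "i \<in> I" for i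
        using f that G(1) by (auto split: if_splits)
      have fb: "f i x \<le> 1" if "i \<in> I" "x \<ge> 0" for i x using f that G(2) by (auto split: if_splits)
      have j: "j \<in> I" using insert by auto
      define h where "h \<omega> = (\<Prod>i\<in>I-{j}. f i (X i \<omega>))" for \<omega>
      define h' where "h' \<omega> = (\<Prod>i\<in>I-{j}. f i (X' i \<omega>))" for \<omega>
      have [measurable]: "h \<in> borel_measurable M" "h' \<in> borel_measurable N"
        unfolding h_def h'_def using X(1) X'(1)
        by (auto intro!: borel_measurable_prod_ennreal measurable_compose[OF _ fm])
      have [measurable]: "X j \<in> borel_measurable M" "X' j \<in> borel_measurable N" using X X' j by auto
      \<comment> \<open>The other factors become a density with values in \<open>[0, 1]\<close>
        almost everywhere, so that finite measures of the single coordinate \<open>j\<close> are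
        compared.\<close>
      define \<mu> where "\<mu> = distr (density M h) borel (X j)"
      define \<nu> where "\<nu> = distr (density N h') borel (X' j)"
      have cng: "(\<Prod>i\<in>I - {j}. (if i = j then g else f i) (Y i)) = (\<Prod>i\<in>I - {j}. f i (Y i))"
        for g and Y :: "'i \<Rightarrow> real" by (rule prod.cong) auto
      have mu: "(\<integral>\<^sup>+x. g x \<partial>\<mu>) = (\<integral>\<^sup>+\<omega>. (\<Prod>i\<in>I. (f(j := g)) i (X i \<omega>)) \<partial>M)"
        if [measurable]: "g \<in> borel_measurable borel" for g
        unfolding \<mu>_def using I j cng
        by (simp add: nn_integral_distr nn_integral_density prod.remove h_def mult.commute)
      have nu: "(\<integral>\<^sup>+x. g x \<partial>\<nu>) = (\<integral>\<^sup>+\<omega>. (\<Prod>i\<in>I. (f(j := g)) i (X' i \<omega>)) \<partial>N)"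
        if [measurable]: "g \<in> borel_measurable borel" for g
        unfolding \<nu>_def using I j cng
        by (simp add: nn_integral_distr nn_integral_density prod.remove h'_def mult.commute)
      have hb: "AE \<omega> in M. h \<omega> \<le> 1"
        unfolding h_def using X(2) fb by (intro AE_I2 prod_le_1) auto
      have "AE \<omega> in N. \<forall>i\<in>I. 0 \<le> X' i \<omega>" using I X'(2) by (simp add: AE_finite_all)
      then have hb': "AE \<omega> in N. h' \<omega> \<le> 1"
        unfolding h'_def using fb by (auto elim!: eventually_mono intro!: prod_le_1)
      have fin: "finite_measure \<mu>" "finite_measure \<nu>"
      proof -
        have "emeasure \<mu> (space \<mu>) = (\<integral>\<^sup>+\<omega>. h \<omega> \<partial>M)"
          unfolding \<mu>_def by (simp add: emeasure_distr emeasure_density)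
        also have "\<dots> \<le> (\<integral>\<^sup>+\<omega>. 1 \<partial>M)" using hb by (intro nn_integral_mono_AE) 
        also have "\<dots> < \<infinity>" using M by (simp add: finite_measure.emeasure_finite less_top[symmetric])
        finally show "finite_measure \<mu>" by (auto intro!: finite_measureI)
        have "emeasure \<nu> (space \<nu>) = (\<integral>\<^sup>+\<omega>. h' \<omega> \<partial>N)"
          unfolding \<nu>_def by (simp add: emeasure_distr emeasure_density)
        also have "\<dots> \<le> (\<integral>\<^sup>+\<omega>. 1 \<partial>N)" using hb' by (intro nn_integral_mono_AE) 
        also have "\<dots> < \<infinity>" using N by (simp add: finite_measure.emeasure_finite less_top[symmetric])
        finally show "finite_measure \<nu>" by (auto intro!: finite_measureI)
      qed
      have "\<mu> = \<nu>"
      proof (rule det)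
        have "AE x in \<mu>. 0 \<le> x" unfolding \<mu>_def using X(2) j
          by (subst AE_distr_iff) (auto simp: AE_density)
        then show "emeasure \<mu> {..<0} = 0"
          by (subst AE_iff_measurable[symmetric, where P="\<lambda>x. 0 \<le> x"]) (auto simp: \<mu>_def)
        have "AE x in \<nu>. 0 \<le> x" unfolding \<nu>_def using X'(2)[OF j]
          by (subst AE_distr_iff) (auto simp: AE_density elim!: eventually_mono)
        then show "emeasure \<nu> {..<0} = 0"
          by (subst AE_iff_measurable[symmetric, where P="\<lambda>x. 0 \<le> x"]) (auto simp: \<nu>_def)
        fix g assume g: "g \<in> G"
        have "\<forall>i\<in>I. if i \<in> J then (f(j := g)) i \<in> borel_measurable borel \<and> (\<forall>x. (f(j := g)) i x \<le> 1) else (f(j := g)) i \<in> G"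
          using f g insert by auto
        then have "(\<integral>\<^sup>+\<omega>. (\<Prod>i\<in>I. (f(j := g)) i (X i \<omega>)) \<partial>M) = (\<integral>\<^sup>+\<omega>. (\<Prod>i\<in>I. (f(j := g)) i (X' i \<omega>)) \<partial>N)"
          using insert by blast
        then show "(\<integral>\<^sup>+x. g x \<partial>\<mu>) = (\<integral>\<^sup>+x. g x \<partial>\<nu>)" using mu nu G(1)[OF g] by simp
      qed (auto simp: fin, auto simp: \<mu>_def \<nu>_def)
      then show "(\<integral>\<^sup>+\<omega>. (\<Prod>i\<in>I. f i (X i \<omega>)) \<partial>M) = (\<integral>\<^sup>+\<omega>. (\<Prod>i\<in>I. f i (X' i \<omega>)) \<partial>N)"
        using mu[OF fm[OF j]] nu[OF fm[OF j]] by simp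
    qed
  qed
  from this[OF order_refl] f show ?thesis by auto
qed


lemma distr_PiM_eqI:
  fixes X :: "'i \<Rightarrow> 'a \<Rightarrow> real" and X' :: "'i \<Rightarrow> 'b \<Rightarrow> real"
  assumes I: "finite I" and M: "finite_measure M"
    and X[measurable]: "\<And>i. i \<in> I \<Longrightarrow> X i \<in> borel_measurable M"
    and X'[measurable]: "\<And>i. i \<in> I \<Longrightarrow> X' i \<in> borel_measurable N"
    and eq: "\<And>A. (\<And>i. i \<in> I \<Longrightarrow> A i \<in> sets borel) \<Longrightarrow>
      (\<integral>\<^sup>+\<omega>. (\<Prod>i\<in>I. indicator (A i) (X i \<omega>)) \<partial>M) = (\<integral>\<^sup>+\<omega>. (\<Prod>i\<in>I. indicator (A i) (X' i \<omega>)) \<partial>N)"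
  shows "distr M (\<Pi>\<^sub>M i\<in>I. borel) (\<lambda>\<omega>. \<lambda>i\<in>I. X i \<omega>) = distr N (\<Pi>\<^sub>M i\<in>I. borel) (\<lambda>\<omega>. \<lambda>i\<in>I. X' i \<omega>)"
proof (rule measure_eqI_PiM_finite[OF I, where A="\<lambda>_. \<Pi>\<^sub>E i\<in>I. UNIV" and M="\<lambda>_. borel"])
  interpret finite_measure M by fact
  have [measurable]: "(\<lambda>\<omega>. \<lambda>i\<in>I. X i \<omega>) \<in> M \<rightarrow>\<^sub>M (\<Pi>\<^sub>M i\<in>I. borel)" "(\<lambda>\<omega>. \<lambda>i\<in>I. X' i \<omega>) \<in> N \<rightarrow>\<^sub>M (\<Pi>\<^sub>M i\<in>I. borel)"
    by (auto intro!: measurable_restrict)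
  fix A :: "'i \<Rightarrow> real set" assume A: "\<And>i. i \<in> I \<Longrightarrow> A i \<in> sets borel"
  then have [measurable]: "(\<Pi>\<^sub>E i\<in>I. A i) \<in> sets (\<Pi>\<^sub>M i\<in>I. borel)" using I by (intro sets_PiM_I_finite) auto
  have ind: "indicator (\<Pi>\<^sub>E i\<in>I. A i) (\<lambda>i\<in>I. x i) = (\<Prod>i\<in>I. indicator (A i) (x i) :: ennreal)" for x :: "'i \<Rightarrow> real"
    using I by (auto simp: indicator_def PiE_def Pi_def intro!: prod.neutral[symmetric])
  show "emeasure (distr M (\<Pi>\<^sub>M i\<in>I. borel) (\<lambda>\<omega>. \<lambda>i\<in>I. X i \<omega>)) (\<Pi>\<^sub>E i\<in>I. A i) =
      emeasure (distr N (\<Pi>\<^sub>M i\<in>I. borel) (\<lambda>\<omega>. \<lambda>i\<in>I. X' i \<omega>)) (\<Pi>\<^sub>E i\<in>I. A i)"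
  proof -
    have "emeasure (distr M (\<Pi>\<^sub>M i\<in>I. borel) (\<lambda>\<omega>. \<lambda>i\<in>I. X i \<omega>)) (\<Pi>\<^sub>E i\<in>I. A i) =
        (\<integral>\<^sup>+x. indicator (\<Pi>\<^sub>E i\<in>I. A i) x \<partial>distr M (\<Pi>\<^sub>M i\<in>I. borel) (\<lambda>\<omega>. \<lambda>i\<in>I. X i \<omega>))" by simp
    also have "\<dots> = (\<integral>\<^sup>+\<omega>. (\<Prod>i\<in>I. indicator (A i) (X i \<omega>)) \<partial>M)"
      by (subst nn_integral_distr) (simp_all add: ind)
    also have "\<dots> = (\<integral>\<^sup>+\<omega>. (\<Prod>i\<in>I. indicator (A i) (X' i \<omega>)) \<partial>N)" using A by (rule eq)
    also have "\<dots> = (\<integral>\<^sup>+x. indicator (\<Pi>\<^sub>E i\<in>I. A i) x \<partial>distr N (\<Pi>\<^sub>M i\<in>I. borel) (\<lambda>\<omega>. \<lambda>i\<in>I. X' i \<omega>))"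
      by (subst nn_integral_distr) (simp_all add: ind)
    also have "\<dots> = emeasure (distr N (\<Pi>\<^sub>M i\<in>I. borel) (\<lambda>\<omega>. \<lambda>i\<in>I. X' i \<omega>)) (\<Pi>\<^sub>E i\<in>I. A i)" by simp
    finally show ?thesis .
  qed
next
  interpret finite_measure M by fact
  have [measurable]: "(\<lambda>\<omega>. \<lambda>i\<in>I. X i \<omega>) \<in> M \<rightarrow>\<^sub>M (\<Pi>\<^sub>M i\<in>I. borel)"
    by (auto intro!: measurable_restrict)
  show "emeasure (distr M (\<Pi>\<^sub>M i\<in>I. borel) (\<lambda>\<omega>. \<lambda>i\<in>I. X i \<omega>)) (\<Pi>\<^sub>E i\<in>I. UNIV) \<noteq> \<infinity>"
    by (simp add: emeasure_distr I sets_PiM_I_finite)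
qed (auto simp: I space_PiM intro!: prod_algebraI_finite)

text \<open>A product of exponentials with integer rates is the exponential of a linear form, and in
  each single coordinate such exponentials determine finite measures on the half-line.\<close>

lemma laplace_determines_joint_law:
  fixes X :: "'i \<Rightarrow> 'a \<Rightarrow> real" and X' :: "'i \<Rightarrow> 'b \<Rightarrow> real"
  assumes I: "finite I" and M: "finite_measure M" and N: "finite_measure N"
    and X: "\<And>i. i \<in> I \<Longrightarrow> X i \<in> borel_measurable M" "\<And>i \<omega>. i \<in> I \<Longrightarrow> \<omega> \<in> space M \<Longrightarrow> 0 \<le> X i \<omega>"
    and X': "\<And>i. i \<in> I \<Longrightarrow> X' i \<in> borel_measurable N" "\<And>i. i \<in> I \<Longrightarrow> AE \<omega> in N. 0 \<le> X' i \<omega>"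
    and eq: "\<And>l. (\<And>i. 0 \<le> l i) \<Longrightarrow>
      (\<integral>\<^sup>+\<omega>. ennreal (exp (- (\<Sum>i\<in>I. l i * X i \<omega>))) \<partial>M) = (\<integral>\<^sup>+\<omega>. ennreal (exp (- (\<Sum>i\<in>I. l i * X' i \<omega>))) \<partial>N)"
  shows "distr M (\<Pi>\<^sub>M i\<in>I. borel) (\<lambda>\<omega>. \<lambda>i\<in>I. X i \<omega>) = distr N (\<Pi>\<^sub>M i\<in>I. borel) (\<lambda>\<omega>. \<lambda>i\<in>I. X' i \<omega>)"
proof (rule distr_PiM_eqI[OF I M X(1) X'(1)])
  define G where "G = range (\<lambda>k::nat. \<lambda>y. ennreal (exp (- real k * y)))"
  fix A :: "'i \<Rightarrow> real set" assume A: "\<And>i. i \<in> I \<Longrightarrow> A i \<in> sets borel"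
  show "(\<integral>\<^sup>+\<omega>. (\<Prod>i\<in>I. indicator (A i) (X i \<omega>)) \<partial>M) = (\<integral>\<^sup>+\<omega>. (\<Prod>i\<in>I. indicator (A i) (X' i \<omega>)) \<partial>N)"
  proof (rule joint_law_determined[where G=G and X=X and X'=X' and f="\<lambda>i. indicator (A i)", OF I _ _ _ M N X X'])
    fix \<mu> \<nu> :: "real measure"
    assume "sets \<mu> = sets borel" "sets \<nu> = sets borel" "finite_measure \<mu>" "finite_measure \<nu>"
      "emeasure \<mu> {..<0} = 0" "emeasure \<nu> {..<0} = 0"
      "\<And>g. g \<in> G \<Longrightarrow> (\<integral>\<^sup>+x. g x \<partial>\<mu>) = (\<integral>\<^sup>+x. g x \<partial>\<nu>)"
    then show "\<mu> = \<nu>" by (intro laplace_determines_measure) (auto simp: G_def)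
  next
    fix g assume "\<And>i. i \<in> I \<Longrightarrow> g i \<in> G"
    then have "\<forall>i\<in>I. \<exists>k::nat. g i = (\<lambda>y. ennreal (exp (- real k * y)))" by (auto simp: G_def)
    then obtain k :: "'i \<Rightarrow> nat" where "\<forall>i\<in>I. g i = (\<lambda>y. ennreal (exp (- real (k i) * y)))" by metis
    then have k: "(\<Prod>i\<in>I. g i (x i)) = ennreal (exp (- (\<Sum>i\<in>I. real (k i) * x i)))" for x
      using I by (simp add: prod_ennreal exp_sum[symmetric] sum_negf)
    show "(\<integral>\<^sup>+\<omega>. (\<Prod>i\<in>I. g i (X i \<omega>)) \<partial>M) = (\<integral>\<^sup>+\<omega>. (\<Prod>i\<in>I. g i (X' i \<omega>)) \<partial>N)"
      unfolding k using eq[of "\<lambda>i. real (k i)"] by simp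
  qed (use A in \<open>auto simp: G_def indicator_def\<close>)
qed auto

section \<open>The jump chain and the Green function\<close>

abbreviation exponential_law :: "real \<Rightarrow> real measure" where
  "exponential_law d \<equiv> density lborel (exponential_density d)"

lemma exponential_law_tail:
  assumes d: "0 < d"
  shows "emeasure (exponential_law d) {s<..} = ennreal (exp (- d * max 0 s))"
proof -
  interpret prob_space "exponential_law d" using d by (rule prob_space_exponential_density)
  have "distributed (exponential_law d) lborel (\<lambda>x. x) (exponential_density d)"
    unfolding distributed_def by (auto simp: distr_id2)
  from exponential_distributedD_gt[OF this _ d] have p: "prob {x. a < x} = exp (- a * d)" if "0 \<le> a" for a
    using that by simp
  have "prob {max 0 s<..} = exp (- d * max 0 s)"
    unfolding greaterThan_def by (subst p) (auto simp: mult.commute)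
  moreover have "emeasure (exponential_law d) {s<..} = emeasure (exponential_law d) {max 0 s<..}"
  proof (rule emeasure_eq_AE)
    have "AE x in lborel. x \<noteq> (0::real)" by (rule AE_lborel_singleton)
    then show "AE x in exponential_law d. x \<in> {s<..} \<longleftrightarrow> x \<in> {max 0 s<..}"
      by (subst AE_density) (auto elim!: eventually_mono simp: erlang_density_def)
  qed auto
  ultimately show ?thesis by (simp add: emeasure_eq_measure)
qed

lemma exponential_law_laplace:
  assumes d: "0 < d" and l: "0 \<le> l"
  shows "(\<integral>\<^sup>+x. ennreal (exp (- l * x)) \<partial>exponential_law d) = ennreal (d / (d + l))"
proof -
  have e: "exponential_density d x * exp (- l * x) = d / (d + l) * exponential_density (d + l) x" for x
  proof -
    have "exp (- d * x) * exp (- l * x) = exp (- (d + l) * x)" by (simp add: exp_add[symmetric] algebra_simps)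
    moreover have "d + l \<noteq> 0" using d l by simp
    ultimately show ?thesis by (simp add: erlang_density_def mult.assoc)
  qed
  have "(\<integral>\<^sup>+x. ennreal (exp (- l * x)) \<partial>exponential_law d)
      = (\<integral>\<^sup>+x. ennreal (exponential_density d x * exp (- l * x)) \<partial>lborel)"
    using d by (simp add: nn_integral_density ennreal_mult[symmetric])
  also have "\<dots> = ennreal (d / (d + l)) * (\<integral>\<^sup>+x. ennreal (exponential_density (d + l) x) \<partial>lborel)"
    unfolding e using d l by (subst nn_integral_cmult[symmetric]) (auto simp: ennreal_mult[symmetric] intro!: nn_integral_cong)
  also have "(\<integral>\<^sup>+x. ennreal (exponential_density (d + l) x) \<partial>lborel) = 1"
    using prob_space.emeasure_space_1[OF prob_space_exponential_density[of "d+l"]] d l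
    by (simp add: emeasure_density)
  finally show ?thesis by simp
qed

section \<open>Neighbours and degrees in the tree\<close>

lemma sum_tree_nbrs:
  assumes v: "v \<in> tree_vertices b n"
  shows "(\<Sum>w\<in>tree_nbrs b n v. f w) =
    (if length v < n then \<Sum>i<b. f (v @ [i]) else 0) + (if v = [] then 0 else f (butlast v) :: real)"
proof -
  have eq: "tree_nbrs b n v = (if length v < n then (\<lambda>i. v @ [i]) ` {..<b} else {}) \<union> (if v = [] then {} else {butlast v})"
  proof (rule set_eqI)
    fix w
    have "(\<exists>i. v = w @ [i]) \<longleftrightarrow> v \<noteq> [] \<and> w = butlast v"
      by (metis append_butlast_last_id butlast_snoc snoc_eq_iff_butlast)
    moreover have "set (butlast v) \<subseteq> {..<b}" using v unfolding tree_vertices_def by (auto dest: in_set_butlastD)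
    ultimately show "w \<in> tree_nbrs b n v \<longleftrightarrow> w \<in> (if length v < n then (\<lambda>i. v @ [i]) ` {..<b} else {}) \<union> (if v = [] then {} else {butlast v})"
      using v by (auto simp: tree_nbrs_def tree_vertices_def)
  qed
  have d: "butlast v \<noteq> v @ [i]" for i using length_butlast[of v] by (metis length_append_singleton diff_le_self Suc_n_not_le_n)
  then have d: "butlast v \<notin> (\<lambda>i. v @ [i]) ` {..<b}" by blast
  have "(\<Sum>w\<in>(\<lambda>i. v @ [i]) ` {..<b}. f w) = (\<Sum>i<b. f (v @ [i]))"
    by (subst sum.reindex) (auto simp: inj_on_def)
  then show ?thesis unfolding eq using d by auto
qed

lemma card_tree_nbrs:
  assumes v: "v \<in> tree_vertices b n"
  shows "real (card (tree_nbrs b n v)) = (if length v < n then real b else 0) + (if v = [] then 0 else 1)"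
  using sum_tree_nbrs[OF v, of "\<lambda>_. 1"] by simp

lemma finite_tree_vertices: "finite (tree_vertices b n)"
proof -
  have "tree_vertices b n = (\<Union>k\<le>n. {v. set v \<subseteq> {..<b} \<and> length v = k})" by (auto simp: tree_vertices_def)
  then show ?thesis by (simp add: finite_lists_length_eq)
qed


text \<open>
  The exponent of the Laplace transform of the local times is an effective conductance to the
  cemetery: \<open>f / (1 + f)\<close> is the unit conductance of an edge in series with the conductance \<open>f\<close> of
  the subtree above it.
\<close>

primrec Phi :: "nat \<Rightarrow> nat \<Rightarrow> (nat list \<Rightarrow> real) \<Rightarrow> real" where
  "Phi b 0 l = l []"
| "Phi b (Suc n) l = l [] + (\<Sum>i<b. Phi b n (\<lambda>x. l (i # x)) / (1 + Phi b n (\<lambda>x. l (i # x))))"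

lemma Phi_ge: "(\<And>x. 0 \<le> l x) \<Longrightarrow> l [] \<le> Phi b n l"
proof (induction n arbitrary: l)
  case (Suc n)
  have "0 \<le> Phi b n (\<lambda>x. l (i # x))" for i
    using Suc.IH[of "\<lambda>x. l (i # x)"] Suc.prems[of "[i]"] Suc.prems by (meson order_trans)
  then show ?case by (auto intro!: sum_nonneg divide_nonneg_nonneg)
qed simp

lemma Phi_nonneg: "(\<And>x. 0 \<le> l x) \<Longrightarrow> 0 \<le> Phi b n l"
  using Phi_ge order_trans by blast

text \<open>Conductance to the cemetery of the subtree above \<open>v\<close>, with vertices
  addressed from the root of the whole tree, so that the Green function can be written as a product
  along the path to \<open>v\<close>.\<close>

definition subtree_Phi :: "nat \<Rightarrow> nat \<Rightarrow> (nat list \<Rightarrow> real) \<Rightarrow> nat list \<Rightarrow> real" where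
  "subtree_Phi b n l v = Phi b (n - length v) (\<lambda>x. l (v @ x))"

lemma subtree_Phi_rec:
  assumes "length v \<le> n"
  shows "subtree_Phi b n l v = l v + (if length v < n then \<Sum>i<b. subtree_Phi b n l (v @ [i]) / (1 + subtree_Phi b n l (v @ [i])) else 0)"
proof (cases "n - length v")
  case (Suc m)
  then have "n - Suc (length v) = m" by simp
  with Suc show ?thesis by (auto simp: subtree_Phi_def)
qed (use assms in \<open>auto simp: subtree_Phi_def\<close>)

text \<open>The Green function \<open>(D + l - A)\<^sup>-\<^sup>1\<close> of the tree, evaluated at \<open>v\<close> and the root.\<close>

definition green :: "nat \<Rightarrow> nat \<Rightarrow> (nat list \<Rightarrow> real) \<Rightarrow> nat list \<Rightarrow> real" where
  "green b n l v = (\<Prod>j\<in>{1..length v}. 1 / (1 + subtree_Phi b n l (take j v))) / Phi b n l"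

lemma green_snoc: "green b n l (v @ [i]) = green b n l v / (1 + subtree_Phi b n l (v @ [i]))"
proof -
  have "(\<Prod>j\<in>{1..length v}. 1 / (1 + subtree_Phi b n l (take j (v @ [i]))))
      = (\<Prod>j\<in>{1..length v}. 1 / (1 + subtree_Phi b n l (take j v)))"
    by (rule prod.cong) auto
  then show ?thesis by (simp add: green_def)
qed

lemma green_nonneg:
  assumes l: "\<And>x. 0 \<le> l x"
  shows "0 \<le> green b n l v"
  unfolding green_def subtree_Phi_def
  by (intro divide_nonneg_nonneg prod_nonneg ballI add_nonneg_nonneg Phi_nonneg l) auto

lemma green_le:
  assumes l: "\<And>x. 0 \<le> l x"
  shows "green b n l v \<le> 1 / Phi b n l"
proof -
  have "0 \<le> subtree_Phi b n l u" for u unfolding subtree_Phi_def by (rule Phi_nonneg) (rule l)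
  then have "(\<Prod>j\<in>{1..length v}. 1 / (1 + subtree_Phi b n l (take j v))) \<le> 1"
    by (intro prod_le_1) (auto simp: add_nonneg_nonneg divide_le_eq_1 add_nonneg_pos)
  then show ?thesis unfolding green_def by (intro divide_right_mono Phi_nonneg l)
qed

text \<open>With \<open>f\<close> the conductance at \<open>v\<close> and \<open>c\<close> its
  number of children, the recursion for \<open>f\<close> makes the children contribute
  \<open>c - f + l v\<close> times the value at \<open>v\<close>, and the parent contributes
  \<open>1 + f\<close> times it, so \<open>f\<close> cancels. At the root the missing parent is
  replaced by the unit source, since there the value times \<open>f\<close> is 1.\<close>

lemma green_eq:
  assumes l: "\<And>x. 0 \<le> l x" and l0: "0 < l []" and v: "v \<in> tree_vertices b n"
  shows "(\<Sum>w\<in>tree_nbrs b n v. green b n l w) + (if v = [] then 1 else 0) =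
    (real (card (tree_nbrs b n v)) + l v) * green b n l v"
proof -
  define c where "c = (if length v < n then real b else 0)"
  let ?p = "subtree_Phi b n l" and ?g = "green b n l"
  have p: "0 \<le> ?p u" for u unfolding subtree_Phi_def by (rule Phi_nonneg) (rule l)
  have lv: "length v \<le> n" using v by (simp add: tree_vertices_def)
  have "(\<Sum>i<b. ?g (v @ [i])) = ?g v * (real b - (\<Sum>i<b. ?p (v @ [i]) / (1 + ?p (v @ [i]))))"
  proof -
    have "?g (v @ [i]) = ?g v - ?g v * (?p (v @ [i]) / (1 + ?p (v @ [i])))" for i
      using p[of "v @ [i]"] by (simp add: green_snoc field_simps add_nonneg_eq_0_iff)
    then have "(\<Sum>i<b. ?g (v @ [i])) = (\<Sum>i<b. ?g v - ?g v * (?p (v @ [i]) / (1 + ?p (v @ [i]))))"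
      by simp
    then show ?thesis by (simp only: sum_subtractf sum_distrib_left[symmetric] right_diff_distrib) simp
  qed
  then have ch: "(if length v < n then \<Sum>i<b. ?g (v @ [i]) else 0) = ?g v * (c - ?p v + l v)"
    using subtree_Phi_rec[OF lv, of b l] by (auto simp: c_def)
  show ?thesis
  proof (cases v rule: rev_cases)
    case Nil
    have "?g [] * ?p [] = 1"
    proof -
      have "l [] \<le> Phi b n l" by (rule Phi_ge) (rule l)
      then show ?thesis using l0 by (simp add: green_def subtree_Phi_def)
    qed
    then show ?thesis unfolding sum_tree_nbrs[OF v] card_tree_nbrs[OF v] ch
      using Nil by (simp add: c_def algebra_simps)
  next
    case (snoc u i)
    then have "?g (butlast v) = ?g v * (1 + ?p v)" using p[of v] green_snoc[of b n l u i] by (simp add: field_simps)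
    then show ?thesis unfolding sum_tree_nbrs[OF v] card_tree_nbrs[OF v] ch
      using snoc by (simp add: c_def algebra_simps)
  qed
qed

section \<open>The killed jump chain\<close>

text \<open>The jump chain and holding times hidden in the existential of \<open>tree_walk\<close>
  become parameters; \<open>n \<ge> 1\<close> gives every vertex, in particular the root, a positive
  degree.\<close>

locale tree_path = prob_space M
  for b n :: nat and M :: "'a measure" and X :: "real \<Rightarrow> 'a \<Rightarrow> nat list"
    and Y :: "nat \<Rightarrow> 'a \<Rightarrow> nat list" and S :: "nat \<Rightarrow> 'a \<Rightarrow> real" +
  assumes b: "2 \<le> b" and n: "1 \<le> n"
    and Y_measurable: "\<And>k. Y k \<in> measurable M (count_space (tree_vertices b n))"
    and S_measurable[measurable]: "\<And>k. S k \<in> borel_measurable M"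
    and S_pos: "\<And>\<omega> k. \<omega> \<in> space M \<Longrightarrow> 0 < S k \<omega>"
    and jump_times_unbounded: "\<And>\<omega>. \<omega> \<in> space M \<Longrightarrow> filterlim (\<lambda>k. \<Sum>i<k. S i \<omega>) at_top sequentially"
    and skeleton_law: "\<And>k (v :: nat \<Rightarrow> nat list) (s :: nat \<Rightarrow> real). (\<And>i. i \<le> k \<Longrightarrow> 0 \<le> s i) \<Longrightarrow>
        measure M {\<omega>\<in>space M. \<forall>i\<le>k. Y i \<omega> = v i \<and> s i < S i \<omega>} =
          (if v 0 = [] then 1 else 0) *
          (\<Prod>i<k. if v (Suc i) \<in> tree_nbrs b n (v i) then 1 / real (card (tree_nbrs b n (v i))) else 0) *
          (\<Prod>i\<le>k. exp (- real (card (tree_nbrs b n (v i))) * s i))"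
    and path_eq: "\<And>\<omega> t k. \<omega> \<in> space M \<Longrightarrow> 0 \<le> t \<Longrightarrow> (\<Sum>i<k. S i \<omega>) \<le> t \<Longrightarrow> t < (\<Sum>i<Suc k. S i \<omega>) \<Longrightarrow> X t \<omega> = Y k \<omega>"

lemma tree_walkE:
  assumes "tree_walk b n M X" "2 \<le> b" "1 \<le> n"
  obtains Y S where "tree_path b n M X Y S"
proof -
  from assms(1)[unfolded tree_walk_def] obtain Y S where
    "prob_space M"
    "\<forall>k. Y k \<in> measurable M (count_space (tree_vertices b n))"
    "\<forall>k. S k \<in> borel_measurable M"
    "\<forall>\<omega>\<in>space M. (\<forall>k. 0 < S k \<omega>) \<and> filterlim (\<lambda>k. \<Sum>i<k. S i \<omega>) at_top sequentially"
    "\<forall>k (v :: nat \<Rightarrow> nat list) (s :: nat \<Rightarrow> real). (\<forall>i\<le>k. 0 \<le> s i) \<longrightarrow>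
        measure M {\<omega>\<in>space M. \<forall>i\<le>k. Y i \<omega> = v i \<and> s i < S i \<omega>} =
          (if v 0 = [] then 1 else 0) *
          (\<Prod>i<k. if v (Suc i) \<in> tree_nbrs b n (v i) then 1 / real (card (tree_nbrs b n (v i))) else 0) *
          (\<Prod>i\<le>k. exp (- real (card (tree_nbrs b n (v i))) * s i))"
    "\<forall>\<omega>\<in>space M. \<forall>t\<ge>0. \<forall>k.
        (\<Sum>i<k. S i \<omega>) \<le> t \<and> t < (\<Sum>i<Suc k. S i \<omega>) \<longrightarrow> X t \<omega> = Y k \<omega>"
    by (elim conjE exE) blast
  with assms(2,3) show thesis
    by (intro that[of Y S] tree_path.intro tree_path_axioms.intro) blast+
qed

context tree_path
begin

abbreviation "V \<equiv> tree_vertices b n"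
abbreviation "deg v \<equiv> real (card (tree_nbrs b n v))"

lemma deg_pos: "v \<in> V \<Longrightarrow> 0 < deg v"
  using b n by (auto simp: card_tree_nbrs)

lemma Y_in: "\<omega> \<in> space M \<Longrightarrow> Y k \<omega> \<in> V"
  using measurable_space[OF Y_measurable[of k]] by simp

lemma Y_eq_measurable[measurable]: "Measurable.pred M (\<lambda>\<omega>. Y k \<omega> = v)"
proof -
  have "Y k -` ({v} \<inter> V) \<inter> space M \<in> sets M"
    by (rule measurable_sets[OF Y_measurable]) auto
  also have "Y k -` ({v} \<inter> V) \<inter> space M = {\<omega>\<in>space M. Y k \<omega> = v}" using Y_in by auto
  finally show ?thesis by (simp add: pred_def)
qed

lemma borel_measurable_Y[measurable]: "(\<lambda>\<omega>. f (Y k \<omega>) :: real) \<in> borel_measurable M"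
  by (rule measurable_compose[OF Y_measurable]) (simp add: measurable_count_space_eq1)

text \<open>Probability that the jump chain follows \<open>v\<close> for \<open>k\<close> steps; it
  vanishes unless these form a nearest-neighbour path from the root.\<close>

definition path_weight :: "(nat \<Rightarrow> nat list) \<Rightarrow> nat \<Rightarrow> real" where
  "path_weight v k = (if v 0 = [] then 1 else 0) *
    (\<Prod>i<k. if v (Suc i) \<in> tree_nbrs b n (v i) then 1 / deg (v i) else 0)"

lemma path_weight_nonneg: "0 \<le> path_weight v k"
  unfolding path_weight_def by (auto intro!: mult_nonneg_nonneg prod_nonneg)

text \<open>Given the visited vertices, the holding times are independent exponentials with the
  degrees as rates. The law of the walk says so for tails only; \<open>joint_law_determined\<close>
  extends it to products of bounded functions.\<close>

lemma holding_times_law: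
  assumes v: "\<And>i. v i \<in> V"
    and f: "\<And>i. i \<le> k \<Longrightarrow> f i \<in> borel_measurable borel" "\<And>i x. i \<le> k \<Longrightarrow> f i x \<le> (1::ennreal)"
  shows "(\<integral>\<^sup>+\<omega>. indicator {\<omega>\<in>space M. \<forall>i\<le>k. Y i \<omega> = v i} \<omega> * (\<Prod>i\<le>k. f i (S i \<omega>)) \<partial>M) =
    ennreal (path_weight v k) * (\<Prod>i\<le>k. \<integral>\<^sup>+x. f i x \<partial>exponential_law (deg (v i)))"
proof -
  define A where "A = {\<omega>\<in>space M. \<forall>i\<le>k. Y i \<omega> = v i}"
  have [measurable]: "A \<in> sets M" unfolding A_def by measurable
  let ?E = "\<lambda>i. exponential_law (deg (v i))"
  interpret E: prob_space "?E i" for i using deg_pos[OF v] by (rule prob_space_exponential_density)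
  interpret product_sigma_finite ?E ..
  define N where "N = density (PiM {..k} ?E) (\<lambda>_. ennreal (path_weight v k))"
  interpret PE: prob_space "PiM {..k} ?E" by (rule prob_space_PiM) (rule E.prob_space_axioms)
  have N: "(\<integral>\<^sup>+\<omega>. (\<Prod>i\<le>k. g i (\<omega> i)) \<partial>N) = ennreal (path_weight v k) * (\<Prod>i\<le>k. \<integral>\<^sup>+x. g i x \<partial>?E i)"
    if [measurable]: "\<And>i. i \<le> k \<Longrightarrow> g i \<in> borel_measurable borel" for g
  proof -
    have [measurable]: "(\<lambda>\<omega>. \<Prod>i\<le>k. g i (\<omega> i)) \<in> borel_measurable (PiM {..k} ?E)"
      by (intro borel_measurable_prod_ennreal measurable_compose[OF measurable_component_singleton]) (auto intro: that)
    have "(\<integral>\<^sup>+\<omega>. (\<Prod>i\<le>k. g i (\<omega> i)) \<partial>N) = ennreal (path_weight v k) * (\<integral>\<^sup>+\<omega>. (\<Prod>i\<le>k. g i (\<omega> i)) \<partial>PiM {..k} ?E)"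
      unfolding N_def by (subst nn_integral_density) (auto intro!: nn_integral_cmult)
    also have "(\<integral>\<^sup>+\<omega>. (\<Prod>i\<le>k. g i (\<omega> i)) \<partial>PiM {..k} ?E) = (\<Prod>i\<le>k. \<integral>\<^sup>+x. g i x \<partial>?E i)"
      by (rule product_nn_integral_prod) auto
    finally show ?thesis .
  qed
  have M: "(\<integral>\<^sup>+\<omega>. (\<Prod>i\<le>k. g i (S i \<omega>)) \<partial>density M (indicator A)) = (\<integral>\<^sup>+\<omega>. indicator A \<omega> * (\<Prod>i\<le>k. g i (S i \<omega>)) \<partial>M)"
    if [measurable]: "\<And>i. i \<le> k \<Longrightarrow> g i \<in> borel_measurable borel" for g
    by (subst nn_integral_density) (auto intro!: borel_measurable_prod_ennreal measurable_compose[OF S_measurable that])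
  have "(\<integral>\<^sup>+\<omega>. (\<Prod>i\<le>k. f i (S i \<omega>)) \<partial>density M (indicator A)) = (\<integral>\<^sup>+\<omega>. (\<Prod>i\<le>k. f i (\<omega> i)) \<partial>N)"
  proof (rule joint_law_determined[where G="range (\<lambda>s. indicator {s<..})" and X="\<lambda>i. S i" and X'="\<lambda>i \<omega>. \<omega> i"])
    fix \<mu> \<nu> :: "real measure"
    assume "sets \<mu> = sets borel" "sets \<nu> = sets borel" "finite_measure \<mu>" "finite_measure \<nu>"
      "\<And>g. g \<in> range (\<lambda>s. indicator {s<..} :: real \<Rightarrow> ennreal) \<Longrightarrow> (\<integral>\<^sup>+x. g x \<partial>\<mu>) = (\<integral>\<^sup>+x. g x \<partial>\<nu>)"
    note * = this
    from this(5)[of "indicator {s<..}" for s] this(1,2) have "emeasure \<mu> {s<..} = emeasure \<nu> {s<..}" for s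
      by (auto simp: image_iff)
    then show "\<mu> = \<nu>" using * by (intro tails_determine_measure) auto
  next
    have "emeasure (density M (indicator A)) (space M) \<le> 1"
      by (simp add: emeasure_density emeasure_le_1 cong: nn_integral_cong)
    then show "finite_measure (density M (indicator A))"
      by (intro finite_measureI) (auto simp: top_unique)
    show "finite_measure N"
      by (intro finite_measureI) (simp add: N_def emeasure_density PE.emeasure_space_1 ennreal_mult_eq_top_iff)
    show "AE \<omega> in N. 0 \<le> \<omega> i" if i: "i \<in> {..k}" for i
    proof -
      have "AE x in ?E i. 0 \<le> x" by (subst AE_density) (auto simp: erlang_density_def)
      from AE_PiM_component[where M="?E", OF E.prob_space_axioms i this]
      show ?thesis unfolding N_def by (subst AE_density) (auto elim: eventually_mono)
    qed
    fix g :: "nat \<Rightarrow> real \<Rightarrow> ennreal" assume "\<And>i. i \<in> {..k} \<Longrightarrow> g i \<in> range (\<lambda>s. indicator {s<..})"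
    then have "\<forall>i. \<exists>s. i \<le> k \<longrightarrow> g i = indicator {s<..}" by auto
    then obtain s where s: "\<And>i. i \<le> k \<Longrightarrow> g i = indicator {s i<..}" by metis
    have gm: "\<And>i. i \<le> k \<Longrightarrow> g i \<in> borel_measurable borel" by (simp add: s)
    have "(\<integral>\<^sup>+\<omega>. indicator A \<omega> * (\<Prod>i\<le>k. g i (S i \<omega>)) \<partial>M)
        = (\<integral>\<^sup>+\<omega>. indicator {\<omega>\<in>space M. \<forall>i\<le>k. Y i \<omega> = v i \<and> max 0 (s i) < S i \<omega>} \<omega> \<partial>M)"
    proof (rule nn_integral_cong)
      fix \<omega> assume w: "\<omega> \<in> space M"
      \<comment> \<open>Negative levels may be raised to 0 because holding times are positive;
        \<open>skeleton_law\<close> speaks of levels at least 0 only.\<close>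
      have "(\<Prod>i\<le>k. g i (S i \<omega>)) = (\<Prod>i\<le>k. indicator {max 0 (s i)<..} (S i \<omega>))"
        by (rule prod.cong) (auto simp: s indicator_def S_pos[OF w])
      also have "\<dots> = (if \<forall>i\<le>k. max 0 (s i) < S i \<omega> then 1 else 0)"
        by (auto simp: indicator_def)
      finally show "indicator A \<omega> * (\<Prod>i\<le>k. g i (S i \<omega>)) = indicator {\<omega>\<in>space M. \<forall>i\<le>k. Y i \<omega> = v i \<and> max 0 (s i) < S i \<omega>} \<omega>"
        using w by (auto simp: A_def indicator_def)
    qed
    also have "\<dots> = ennreal (measure M {\<omega>\<in>space M. \<forall>i\<le>k. Y i \<omega> = v i \<and> max 0 (s i) < S i \<omega>})"
      by (subst nn_integral_indicator) (auto simp: emeasure_eq_measure)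
    also have "\<dots> = ennreal (path_weight v k * (\<Prod>i\<le>k. exp (- deg (v i) * max 0 (s i))))"
      by (subst skeleton_law) (auto simp: path_weight_def)
    also have "\<dots> = ennreal (path_weight v k) * (\<Prod>i\<le>k. ennreal (exp (- deg (v i) * max 0 (s i))))"
      by (simp add: ennreal_mult path_weight_nonneg prod_nonneg prod_ennreal)
    also have "\<dots> = ennreal (path_weight v k) * (\<Prod>i\<le>k. \<integral>\<^sup>+x. g i x \<partial>?E i)"
      by (intro arg_cong2[where f=times] prod.cong)
        (auto simp: s exponential_law_tail[OF deg_pos[OF v]])
    finally show "(\<integral>\<^sup>+\<omega>. (\<Prod>i\<in>{..k}. g i (S i \<omega>)) \<partial>density M (indicator A)) = (\<integral>\<^sup>+\<omega>. (\<Prod>i\<in>{..k}. g i (\<omega> i)) \<partial>N)"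
      using M[OF gm] N[OF gm] by simp
  qed (use f S_pos in \<open>auto simp: indicator_def less_imp_le N_def cong: measurable_cong_sets\<close>)
  then show ?thesis using M[OF f(1)] N[OF f(1)] by (simp add: A_def)
qed


text \<open>Conditional probability, given the path, that a walk killed at rate \<open>l x\<close>
  while at \<open>x\<close> survives its first \<open>k\<close> holding times.\<close>

definition killed :: "(nat list \<Rightarrow> real) \<Rightarrow> nat \<Rightarrow> 'a \<Rightarrow> ennreal" where
  "killed l k \<omega> = (\<Prod>i<k. ennreal (exp (- l (Y i \<omega>) * S i \<omega>)))"

lemma killed_measurable[measurable]: "killed l k \<in> borel_measurable M"
  unfolding killed_def by measurable

text \<open>Law of the killed chain at step \<open>k\<close>; the mass lost is the probability of
  having been killed before.\<close>

definition occupancy :: "(nat list \<Rightarrow> real) \<Rightarrow> nat \<Rightarrow> nat list \<Rightarrow> ennreal" where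
  "occupancy l k v = (\<integral>\<^sup>+\<omega>. indicator {\<omega>\<in>space M. Y k \<omega> = v} \<omega> * killed l k \<omega> \<partial>M)"

text \<open>The Markov property at a jump: the holding time at step \<open>k\<close> is exponential
  and independent of the past, and the next vertex is uniform among the neighbours and independent
  of both. It comes from summing \<open>holding_times_law\<close> over the finitely many histories
  of length \<open>k\<close>.\<close>

lemma occupancy_decompose:
  assumes v: "v \<in> V" and l: "\<And>x. 0 \<le> l x"
    and phi[measurable]: "\<phi> \<in> borel_measurable borel" "\<And>x. \<phi> x \<le> (1::ennreal)"
  shows "(\<integral>\<^sup>+\<omega>. indicator {\<omega>\<in>space M. Y k \<omega> = v} \<omega> * killed l k \<omega> * \<phi> (S k \<omega>) \<partial>M) =
      occupancy l k v * (\<integral>\<^sup>+x. \<phi> x \<partial>exponential_law (deg v))" (is ?one)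
    and "w \<in> V \<Longrightarrow> (\<integral>\<^sup>+\<omega>. indicator {\<omega>\<in>space M. Y k \<omega> = v \<and> Y (Suc k) \<omega> = w} \<omega> * killed l k \<omega> * \<phi> (S k \<omega>) \<partial>M) =
      occupancy l k v * (if w \<in> tree_nbrs b n v then ennreal (1 / deg v) else 0) * (\<integral>\<^sup>+x. \<phi> x \<partial>exponential_law (deg v))" (is "_ \<Longrightarrow> ?two")
proof -
  let ?E = "\<lambda>v. exponential_law (deg v)"
  have E1: "(\<integral>\<^sup>+x. 1 \<partial>?E u) = 1" if "u \<in> V" for u
    using prob_space.emeasure_space_1[OF prob_space_exponential_density[OF deg_pos[OF that]]] by simp
  define Hs where "Hs = ({..<k} \<rightarrow>\<^sub>E V)"
  have fin: "finite Hs" unfolding Hs_def using finite_tree_vertices by (intro finite_PiE) auto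
  \<comment> \<open>The history, followed by \<open>v\<close> at index \<open>k\<close> and by
    \<open>w\<close> at all later ones, so that one family of paths serves both claims.\<close>
  define p where "p h w = (\<lambda>i. if i < k then h i else if i = k then v else w)" for h :: "nat \<Rightarrow> nat list" and w
  have pV: "p h w i \<in> V" if "h \<in> Hs" "w \<in> V" for h w i using that v by (auto simp: p_def Hs_def)
  define F where "F h \<omega> = (\<Prod>i<k. ennreal (exp (- l (h i) * S i \<omega>)))" for h \<omega>
  define A where "A h = {\<omega>\<in>space M. \<forall>i<k. Y i \<omega> = h i}" for h
  have [measurable]: "A h \<in> sets M" for h unfolding A_def by measurable
  have [measurable]: "F h \<in> borel_measurable M" for h unfolding F_def by measurable
  define c where "c h = (\<Prod>i<k. \<integral>\<^sup>+x. ennreal (exp (- l (h i) * x)) \<partial>?E (h i))" for h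
  \<comment> \<open>The indicator keeps the factor at most 1 on the negative axis, as
    \<open>holding_times_law\<close> demands, and equals 1 at the actual holding times. Beyond
    \<open>k\<close> the holding times are left free.\<close>
  define f where "f h \<psi> = (\<lambda>i x. if i < k then indicator {0..} x * ennreal (exp (- l (h i) * x)) else if i = k then \<psi> x else 1)" for h and \<psi> :: "real \<Rightarrow> ennreal"
  have fm: "f h \<psi> i \<in> borel_measurable borel" if [measurable]: "\<psi> \<in> borel_measurable borel" for h \<psi> i
    unfolding f_def by (cases "i < k"; cases "i = k") simp_all
  have fb: "f h \<psi> i x \<le> 1" if "\<And>x. \<psi> x \<le> 1" for h \<psi> i x
    using that l by (auto simp: f_def indicator_def)
  have fE: "(\<integral>\<^sup>+x. f h \<psi> i x \<partial>?E u) = (\<integral>\<^sup>+x. ennreal (exp (- l (h i) * x)) \<partial>?E u)" if "i < k" for h \<psi> i u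
  proof (rule nn_integral_cong_AE)
    have "AE x in ?E u. 0 \<le> x" by (subst AE_density) (auto simp: erlang_density_def)
    then show "AE x in ?E u. f h \<psi> i x = ennreal (exp (- l (h i) * x))"
      using that by (auto simp: f_def elim!: eventually_mono)
  qed
  have fP: "(\<Prod>i\<le>k. f h \<psi> i (S i \<omega>)) = F h \<omega> * \<psi> (S k \<omega>)" if "\<omega> \<in> space M" for h \<psi> \<omega>
  proof -
    have "(\<Prod>i<k. f h \<psi> i (S i \<omega>)) = F h \<omega>"
      unfolding F_def by (rule prod.cong) (auto simp: f_def indicator_def S_pos[OF that] less_imp_le)
    then show ?thesis by (simp add: f_def lessThan_Suc_atMost[symmetric])
  qed
  have one: "(\<integral>\<^sup>+\<omega>. indicator {\<omega>\<in>space M. Y k \<omega> = v} \<omega> * indicator (A h) \<omega> * F h \<omega> * \<psi> (S k \<omega>) \<partial>M) =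
      ennreal (path_weight (p h v) k) * c h * (\<integral>\<^sup>+x. \<psi> x \<partial>?E v)"
    if h: "h \<in> Hs" and [measurable]: "\<psi> \<in> borel_measurable borel" and b: "\<And>x. \<psi> x \<le> 1" for h and \<psi> :: "real \<Rightarrow> ennreal"
  proof -
    have "(\<integral>\<^sup>+\<omega>. indicator {\<omega>\<in>space M. Y k \<omega> = v} \<omega> * indicator (A h) \<omega> * F h \<omega> * \<psi> (S k \<omega>) \<partial>M)
      = (\<integral>\<^sup>+\<omega>. indicator {\<omega>\<in>space M. \<forall>i\<le>k. Y i \<omega> = p h v i} \<omega> * (\<Prod>i\<le>k. f h \<psi> i (S i \<omega>)) \<partial>M)"
      by (rule nn_integral_cong) (auto simp: fP A_def p_def indicator_def mult.assoc)
    also have "\<dots> = ennreal (path_weight (p h v) k) * (\<Prod>i\<le>k. \<integral>\<^sup>+x. f h \<psi> i x \<partial>?E (p h v i))"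
      using pV[OF h v] fm fb b by (intro holding_times_law) auto
    also have "(\<Prod>i\<le>k. \<integral>\<^sup>+x. f h \<psi> i x \<partial>?E (p h v i)) = c h * (\<integral>\<^sup>+x. \<psi> x \<partial>?E v)"
    proof -
      have "(\<Prod>i<k. \<integral>\<^sup>+x. f h \<psi> i x \<partial>?E (p h v i)) = c h"
        unfolding c_def by (rule prod.cong) (auto simp: fE p_def)
      then show ?thesis by (simp add: f_def p_def lessThan_Suc_atMost[symmetric])
    qed
    finally show ?thesis by (simp add: mult.assoc)
  qed
  have two: "(\<integral>\<^sup>+\<omega>. indicator {\<omega>\<in>space M. Y k \<omega> = v \<and> Y (Suc k) \<omega> = w} \<omega> * indicator (A h) \<omega> * F h \<omega> * \<psi> (S k \<omega>) \<partial>M) =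
      ennreal (path_weight (p h v) k) * (if w \<in> tree_nbrs b n v then ennreal (1 / deg v) else 0) * c h * (\<integral>\<^sup>+x. \<psi> x \<partial>?E v)"
    if h: "h \<in> Hs" and w: "w \<in> V" and [measurable]: "\<psi> \<in> borel_measurable borel" and b: "\<And>x. \<psi> x \<le> 1" for h w and \<psi> :: "real \<Rightarrow> ennreal"
  proof -
    have "(\<integral>\<^sup>+\<omega>. indicator {\<omega>\<in>space M. Y k \<omega> = v \<and> Y (Suc k) \<omega> = w} \<omega> * indicator (A h) \<omega> * F h \<omega> * \<psi> (S k \<omega>) \<partial>M)
      = (\<integral>\<^sup>+\<omega>. indicator {\<omega>\<in>space M. \<forall>i\<le>Suc k. Y i \<omega> = p h w i} \<omega> * (\<Prod>i\<le>Suc k. f h \<psi> i (S i \<omega>)) \<partial>M)"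
    proof (rule nn_integral_cong)
      fix \<omega> assume o: "\<omega> \<in> space M"
      have "(\<forall>i\<le>Suc k. Y i \<omega> = p h w i) \<longleftrightarrow> Y k \<omega> = v \<and> Y (Suc k) \<omega> = w \<and> (\<forall>i<k. Y i \<omega> = h i)"
        unfolding p_def le_Suc_eq le_eq_less_or_eq by (auto simp: less_Suc_eq)
      moreover have "f h \<psi> (Suc k) x = 1" for x by (simp add: f_def)
      ultimately show "indicator {\<omega>\<in>space M. Y k \<omega> = v \<and> Y (Suc k) \<omega> = w} \<omega> * indicator (A h) \<omega> * F h \<omega> * \<psi> (S k \<omega>) =
          indicator {\<omega>\<in>space M. \<forall>i\<le>Suc k. Y i \<omega> = p h w i} \<omega> * (\<Prod>i\<le>Suc k. f h \<psi> i (S i \<omega>))"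
        using o by (auto simp: fP A_def indicator_def)
    qed
    also have "\<dots> = ennreal (path_weight (p h w) (Suc k)) * (\<Prod>i\<le>Suc k. \<integral>\<^sup>+x. f h \<psi> i x \<partial>?E (p h w i))"
      using pV[OF h w] fm fb b by (intro holding_times_law) auto
    also have "(\<Prod>i\<le>Suc k. \<integral>\<^sup>+x. f h \<psi> i x \<partial>?E (p h w i)) = c h * (\<integral>\<^sup>+x. \<psi> x \<partial>?E v)"
    proof -
      have "(\<Prod>i<k. \<integral>\<^sup>+x. f h \<psi> i x \<partial>?E (p h w i)) = c h"
        unfolding c_def by (rule prod.cong) (auto simp: fE p_def)
      moreover have "(\<integral>\<^sup>+x. f h \<psi> (Suc k) x \<partial>?E (p h w (Suc k))) = 1"
        using E1[OF w] by (simp add: f_def p_def)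
      ultimately show ?thesis by (simp add: f_def p_def lessThan_Suc_atMost[symmetric])
    qed
    also have "path_weight (p h w) (Suc k) = path_weight (p h v) k * (if w \<in> tree_nbrs b n v then 1 / deg v else 0)"
    proof -
      have "(\<Prod>i<k. if p h w (Suc i) \<in> tree_nbrs b n (p h w i) then 1 / deg (p h w i) else 0) =
        (\<Prod>i<k. if p h v (Suc i) \<in> tree_nbrs b n (p h v i) then 1 / deg (p h v i) else 0)"
        by (rule prod.cong) (auto simp: p_def)
      moreover have "p h w 0 = p h v 0" "p h w k = v" "p h w (Suc k) = w" by (auto simp: p_def)
      ultimately show ?thesis by (simp add: path_weight_def)
    qed
    finally show ?thesis by (auto simp: mult.assoc ennreal_mult path_weight_nonneg)
  qed
  have split: "(\<integral>\<^sup>+\<omega>. indicator B \<omega> * killed l k \<omega> * \<psi> (S k \<omega>) \<partial>M) =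
      (\<Sum>h\<in>Hs. \<integral>\<^sup>+\<omega>. indicator B \<omega> * indicator (A h) \<omega> * F h \<omega> * \<psi> (S k \<omega>) \<partial>M)"
    if [measurable]: "B \<in> sets M" "\<psi> \<in> borel_measurable borel" for B and \<psi> :: "real \<Rightarrow> ennreal"
  proof -
    have "(\<integral>\<^sup>+\<omega>. indicator B \<omega> * killed l k \<omega> * \<psi> (S k \<omega>) \<partial>M) =
      (\<integral>\<^sup>+\<omega>. (\<Sum>h\<in>Hs. indicator B \<omega> * indicator (A h) \<omega> * F h \<omega> * \<psi> (S k \<omega>)) \<partial>M)"
    proof (rule nn_integral_cong)
      fix \<omega> assume o: "\<omega> \<in> space M"
      define h0 where "h0 = restrict (\<lambda>i. Y i \<omega>) {..<k}"
      have h0: "h0 \<in> Hs" using Y_in[OF o] by (auto simp: h0_def Hs_def)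
      have ne: "\<omega> \<notin> A h" if "h \<in> Hs" "h \<noteq> h0" for h
      proof
        assume "\<omega> \<in> A h"
        then have "h = h0" using that(1) by (auto simp: A_def h0_def Hs_def fun_eq_iff PiE_def extensional_def)
        with that show False by simp
      qed
      have "F h0 \<omega> = killed l k \<omega>" unfolding F_def killed_def by (rule prod.cong) (auto simp: h0_def)
      moreover have "\<omega> \<in> A h0" using o by (auto simp: A_def h0_def)
      moreover have "(\<Sum>h\<in>Hs. indicator B \<omega> * indicator (A h) \<omega> * F h \<omega> * \<psi> (S k \<omega>)) =
        (\<Sum>h\<in>{h0}. indicator B \<omega> * indicator (A h) \<omega> * F h \<omega> * \<psi> (S k \<omega>))"
        by (rule sum.mono_neutral_right) (use fin h0 ne in auto)
      ultimately show "indicator B \<omega> * killed l k \<omega> * \<psi> (S k \<omega>) =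
          (\<Sum>h\<in>Hs. indicator B \<omega> * indicator (A h) \<omega> * F h \<omega> * \<psi> (S k \<omega>))" by simp
    qed
    also have "\<dots> = (\<Sum>h\<in>Hs. \<integral>\<^sup>+\<omega>. indicator B \<omega> * indicator (A h) \<omega> * F h \<omega> * \<psi> (S k \<omega>) \<partial>M)"
      by (rule nn_integral_sum) measurable
    finally show ?thesis .
  qed
  have occ: "occupancy l k v = (\<Sum>h\<in>Hs. ennreal (path_weight (p h v) k) * c h)"
    using split[of "{\<omega>\<in>space M. Y k \<omega> = v}" "\<lambda>_. 1"] one[of _ "\<lambda>_. 1"] E1[OF v]
    by (simp add: occupancy_def)
  have "(\<integral>\<^sup>+\<omega>. indicator {\<omega>\<in>space M. Y k \<omega> = v} \<omega> * killed l k \<omega> * \<phi> (S k \<omega>) \<partial>M) =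
      (\<Sum>h\<in>Hs. ennreal (path_weight (p h v) k) * c h * (\<integral>\<^sup>+x. \<phi> x \<partial>?E v))"
    by (subst split) (auto simp: one phi)
  then show ?one by (simp add: occ sum_distrib_right)
  show ?two if w: "w \<in> V"
  proof -
    have "(\<integral>\<^sup>+\<omega>. indicator {\<omega>\<in>space M. Y k \<omega> = v \<and> Y (Suc k) \<omega> = w} \<omega> * killed l k \<omega> * \<phi> (S k \<omega>) \<partial>M) =
      (\<Sum>h\<in>Hs. ennreal (path_weight (p h v) k) * (if w \<in> tree_nbrs b n v then ennreal (1 / deg v) else 0) * c h * (\<integral>\<^sup>+x. \<phi> x \<partial>?E v))"
      by (subst split) (auto simp: two[OF _ w] phi simp del: mult_eq_0_iff intro!: sum.cong)
    also have "\<dots> = (\<Sum>h\<in>Hs. (ennreal (path_weight (p h v) k) * c h) * ((if w \<in> tree_nbrs b n v then ennreal (1 / deg v) else 0) * (\<integral>\<^sup>+x. \<phi> x \<partial>?E v)))"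
      by (rule sum.cong) (auto simp: mult_ac)
    also have "\<dots> = occupancy l k v * ((if w \<in> tree_nbrs b n v then ennreal (1 / deg v) else 0) * (\<integral>\<^sup>+x. \<phi> x \<partial>?E v))"
      unfolding occ by (rule sum_distrib_right[symmetric])
    finally show ?thesis by (simp only: mult.assoc)
  qed
qed

lemma occupancy_0: "occupancy l 0 v = (if v = [] then 1 else 0)"
proof -
  have "measure M {\<omega>\<in>space M. \<forall>i\<le>0. Y i \<omega> = v \<and> 0 < S i \<omega>} = (if v = [] then 1 else 0)"
    using skeleton_law[of 0 "\<lambda>_. 0" "\<lambda>_. v"] by simp
  moreover have "{\<omega>\<in>space M. \<forall>i\<le>0. Y i \<omega> = v \<and> 0 < S i \<omega>} = {\<omega>\<in>space M. Y 0 \<omega> = v}" using S_pos by auto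
  ultimately show ?thesis by (auto simp: occupancy_def killed_def emeasure_eq_measure)
qed

lemma killed_Suc: "killed l (Suc k) \<omega> = killed l k \<omega> * ennreal (exp (- l (Y k \<omega>) * S k \<omega>))"
  by (simp add: killed_def)

lemma exponential_law_laplace':
  assumes d: "0 < d" and l: "0 \<le> l"
  shows "(\<integral>\<^sup>+x. indicator {0..} x * ennreal (exp (- l * x)) \<partial>exponential_law d) = ennreal (d / (d + l))"
proof -
  have "AE x in exponential_law d. 0 \<le> x" by (subst AE_density) (auto simp: erlang_density_def)
  then have "(\<integral>\<^sup>+x. indicator {0..} x * ennreal (exp (- l * x)) \<partial>exponential_law d) = (\<integral>\<^sup>+x. ennreal (exp (- l * x)) \<partial>exponential_law d)"
    by (intro nn_integral_cong_AE) (auto elim!: eventually_mono)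
  then show ?thesis using exponential_law_laplace[OF assms] by simp
qed

text \<open>A stay at \<open>v\<close> is survived with probability
  \<open>deg v / (deg v + l v)\<close>, and a given neighbour is chosen with probability
  \<open>1 / deg v\<close>. The degree cancels, which leaves the symmetric adjacency relation
  weighted by \<open>1 / (deg v + l v)\<close>.\<close>

lemma occupancy_Suc:
  assumes w: "w \<in> V" and l: "\<And>x. 0 \<le> l x"
  shows "occupancy l (Suc k) w = (\<Sum>v\<in>V. if w \<in> tree_nbrs b n v then occupancy l k v * ennreal (1 / (deg v + l v)) else 0)"
proof -
  let ?I = "\<lambda>v \<omega>. indicator {\<omega>\<in>space M. Y k \<omega> = v \<and> Y (Suc k) \<omega> = w} \<omega> * killed l k \<omega> * (indicator {0..} (S k \<omega>) * ennreal (exp (- l v * S k \<omega>)))"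
  have "occupancy l (Suc k) w = (\<integral>\<^sup>+\<omega>. (\<Sum>v\<in>V. ?I v \<omega>) \<partial>M)"
    unfolding occupancy_def
  proof (rule nn_integral_cong)
    fix \<omega> assume o: "\<omega> \<in> space M"
    have "(\<Sum>v\<in>V. ?I v \<omega>) = (\<Sum>v\<in>{Y k \<omega>}. ?I v \<omega>)"
      by (rule sum.mono_neutral_right) (use finite_tree_vertices Y_in[OF o] in auto)
    then show "indicator {\<omega>\<in>space M. Y (Suc k) \<omega> = w} \<omega> * killed l (Suc k) \<omega> = (\<Sum>v\<in>V. ?I v \<omega>)"
      using o S_pos[OF o, of k] by (simp add: killed_Suc indicator_def)
  qed
  also have "\<dots> = (\<Sum>v\<in>V. \<integral>\<^sup>+\<omega>. ?I v \<omega> \<partial>M)" by (rule nn_integral_sum) measurable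
  also have "\<dots> = (\<Sum>v\<in>V. occupancy l k v * (if w \<in> tree_nbrs b n v then ennreal (1 / deg v) else 0) * ennreal (deg v / (deg v + l v)))"
  proof (rule sum.cong)
    fix v assume v: "v \<in> V"
    show "(\<integral>\<^sup>+\<omega>. ?I v \<omega> \<partial>M) = occupancy l k v * (if w \<in> tree_nbrs b n v then ennreal (1 / deg v) else 0) * ennreal (deg v / (deg v + l v))"
    proof -
      have "indicator {0..} x * ennreal (exp (- l v * x)) \<le> 1" for x using l[of v] by (auto simp: indicator_def)
      from occupancy_decompose(2)[where l=l and \<phi>="\<lambda>x. indicator {0..} x * ennreal (exp (- l v * x))", OF v l _ this w]
      show ?thesis using exponential_law_laplace'[OF deg_pos[OF v] l[of v]] by simp
    qed
  qed simp
  also have "\<dots> = (\<Sum>v\<in>V. if w \<in> tree_nbrs b n v then occupancy l k v * ennreal (1 / (deg v + l v)) else 0)"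
  proof (rule sum.cong)
    fix v assume v: "v \<in> V"
    have "ennreal (1 / deg v) * ennreal (deg v / (deg v + l v)) = ennreal (1 / (deg v + l v))"
      using deg_pos[OF v] l[of v] by (subst ennreal_mult[symmetric]) auto
    then show "occupancy l k v * (if w \<in> tree_nbrs b n v then ennreal (1 / deg v) else 0) * ennreal (deg v / (deg v + l v)) =
      (if w \<in> tree_nbrs b n v then occupancy l k v * ennreal (1 / (deg v + l v)) else 0)"
      by (auto simp: mult.assoc)
  qed simp
  finally show ?thesis .
qed

text \<open>
  The adjacency matrix is symmetric, so one step of the jump chain can be moved from the occupation
  measure onto the Green function.
\<close>

lemma green_telescope:
  assumes l: "\<And>x. 0 \<le> l x" and l0: "0 < l []"
  shows "(\<Sum>v\<in>V. occupancy l (Suc k) v * ennreal (green b n l v)) + occupancy l k [] * ennreal (1 / (deg [] + l [])) =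
    (\<Sum>v\<in>V. occupancy l k v * ennreal (green b n l v))"
proof -
  let ?g = "green b n l"
  have root: "[] \<in> V" by (simp add: tree_vertices_def)
  have g: "0 \<le> ?g v" for v by (rule green_nonneg) (rule l)
  have r: "1 / (deg v + l v) \<ge> 0" for v using l[of v] by simp
  have "(\<Sum>v\<in>V. occupancy l (Suc k) v * ennreal (?g v)) =
      (\<Sum>w\<in>V. \<Sum>v\<in>V. if w \<in> tree_nbrs b n v then occupancy l k v * ennreal (1 / (deg v + l v)) * ennreal (?g w) else 0)"
    by (rule sum.cong) (auto simp: occupancy_Suc[where l=l, OF _ l] sum_distrib_right intro!: sum.cong)
  also have "\<dots> = (\<Sum>v\<in>V. \<Sum>w\<in>V. if w \<in> tree_nbrs b n v then occupancy l k v * ennreal (1 / (deg v + l v)) * ennreal (?g w) else 0)"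
    by (rule sum.swap)
  also have "\<dots> = (\<Sum>v\<in>V. occupancy l k v * ennreal (1 / (deg v + l v)) * ennreal (\<Sum>w\<in>tree_nbrs b n v. ?g w))"
  proof (rule sum.cong)
    fix v assume "v \<in> V"
    have V: "V \<inter> {w. w \<in> tree_nbrs b n v} = tree_nbrs b n v" by (auto simp: tree_nbrs_def)
    have "(\<Sum>w\<in>V. if w \<in> tree_nbrs b n v then occupancy l k v * ennreal (1 / (deg v + l v)) * ennreal (?g w) else 0) =
      (\<Sum>w\<in>tree_nbrs b n v. occupancy l k v * ennreal (1 / (deg v + l v)) * ennreal (?g w))"
      by (subst sum.inter_restrict[symmetric, OF finite_tree_vertices, unfolded Int_def, simplified]) 
        (use V in \<open>auto intro!: sum.cong\<close>)
    then show "(\<Sum>w\<in>V. if w \<in> tree_nbrs b n v then occupancy l k v * ennreal (1 / (deg v + l v)) * ennreal (?g w) else 0) =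
      occupancy l k v * ennreal (1 / (deg v + l v)) * ennreal (\<Sum>w\<in>tree_nbrs b n v. ?g w)"
      by (simp add: sum_distrib_left[symmetric] sum_ennreal g)
  qed simp
  finally have 1: "(\<Sum>v\<in>V. occupancy l (Suc k) v * ennreal (?g v)) =
    (\<Sum>v\<in>V. occupancy l k v * ennreal (1 / (deg v + l v)) * ennreal (\<Sum>w\<in>tree_nbrs b n v. ?g w))" .
  have 2: "occupancy l k [] * ennreal (1 / (deg [] + l [])) =
    (\<Sum>v\<in>V. occupancy l k v * ennreal (1 / (deg v + l v)) * ennreal (if v = [] then 1 else 0))"
    using root finite_tree_vertices by (simp add: if_distrib[where f=ennreal] if_distrib[where f="(*) _"] cong: if_cong)
  show ?thesis
    unfolding 1 2 sum.distrib[symmetric]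
  proof (rule sum.cong)
    fix v assume v: "v \<in> V"
    have "ennreal (1 / (deg v + l v)) * (ennreal (\<Sum>w\<in>tree_nbrs b n v. ?g w) + ennreal (if v = [] then 1 else 0)) =
       ennreal (1 / (deg v + l v) * ((\<Sum>w\<in>tree_nbrs b n v. ?g w) + (if v = [] then 1 else 0)))"
    proof -
      have 0: "0 \<le> (\<Sum>w\<in>tree_nbrs b n v. ?g w)" "0 \<le> (if v = [] then 1 else 0 :: real)" by (auto simp: sum_nonneg g)
      show ?thesis unfolding ennreal_plus[OF 0, symmetric] by (rule ennreal_mult[symmetric, OF r add_nonneg_nonneg[OF 0]])
    qed
    also have "\<dots> = ennreal (?g v)"
      using deg_pos[OF v] l[of v] by (subst green_eq[where l=l, OF l l0 v]) auto
    finally show "occupancy l k v * ennreal (1 / (deg v + l v)) * ennreal (\<Sum>w\<in>tree_nbrs b n v. ?g w) +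
      occupancy l k v * ennreal (1 / (deg v + l v)) * ennreal (if v = [] then 1 else 0) = occupancy l k v * ennreal (?g v)"
      by (simp add: distrib_left[symmetric] mult.assoc)
  qed simp
qed

text \<open>Rates of at least \<delta> bound the surviving weight by
  \<open>exp (- \<delta> * T)\<close> with \<open>T\<close> the time of the \<open>k\<close>-th
  jump, and the jump times tend to infinity.\<close>

lemma killed_mass_tendsto_0:
  assumes l: "\<And>x. \<delta> \<le> l x" and d: "0 < \<delta>"
  shows "(\<lambda>k. \<integral>\<^sup>+\<omega>. killed l k \<omega> \<partial>M) \<longlonglongrightarrow> 0"
proof -
  have le: "killed l k \<omega> \<le> ennreal (exp (- \<delta> * (\<Sum>i<k. S i \<omega>)))" if "\<omega> \<in> space M" for k \<omega>
  proof -
    have "killed l k \<omega> = ennreal (exp (\<Sum>i<k. - l (Y i \<omega>) * S i \<omega>))"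
      unfolding killed_def by (simp add: prod_ennreal exp_sum)
    also have "\<dots> \<le> ennreal (exp (\<Sum>i<k. - \<delta> * S i \<omega>))"
      using l S_pos[OF that] by (intro ennreal_leI) (auto intro!: sum_mono mult_right_mono simp: less_imp_le)
    finally show ?thesis by (simp add: sum_distrib_left)
  qed
  have "(\<lambda>k. \<integral>\<^sup>+\<omega>. ennreal (exp (- \<delta> * (\<Sum>i<k. S i \<omega>))) \<partial>M) \<longlonglongrightarrow> (\<integral>\<^sup>+\<omega>. 0 \<partial>M)"
  proof (rule nn_integral_dominated_convergence[where w="\<lambda>_. 1"])
    have "exp (- \<delta> * (\<Sum>i<k. S i \<omega>)) \<le> 1" if "\<omega> \<in> space M" for k \<omega>
      using d sum_nonneg[of "{..<k}" "\<lambda>i. S i \<omega>"] S_pos[OF that] by (simp add: less_imp_le)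
    then show "AE \<omega> in M. ennreal (exp (- \<delta> * (\<Sum>i<k. S i \<omega>))) \<le> 1" for k by (auto intro!: AE_I2)
    show "AE \<omega> in M. (\<lambda>k. ennreal (exp (- \<delta> * (\<Sum>i<k. S i \<omega>)))) \<longlonglongrightarrow> 0"
    proof (rule AE_I2)
      fix \<omega> assume "\<omega> \<in> space M"
      have "filterlim (\<lambda>k. - \<delta> * (\<Sum>i<k. S i \<omega>)) at_bot sequentially"
        using d by (intro filterlim_tendsto_neg_mult_at_bot[OF tendsto_const _ jump_times_unbounded]) (auto simp: \<open>\<omega> \<in> space M\<close>)
      then have "(\<lambda>k. exp (- \<delta> * (\<Sum>i<k. S i \<omega>))) \<longlonglongrightarrow> 0"
        by (rule filterlim_compose[OF exp_at_bot])
      then show "(\<lambda>k. ennreal (exp (- \<delta> * (\<Sum>i<k. S i \<omega>)))) \<longlonglongrightarrow> 0" by (metis ennreal_0 tendsto_ennrealI)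
    qed
  qed (auto simp: emeasure_space_1)
  then have "(\<lambda>k. \<integral>\<^sup>+\<omega>. ennreal (exp (- \<delta> * (\<Sum>i<k. S i \<omega>))) \<partial>M) \<longlonglongrightarrow> 0" by simp
  moreover have "\<forall>\<^sub>F k in sequentially. (\<integral>\<^sup>+\<omega>. killed l k \<omega> \<partial>M) \<le> (\<integral>\<^sup>+\<omega>. ennreal (exp (- \<delta> * (\<Sum>i<k. S i \<omega>))) \<partial>M)"
    by (rule always_eventually, intro allI nn_integral_mono le)
  ultimately show ?thesis
    using tendsto_sandwich[where f="\<lambda>_. 0 :: ennreal", OF always_eventually _ tendsto_const] by simp
qed

text \<open>The integrand sums, over the stays at the root, the conditional chance of being killed
  during that stay. Its mean is the probability that the killed walk dies at the root, namely
  \<open>l []\<close> times the Green function there.\<close>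

lemma green_root:
  assumes l: "\<And>x. \<delta> \<le> l x" and d: "0 < \<delta>"
  shows "(\<integral>\<^sup>+\<omega>. (\<Sum>k. indicator {\<omega>\<in>space M. Y k \<omega> = []} \<omega> * killed l k \<omega> * ennreal (1 - exp (- l [] * S k \<omega>))) \<partial>M) =
    ennreal (l [] / Phi b n l)"
proof -
  have l': "0 \<le> l x" "0 < l x" for x using l[of x] d by auto
  have root: "[] \<in> V" by (simp add: tree_vertices_def)
  note dp = deg_pos[OF root]
  have P: "Phi b n l > 0" using Phi_ge[where l=l and b=b and n=n, OF l'(1)] l'(2)[of "[]"] by linarith
  define R where "R K = (\<Sum>v\<in>V. occupancy l K v * ennreal (green b n l v))" for K
  define a where "a k = occupancy l k [] * ennreal (1 / (deg [] + l []))" for k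
  \<comment> \<open>Each use of \<open>green_telescope\<close> moves one root term out of the
    remainder \<open>R\<close>; the conserved value is \<open>R 0\<close>, the Green function at the
    root.\<close>
  have tel: "(\<Sum>k<K. a k) + R K = ennreal (1 / Phi b n l)" for K
  proof (induction K)
    case 0
    have "R 0 = (\<Sum>v\<in>V. if v = [] then ennreal (green b n l []) else 0)"
      unfolding R_def by (rule sum.cong) (auto simp: occupancy_0)
    then show ?case using root finite_tree_vertices by (simp add: green_def)
  next
    case (Suc K)
    have "R (Suc K) + a K = R K" unfolding R_def a_def using l' by (intro green_telescope) auto
    then have "a K + R (Suc K) = R K" by (simp only: add.commute)
    with Suc show ?case by (simp only: sum.lessThan_Suc add.assoc)
  qed
  \<comment> \<open>The Green function is bounded by its value at the root, so the remainder is
    controlled by the surviving mass.\<close>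
  have "R \<longlonglongrightarrow> 0"
  proof -
    have le: "R K \<le> (\<integral>\<^sup>+\<omega>. killed l K \<omega> \<partial>M) * ennreal (1 / Phi b n l)" for K
    proof -
      have "R K \<le> (\<Sum>v\<in>V. occupancy l K v * ennreal (1 / Phi b n l))"
        unfolding R_def using green_le[where l=l, OF l'(1)] by (intro sum_mono mult_left_mono ennreal_leI) auto
      also have "\<dots> = (\<Sum>v\<in>V. occupancy l K v) * ennreal (1 / Phi b n l)" by (simp add: sum_distrib_right)
      also have "(\<Sum>v\<in>V. occupancy l K v) = (\<integral>\<^sup>+\<omega>. (\<Sum>v\<in>V. indicator {\<omega>\<in>space M. Y K \<omega> = v} \<omega> * killed l K \<omega>) \<partial>M)"
        unfolding occupancy_def by (rule nn_integral_sum[symmetric]) measurable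
      also have "\<dots> = (\<integral>\<^sup>+\<omega>. killed l K \<omega> \<partial>M)"
      proof (rule nn_integral_cong)
        fix \<omega> assume o: "\<omega> \<in> space M"
        have "(\<Sum>v\<in>V. indicator {\<omega>\<in>space M. Y K \<omega> = v} \<omega> * killed l K \<omega>) = (\<Sum>v\<in>{Y K \<omega>}. indicator {\<omega>\<in>space M. Y K \<omega> = v} \<omega> * killed l K \<omega>)"
          by (rule sum.mono_neutral_right) (use finite_tree_vertices Y_in[OF o] in \<open>auto simp: indicator_def\<close>)
        then show "(\<Sum>v\<in>V. indicator {\<omega>\<in>space M. Y K \<omega> = v} \<omega> * killed l K \<omega>) = killed l K \<omega>" using o by simp
      qed
      finally show ?thesis .
    qed
    have "(\<lambda>K. (\<integral>\<^sup>+\<omega>. killed l K \<omega> \<partial>M) * ennreal (1 / Phi b n l)) \<longlonglongrightarrow> 0 * ennreal (1 / Phi b n l)"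
      by (intro tendsto_mult_ennreal killed_mass_tendsto_0[where l=l, OF l d] tendsto_const) auto
    then have "(\<lambda>K. (\<integral>\<^sup>+\<omega>. killed l K \<omega> \<partial>M) * ennreal (1 / Phi b n l)) \<longlonglongrightarrow> 0" by simp
    then show ?thesis
      by - (rule tendsto_sandwich[where f="\<lambda>_. 0 :: ennreal" and g=R, OF always_eventually always_eventually[OF allI, OF le] tendsto_const], auto)
  qed
  then have "(\<lambda>K. (\<Sum>k<K. a k) + R K) \<longlonglongrightarrow> suminf a + 0"
    by (intro tendsto_add summable_LIMSEQ) auto
  then have sa: "suminf a = ennreal (1 / Phi b n l)" unfolding tel by (simp add: LIMSEQ_const_iff)
  have Ee: "(\<integral>\<^sup>+x. ennreal (1 - exp (- l [] * x)) \<partial>exponential_law (deg [])) = ennreal (l [] / (deg [] + l []))"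
  proof -
    interpret E: prob_space "exponential_law (deg [])" using dp by (rule prob_space_exponential_density)
    have ae: "AE x in exponential_law (deg []). 0 \<le> x" by (subst AE_density) (auto simp: erlang_density_def)
    have "(\<integral>\<^sup>+x. ennreal (1 - exp (- l [] * x)) \<partial>exponential_law (deg [])) + (\<integral>\<^sup>+x. ennreal (exp (- l [] * x)) \<partial>exponential_law (deg []))
      = (\<integral>\<^sup>+x. 1 \<partial>exponential_law (deg []))"
    proof (subst nn_integral_add[symmetric])
      show "(\<integral>\<^sup>+x. ennreal (1 - exp (- l [] * x)) + ennreal (exp (- l [] * x)) \<partial>exponential_law (deg [])) = (\<integral>\<^sup>+x. 1 \<partial>exponential_law (deg []))"
      proof (rule nn_integral_cong_AE, use ae in eventually_elim)
        fix x :: real assume "0 \<le> x"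
        then have "0 \<le> 1 - exp (- l [] * x)" using l'(1)[of "[]"] by simp
        then have "ennreal (1 - exp (- l [] * x)) + ennreal (exp (- l [] * x)) = ennreal (1 - exp (- l [] * x) + exp (- l [] * x))"
          by (rule ennreal_plus[symmetric]) simp
        then show "ennreal (1 - exp (- l [] * x)) + ennreal (exp (- l [] * x)) = 1" by simp
      qed
    qed simp_all
    also have "\<dots> = 1" using E.emeasure_space_1 by simp
    also have "1 = ennreal (l [] / (deg [] + l [])) + ennreal (deg [] / (deg [] + l []))"
      using dp l'(2)[of "[]"] by (simp add: ennreal_plus[symmetric] add_divide_distrib[symmetric] add.commute del: ennreal_plus)
    finally show ?thesis using exponential_law_laplace[OF dp l'(1)[of "[]"]] 
      by (simp add: ennreal_add_left_cancel add.commute[of _ "ennreal (deg [] / _)"])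
  qed
  have "(\<integral>\<^sup>+\<omega>. (\<Sum>k. indicator {\<omega>\<in>space M. Y k \<omega> = []} \<omega> * killed l k \<omega> * ennreal (1 - exp (- l [] * S k \<omega>))) \<partial>M) =
     (\<Sum>k. \<integral>\<^sup>+\<omega>. indicator {\<omega>\<in>space M. Y k \<omega> = []} \<omega> * killed l k \<omega> * ennreal (1 - exp (- l [] * S k \<omega>)) \<partial>M)"
    by (rule nn_integral_suminf) measurable
  also have "\<dots> = (\<Sum>k. a k * ennreal (l []))"
  proof (rule suminf_cong)
    fix k
    have "(\<integral>\<^sup>+\<omega>. indicator {\<omega>\<in>space M. Y k \<omega> = []} \<omega> * killed l k \<omega> * ennreal (1 - exp (- l [] * S k \<omega>)) \<partial>M)
      = occupancy l k [] * ennreal (l [] / (deg [] + l []))"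
      using occupancy_decompose(1)[where l=l and \<phi>="\<lambda>x. ennreal (1 - exp (- l [] * x))" and k=k, OF root l'(1)] Ee
      by simp
    also have "ennreal (l [] / (deg [] + l [])) = ennreal (1 / (deg [] + l [])) * ennreal (l [])"
      using dp l'(1)[of "[]"] by (subst ennreal_mult[symmetric]) auto
    finally show "(\<integral>\<^sup>+\<omega>. indicator {\<omega>\<in>space M. Y k \<omega> = []} \<omega> * killed l k \<omega> * ennreal (1 - exp (- l [] * S k \<omega>)) \<partial>M) = a k * ennreal (l [])"
      by (simp add: a_def mult.assoc)
  qed
  also have "\<dots> = ennreal (1 / Phi b n l) * ennreal (l [])" by (simp add: ennreal_suminf_multc sa)
  also have "\<dots> = ennreal (l [] / Phi b n l)" using P l'(1)[of "[]"] by (subst ennreal_mult[symmetric]) auto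
  finally show ?thesis .
qed

end

section \<open>Local times\<close>

lemma occupation_time_nonneg: "0 \<le> occupation_time X t x \<omega>"
  unfolding occupation_time_def set_lebesgue_integral_def by (rule Bochner_Integration.integral_nonneg) simp

lemma local_time_nonneg: "0 \<le> local_time X t x \<omega>"
  unfolding local_time_def by (rule occupation_time_nonneg)

lemma Phi_tendsto:
  assumes "\<And>x. ((\<lambda>m. l m x) \<longlongrightarrow> l' x) F" and "\<And>x. 0 \<le> l' x"
  shows "((\<lambda>m. Phi b n (l m)) \<longlongrightarrow> Phi b n l') F"
  using assms
proof (induction n arbitrary: l l')
  case (Suc n)
  have "0 \<le> Phi b n (\<lambda>x. l' (i # x))" for i using Suc.prems(2) by (intro Phi_nonneg) auto
  then have "1 + Phi b n (\<lambda>x. l' (i # x)) \<noteq> 0" for i by (metis add_nonneg_eq_0_iff zero_le_one zero_neq_one)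
  then show ?case using Suc by (auto intro!: tendsto_intros)
qed simp

lemma Phi_root: "Phi b n l = l [] + Phi b n (l([] := 0))"
  by (cases n) auto

lemma Phi_zero: "(\<And>x. l x = 0) \<Longrightarrow> Phi b n l = 0"
  by (induction n arbitrary: l) auto

context tree_path
begin

section \<open>Occupation and local times in terms of the jump times\<close>

definition jump :: "nat \<Rightarrow> 'a \<Rightarrow> real" where "jump k \<omega> = (\<Sum>i<k. S i \<omega>)"

definition spent :: "nat list \<Rightarrow> nat \<Rightarrow> 'a \<Rightarrow> real" where
  "spent x k \<omega> = (\<Sum>i<k. if Y i \<omega> = x then S i \<omega> else 0)"

lemma spent_Suc: "spent x (Suc k) \<omega> = spent x k \<omega> + (if Y k \<omega> = x then S k \<omega> else 0)"
  by (simp add: spent_def)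

lemma jump_measurable[measurable]: "jump k \<in> borel_measurable M"
  unfolding jump_def by measurable

lemma spent_measurable[measurable]: "spent x k \<in> borel_measurable M"
  unfolding spent_def by measurable

lemma jump_mono: "\<omega> \<in> space M \<Longrightarrow> i \<le> j \<Longrightarrow> jump i \<omega> \<le> jump j \<omega>"
  unfolding jump_def using S_pos by (intro sum_mono2) (auto simp: less_imp_le)

lemma jump_nonneg: "\<omega> \<in> space M \<Longrightarrow> 0 \<le> jump i \<omega>"
  using jump_mono[of \<omega> 0 i] by (simp add: jump_def)

lemma spent_mono: "\<omega> \<in> space M \<Longrightarrow> i \<le> j \<Longrightarrow> spent x i \<omega> \<le> spent x j \<omega>"
  unfolding spent_def using S_pos by (intro sum_mono2) (auto simp: less_imp_le)

lemma spent_nonneg: "\<omega> \<in> space M \<Longrightarrow> 0 \<le> spent x i \<omega>"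
  using spent_mono[of \<omega> 0 i] by (simp add: spent_def)

lemma jump_gt: "\<omega> \<in> space M \<Longrightarrow> \<exists>k. s < jump k \<omega>"
  using jump_times_unbounded[of \<omega>] unfolding jump_def filterlim_at_top_dense eventually_sequentially by blast

lemma jump_interval:
  assumes "0 \<le> u" "u < jump K \<omega>"
  shows "\<exists>k<K. jump k \<omega> \<le> u \<and> u < jump (Suc k) \<omega>"
  using assms(2)
proof (induction K)
  case 0 then show ?case using assms(1) by (simp add: jump_def)
next
  case (Suc K) then show ?case by (cases "u < jump K \<omega>") (auto intro: less_SucI)
qed

text \<open>The path is constant between jump times, so the integral is a finite sum of lengths; the
  interval containing \<open>s\<close> is cut there, and later ones contribute 0 through the
  maximum.\<close>

lemma occupation_time_eq:
  assumes o: "\<omega> \<in> space M" and s: "s \<le> jump K \<omega>"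
  shows "occupation_time X s x \<omega> = (\<Sum>i<K. if Y i \<omega> = x then max 0 (min (S i \<omega>) (s - jump i \<omega>)) else 0)"
proof -
  let ?I = "\<lambda>i. {jump i \<omega>..<min (jump (Suc i) \<omega>) s}"
  have pt: "indicator {0..s} u * indicator {x} (X u \<omega>) = (\<Sum>i<K. (if Y i \<omega> = x then 1 else 0) * indicator (?I i) u :: real)"
    if "u \<noteq> s" for u
  proof (cases "0 \<le> u \<and> u < s")
    case True
    then obtain k where k: "k < K" "jump k \<omega> \<le> u" "u < jump (Suc k) \<omega>" using jump_interval[of u K \<omega>] s by auto
    have X: "X u \<omega> = Y k \<omega>" using k True o by (intro path_eq) (auto simp: jump_def)
    have "u \<notin> ?I i" if "i \<noteq> k" for i
    proof (cases "i < k")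
      case True
      then show ?thesis using jump_mono[OF o, of "Suc i" k] k by auto
    next
      case False
      then show ?thesis using jump_mono[OF o, of "Suc k" i] k that by auto
    qed
    then have "(\<Sum>i<K. (if Y i \<omega> = x then 1 else 0) * indicator (?I i) u :: real) = (\<Sum>i\<in>{k}. (if Y i \<omega> = x then 1 else 0) * indicator (?I i) u)"
      using k by (intro sum.mono_neutral_right) auto
    then show ?thesis using True k X by (auto simp: indicator_def)
  next
    case False
    then have "indicator (?I i) u = (0 :: real)" for i using jump_nonneg[OF o, of i] by (auto simp: indicator_def)
    then have "(\<Sum>i<K. (if Y i \<omega> = x then 1 else 0) * indicator (?I i) u :: real) = 0" by (simp only: mult_zero_right sum.neutral_const)
    then show ?thesis using False that by (auto simp: indicator_def)
  qed
  have len: "(\<integral>u. (if Y i \<omega> = x then 1 else 0) * indicator (?I i) u \<partial>lborel) = (if Y i \<omega> = x then max 0 (min (S i \<omega>) (s - jump i \<omega>)) else 0 :: real)" for i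
  proof -
    have "measure lborel (?I i) = max 0 (min (S i \<omega>) (s - jump i \<omega>))"
    proof (cases "jump i \<omega> \<le> min (jump (Suc i) \<omega>) s")
      case True
      then show ?thesis by (auto simp: jump_def min_def)
    next
      case False
      then have "s < jump i \<omega>" using jump_mono[OF o, of i "Suc i"] by auto
      then show ?thesis using S_pos[OF o, of i] by auto
    qed
    then show ?thesis by simp
  qed
  have "occupation_time X s x \<omega> = (\<integral>u. (\<Sum>i<K. (if Y i \<omega> = x then 1 else 0) * indicator (?I i) u) \<partial>lborel)"
    unfolding occupation_time_def set_lebesgue_integral_def
  proof (rule integral_cong_AE)
    show "AE u in lborel. indicat_real {0..s} u *\<^sub>R indicat_real {x} (X u \<omega>) = (\<Sum>i<K. (if Y i \<omega> = x then 1 else 0) * indicator (?I i) u)"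
      using AE_lborel_singleton[of s] by eventually_elim (use pt in simp)
    define g where "g u = (\<Sum>i<K. (if Y i \<omega> = x then 1 else 0) * indicator (?I i) u :: real)" for u
    show "(\<lambda>u. (\<Sum>i<K. (if Y i \<omega> = x then 1 else 0) * indicator (?I i) u :: real)) \<in> borel_measurable lborel"
      by (intro borel_measurable_sum borel_measurable_times borel_measurable_const borel_measurable_indicator) auto
    have [measurable]: "g \<in> borel_measurable borel"
      unfolding g_def by (intro borel_measurable_sum borel_measurable_times borel_measurable_const borel_measurable_indicator) auto
    \<comment> \<open>Measurability of the path in time is inherited from the step function, from
      which the integrand differs at most at the single point \<open>s\<close>.\<close>
    have "(\<lambda>u. if u = s then indicator {0..s} s * indicator {x} (X s \<omega>) else g u) \<in> borel_measurable borel"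
      by (intro measurable_If) auto
    moreover have "(\<lambda>u. if u = s then indicator {0..s} s * indicator {x} (X s \<omega>) else g u) = (\<lambda>u. indicat_real {0..s} u *\<^sub>R indicat_real {x} (X u \<omega>))"
      using pt by (auto simp: g_def)
    ultimately show "(\<lambda>u. indicat_real {0..s} u *\<^sub>R indicat_real {x} (X u \<omega>)) \<in> borel_measurable lborel" by simp
  qed
  also have "\<dots> = (\<Sum>i<K. \<integral>u. (if Y i \<omega> = x then 1 else 0) * indicator (?I i) u \<partial>lborel)"
  proof (rule Bochner_Integration.integral_sum)
    fix i
    have "integrable lborel (indicator (?I i) :: real \<Rightarrow> real)"
      by (rule integrable_real_indicator) (use emeasure_bounded_finite[of "?I i"] in \<open>auto simp: bounded_Ico\<close>)
    then show "integrable lborel (\<lambda>u. (if Y i \<omega> = x then 1 else 0) * indicator (?I i) u :: real)" by simp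
  qed
  finally show ?thesis unfolding len .
qed

lemma occupation_time_mono:
  assumes "\<omega> \<in> space M" "s \<le> s'"
  shows "occupation_time X s x \<omega> \<le> occupation_time X s' x \<omega>"
proof -
  obtain K where K: "s' < jump K \<omega>" using jump_gt[OF assms(1)] by blast
  show ?thesis using assms K
    by (subst (1 2) occupation_time_eq[where K=K]) (auto intro!: sum_mono)
qed

lemma occupation_time_piece:
  assumes o: "\<omega> \<in> space M" and s: "jump k \<omega> \<le> s" "s \<le> jump (Suc k) \<omega>"
  shows "occupation_time X s x \<omega> = spent x k \<omega> + (if Y k \<omega> = x then s - jump k \<omega> else 0)"
proof -
  have "(\<Sum>i<k. if Y i \<omega> = x then max 0 (min (S i \<omega>) (s - jump i \<omega>)) else 0) = spent x k \<omega>"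
    unfolding spent_def
  proof (rule sum.cong)
    fix i assume "i \<in> {..<k}"
    then have "jump (Suc i) \<omega> \<le> jump k \<omega>" using jump_mono[OF o] by auto
    then have "S i \<omega> \<le> s - jump i \<omega>" using s by (simp add: jump_def)
    then show "(if Y i \<omega> = x then max 0 (min (S i \<omega>) (s - jump i \<omega>)) else 0) = (if Y i \<omega> = x then S i \<omega> else 0)"
      using S_pos[OF o, of i] by auto
  qed simp
  moreover have "max 0 (min (S k \<omega>) (s - jump k \<omega>)) = s - jump k \<omega>" using s by (auto simp: jump_def)
  ultimately show ?thesis using occupation_time_eq[OF o s(2), of x] by simp
qed

lemma occupation_time_measurable[measurable]: "(\<lambda>\<omega>. occupation_time X s x \<omega>) \<in> borel_measurable M"
proof (rule borel_measurable_LIMSEQ_real)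
  fix \<omega> assume o: "\<omega> \<in> space M"
  obtain K where K: "s < jump K \<omega>" using jump_gt[OF o] by blast
  have "(\<Sum>i<K'. if Y i \<omega> = x then max 0 (min (S i \<omega>) (s - jump i \<omega>)) else 0) = occupation_time X s x \<omega>" if "K \<le> K'" for K'
    using K jump_mono[OF o that] by (intro occupation_time_eq[OF o, symmetric]) auto
  then show "(\<lambda>K. \<Sum>i<K. if Y i \<omega> = x then max 0 (min (S i \<omega>) (s - jump i \<omega>)) else 0) \<longlonglongrightarrow> occupation_time X s x \<omega>"
    by (intro tendsto_eventually) (auto simp: eventually_sequentially)
qed measurable

text \<open>During a stay at the root its local time grows at unit speed, so it equals
  \<open>t\<close> at one moment of the stay and exceeds \<open>t\<close> immediately afterwards;
  the strict upper bound on \<open>t\<close> leaves room for this within the stay.\<close>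

lemma inverse_local_time_eq:
  assumes o: "\<omega> \<in> space M" and t: "spent [] k \<omega> \<le> t" "t < spent [] (Suc k) \<omega>"
  shows "inverse_local_time X t \<omega> = jump k \<omega> + (t - spent [] k \<omega>)" and "Y k \<omega> = []"
proof -
  show Y: "Y k \<omega> = []" using t by (auto simp: spent_Suc split: if_splits)
  define \<tau> where "\<tau> = jump k \<omega> + (t - spent [] k \<omega>)"
  have S: "t - spent [] k \<omega> < S k \<omega>" using t Y by (simp add: spent_Suc)
  have j: "jump (Suc k) \<omega> = jump k \<omega> + S k \<omega>" by (simp add: jump_def)
  have tau: "jump k \<omega> \<le> \<tau>" "\<tau> < jump (Suc k) \<omega>" using t S j by (auto simp: \<tau>_def)
  have occ: "occupation_time X s [] \<omega> = spent [] k \<omega> + (s - jump k \<omega>)" if "jump k \<omega> \<le> s" "s \<le> jump (Suc k) \<omega>" for s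
    using occupation_time_piece[OF o that] Y by simp
  have "Inf {s. 0 \<le> s \<and> t < occupation_time X s [] \<omega>} = \<tau>"
  proof (rule cInf_eq)
    fix s assume "s \<in> {s. 0 \<le> s \<and> t < occupation_time X s [] \<omega>}"
    moreover have "occupation_time X \<tau> [] \<omega> = t" using occ[of \<tau>] tau by (simp add: \<tau>_def)
    ultimately show "\<tau> \<le> s" using occupation_time_mono[OF o, of s \<tau> "[]"] by force
  next
    fix y assume y: "\<And>s. s \<in> {s. 0 \<le> s \<and> t < occupation_time X s [] \<omega>} \<Longrightarrow> y \<le> s"
    show "y \<le> \<tau>"
    proof (rule dense_ge_bounded[OF tau(2)])
      fix s assume s: "\<tau> < s" "s < jump (Suc k) \<omega>"
      then have "t < occupation_time X s [] \<omega>" using occ[of s] tau by (simp add: \<tau>_def)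
      moreover have "0 \<le> s" using jump_nonneg[OF o, of k] tau s by linarith
      ultimately show "y \<le> s" using y by auto
    qed
  qed
  then show "inverse_local_time X t \<omega> = jump k \<omega> + (t - spent [] k \<omega>)"
    by (simp add: inverse_local_time_def \<tau>_def)
qed

text \<open>While the root local time runs through this interval the walk sits at the root, so
  nothing is added elsewhere. Hence the local times off the root are constant on intervals closed on
  the left: the source of all right-continuity in \<open>t\<close>.\<close>

lemma local_time_eq:
  assumes o: "\<omega> \<in> space M" and t: "spent [] k \<omega> \<le> t" "t < spent [] (Suc k) \<omega>" and x: "x \<noteq> []"
  shows "local_time X t x \<omega> = spent x k \<omega>"
proof -
  note i = inverse_local_time_eq[OF o t]
  have "jump k \<omega> + (t - spent [] k \<omega>) \<le> jump (Suc k) \<omega>"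
    using t i(2) by (simp add: jump_def spent_Suc)
  then show ?thesis
    unfolding local_time_def i(1) using occupation_time_piece[OF o, where k=k and x=x] t i(2) x by simp
qed

lemma spent_interval:
  assumes "0 \<le> t" "t < spent x K \<omega>"
  shows "\<exists>k<K. spent x k \<omega> \<le> t \<and> t < spent x (Suc k) \<omega>"
  using assms(2)
proof (induction K)
  case 0 then show ?case using assms(1) by (simp add: spent_def)
next
  case (Suc K) then show ?case by (cases "t < spent x K \<omega>") (auto intro: less_SucI)
qed

lemma spent_interval_unique:
  assumes o: "\<omega> \<in> space M" and "spent x k \<omega> \<le> t" "t < spent x (Suc k) \<omega>" "spent x j \<omega> \<le> t" "t < spent x (Suc j) \<omega>"
  shows "j = k"
proof (rule ccontr)
  assume "j \<noteq> k"
  then consider "Suc j \<le> k" | "Suc k \<le> j" by linarith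
  then show False using spent_mono[OF o, of "Suc j" k x] spent_mono[OF o, of "Suc k" j x] assms by cases auto
qed

text \<open>
  If the local time of the root never exceeds \<open>t\<close>, the inverse local time is the unspecified value
  \<open>Inf {}\<close>. This event is null, but \<^const>\<open>Zn\<close> must be measurable on it.
\<close>

lemma local_time_never:
  assumes o: "\<omega> \<in> space M" and t: "\<And>k. spent [] k \<omega> \<le> t"
  shows "local_time X t x \<omega> = occupation_time X (Inf {}) x \<omega>"
proof -
  have "occupation_time X s [] \<omega> \<le> t" if "0 \<le> s" for s
  proof -
    obtain K where "s < jump K \<omega>" using jump_gt[OF o] by blast
    from jump_interval[OF that this] obtain k where k: "jump k \<omega> \<le> s" "s < jump (Suc k) \<omega>" by blast
    have "occupation_time X s [] \<omega> \<le> occupation_time X (jump (Suc k) \<omega>) [] \<omega>"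
      using k by (intro occupation_time_mono o) auto
    also have "\<dots> = spent [] (Suc k) \<omega>"
      using occupation_time_piece[OF o, of "Suc k" "jump (Suc k) \<omega>"] jump_mono[OF o, of "Suc k" "Suc (Suc k)"] by simp
    finally show ?thesis using t order_trans by blast
  qed
  then have "{s. 0 \<le> s \<and> t < occupation_time X s [] \<omega>} = {}" by force
  then show ?thesis unfolding local_time_def inverse_local_time_def by (simp only:)
qed

lemma local_time_measurable_pair:
  assumes x: "x \<noteq> []"
  shows "(\<lambda>(t, \<omega>). local_time X t x \<omega>) \<in> borel_measurable (restrict_space borel {0..} \<Otimes>\<^sub>M M)"
proof -
  \<comment> \<open>At most one term of the series is nonzero, the one whose interval contains
    \<open>t\<close>; the second summand covers the paths on which the root local time never exceeds
    \<open>t\<close>.\<close>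
  define G where "G = (\<lambda>(t, \<omega>). (\<Sum>k. if spent [] k \<omega> \<le> t \<and> t < spent [] (Suc k) \<omega> then spent x k \<omega> else 0) +
    (if \<forall>k. spent [] k \<omega> \<le> t then occupation_time X (Inf {}) x \<omega> else 0))"
  have [measurable]: "G \<in> borel_measurable (borel \<Otimes>\<^sub>M M)" unfolding G_def by measurable
  have [measurable]: "(\<lambda>z. z) \<in> restrict_space borel {0..} \<Otimes>\<^sub>M M \<rightarrow>\<^sub>M (borel :: real measure) \<Otimes>\<^sub>M M"
    unfolding measurable_pair_iff comp_def
    by (intro conjI measurable_snd measurable_compose[OF measurable_fst] measurable_restrict_space1 measurable_ident)
      auto
  have "G \<in> borel_measurable (restrict_space borel {0..} \<Otimes>\<^sub>M M)"
    by (rule measurable_compose[where f="\<lambda>z. z"]) measurable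
  moreover have "local_time X t x \<omega> = G (t, \<omega>)" if t: "0 \<le> t" and o: "\<omega> \<in> space M" for t \<omega>
  proof (cases "\<forall>k. spent [] k \<omega> \<le> t")
    case True
    then have "(\<lambda>k. if spent [] k \<omega> \<le> t \<and> t < spent [] (Suc k) \<omega> then spent x k \<omega> else 0) = (\<lambda>k. 0)" by (auto simp: not_less[symmetric])
    then show ?thesis using True local_time_never[OF o, of t x] by (simp add: G_def del: if_cancel)
  next
    case False
    then obtain K where "t < spent [] K \<omega>" by (auto simp: not_le)
    from spent_interval[OF t this] obtain k where k: "spent [] k \<omega> \<le> t" "t < spent [] (Suc k) \<omega>" by blast
    have "(\<Sum>j. if spent [] j \<omega> \<le> t \<and> t < spent [] (Suc j) \<omega> then spent x j \<omega> else 0) =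
        (\<Sum>j\<in>{k}. if spent [] j \<omega> \<le> t \<and> t < spent [] (Suc j) \<omega> then spent x j \<omega> else 0)"
      by (rule suminf_finite) (use spent_interval_unique[OF o k] in auto)
    moreover have "(if \<forall>k. spent [] k \<omega> \<le> t then occupation_time X (Inf {}) x \<omega> else 0) = 0"
      using False by (rule if_not_P)
    ultimately show ?thesis using k local_time_eq[OF o k x] by (simp add: G_def)
  qed
  ultimately show ?thesis
    by (subst measurable_cong[where g=G]) (auto simp: space_pair_measure space_restrict_space)
qed

lemma local_time_measurable[measurable]:
  assumes "x \<noteq> []" "0 \<le> t"
  shows "local_time X t x \<in> borel_measurable M"
  using measurable_Pair_compose_split[OF local_time_measurable_pair[OF assms(1)], of "\<lambda>_. t" M "\<lambda>\<omega>. \<omega>"] assms(2)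
  by (simp add: measurable_restrict_space2)

text \<open>
  Killing only at the root already bounds the Green function by \<open>1 / l []\<close>; that this bound is
  attained as the other rates tend to \<open>0\<close> forces the root to be visited for an infinite time.
\<close>

lemma root_time_unbounded: "AE \<omega> in M. \<forall>t. \<exists>k. t < spent [] k \<omega>"
proof -
  have "AE \<omega> in M. \<exists>k. real N < spent [] k \<omega>" for N :: nat
  proof -
    define B where "B = {\<omega>\<in>space M. \<forall>k. spent [] k \<omega> \<le> real N}"
    have [measurable]: "B \<in> sets M" unfolding B_def by measurable
    \<comment> \<open>Rate 1 at the root and rates tending to 0 elsewhere, so that in the limit all
      killing takes place at the root.\<close>
    define l where "l m = (\<lambda>x::nat list. if x = [] then 1 else 1 / real (Suc m))" for m
    let ?s = "\<lambda>m k \<omega>. indicator {\<omega>\<in>space M. Y k \<omega> = []} \<omega> * killed (l m) k \<omega> * ennreal (1 - exp (- l m [] * S k \<omega>))"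
    have "(\<Sum>k. ?s m k \<omega>) + ennreal (exp (- real N)) * indicator B \<omega> \<le> 1" if o: "\<omega> \<in> space M" for m \<omega>
    proof -
      have kl: "killed (l m) k \<omega> \<le> ennreal (exp (- spent [] k \<omega>))" for k
      proof -
        have "killed (l m) k \<omega> = ennreal (exp (\<Sum>i<k. - l m (Y i \<omega>) * S i \<omega>))"
          unfolding killed_def by (simp add: prod_ennreal exp_sum)
        also have "\<dots> \<le> ennreal (exp (\<Sum>i<k. - (if Y i \<omega> = [] then S i \<omega> else 0)))"
          using S_pos[OF o] by (intro ennreal_leI) (auto intro!: sum_mono simp: l_def less_imp_le)
        finally show ?thesis by (simp add: spent_def sum_negf)
      qed
      have st: "?s m k \<omega> \<le> ennreal (exp (- spent [] k \<omega>) - exp (- spent [] (Suc k) \<omega>))" for k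
      proof (cases "Y k \<omega> = []")
        case True
        have "?s m k \<omega> \<le> ennreal (exp (- spent [] k \<omega>)) * ennreal (1 - exp (- S k \<omega>))"
          using True o kl[of k] by (auto simp: l_def intro!: mult_right_mono)
        also have "\<dots> = ennreal (exp (- spent [] k \<omega>) * (1 - exp (- S k \<omega>)))"
          using S_pos[OF o, of k] by (subst ennreal_mult) auto
        also have "exp (- spent [] k \<omega>) * (1 - exp (- S k \<omega>)) = exp (- spent [] k \<omega>) - exp (- spent [] (Suc k) \<omega>)"
          using True by (simp add: spent_Suc right_diff_distrib mult_exp_exp)
        finally show ?thesis .
      qed (simp add: spent_Suc)
      \<comment> \<open>The chances of dying at the root telescope to at most
        \<open>1 - exp (- spent [] K \<omega>)\<close>, and on \<open>B\<close> the missing part is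
        at least \<open>exp (- real N)\<close>.\<close>
      have "(\<Sum>k<K. ?s m k \<omega>) + ennreal (exp (- real N)) * indicator B \<omega> \<le> 1" for K
      proof -
        have "(\<Sum>k<K. ?s m k \<omega>) \<le> (\<Sum>k<K. ennreal (exp (- spent [] k \<omega>) - exp (- spent [] (Suc k) \<omega>)))"
          by (intro sum_mono st)
        also have "\<dots> = ennreal (\<Sum>k<K. exp (- spent [] k \<omega>) - exp (- spent [] (Suc k) \<omega>))"
          using spent_mono[OF o] by (intro sum_ennreal) auto
        also have "(\<Sum>k<K. exp (- spent [] k \<omega>) - exp (- spent [] (Suc k) \<omega>)) = 1 - exp (- spent [] K \<omega>)"
          by (subst sum_lessThan_telescope') (simp add: spent_def)
        finally have 1: "(\<Sum>k<K. ?s m k \<omega>) \<le> ennreal (1 - exp (- spent [] K \<omega>))" .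
        have "ennreal (exp (- real N)) * indicator B \<omega> \<le> ennreal (exp (- spent [] K \<omega>))"
          by (auto simp: B_def indicator_def)
        with 1 have "(\<Sum>k<K. ?s m k \<omega>) + ennreal (exp (- real N)) * indicator B \<omega> \<le> ennreal (1 - exp (- spent [] K \<omega>)) + ennreal (exp (- spent [] K \<omega>))"
          by (rule add_mono)
        also have "\<dots> = ennreal (1 - exp (- spent [] K \<omega>) + exp (- spent [] K \<omega>))"
          using spent_nonneg[OF o, of "[]" K] by (intro ennreal_plus[symmetric]) auto
        finally show ?thesis by simp
      qed
      moreover have "(\<lambda>K. (\<Sum>k<K. ?s m k \<omega>) + ennreal (exp (- real N)) * indicator B \<omega>) \<longlonglongrightarrow> (\<Sum>k. ?s m k \<omega>) + ennreal (exp (- real N)) * indicator B \<omega>"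
        by (intro tendsto_add summable_LIMSEQ tendsto_const) auto
      ultimately show ?thesis by (intro LIMSEQ_le_const2) auto
    qed
    then have "(\<integral>\<^sup>+\<omega>. (\<Sum>k. ?s m k \<omega>) + ennreal (exp (- real N)) * indicator B \<omega> \<partial>M) \<le> (\<integral>\<^sup>+\<omega>. 1 \<partial>M)" for m
      by (intro nn_integral_mono)
    moreover have "(\<integral>\<^sup>+\<omega>. (\<Sum>k. ?s m k \<omega>) + ennreal (exp (- real N)) * indicator B \<omega> \<partial>M) =
        ennreal (1 / Phi b n (l m)) + ennreal (exp (- real N) * prob B)" for m
    proof -
      have "(\<integral>\<^sup>+\<omega>. (\<Sum>k. ?s m k \<omega>) \<partial>M) = ennreal (l m [] / Phi b n (l m))"
        by (rule green_root[where \<delta>="1 / real (Suc m)"]) (auto simp: l_def)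
      moreover have "(\<integral>\<^sup>+\<omega>. ennreal (exp (- real N)) * indicator B \<omega> \<partial>M) = ennreal (exp (- real N) * prob B)"
        by (simp add: nn_integral_cmult emeasure_eq_measure ennreal_mult)
      ultimately show ?thesis by (subst nn_integral_add) (auto simp: l_def)
    qed
    ultimately have le: "ennreal (1 / Phi b n (l m) + exp (- real N) * prob B) \<le> 1" for m
      using Phi_nonneg[of "l m" b n] by (simp add: emeasure_space_1 l_def)
    then have le: "1 / Phi b n (l m) + exp (- real N) * prob B \<le> 1" for m
      using ennreal_le_1 by blast
    have "(\<lambda>m. l m x) \<longlonglongrightarrow> (if x = [] then 1 else 0)" for x
      using LIMSEQ_inverse_real_of_nat by (cases "x = []") (auto simp: l_def inverse_eq_divide)
    then have "(\<lambda>m. Phi b n (l m)) \<longlonglongrightarrow> Phi b n (\<lambda>x. if x = [] then 1 else 0)"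
      by (rule Phi_tendsto) auto
    also have "Phi b n (\<lambda>x. if x = [] then 1 else 0) = 1"
      by (subst Phi_root) (simp add: Phi_zero)
    \<comment> \<open>The exponent tends to 1, so the first term alone exhausts the bound 1 and
      nothing is left for \<open>B\<close>.\<close>
    finally have "(\<lambda>m. 1 / Phi b n (l m) + exp (- real N) * prob B) \<longlonglongrightarrow> 1 / 1 + exp (- real N) * prob B"
      by (intro tendsto_intros) auto
    then have "1 / 1 + exp (- real N) * prob B \<le> 1"
      using le by (intro LIMSEQ_le_const2) auto
    then have "prob B = 0" using measure_nonneg[of M B] by (simp add: mult_le_0_iff)
    then have "AE \<omega> in M. \<omega> \<notin> B" by (intro AE_not_in) (simp add: null_sets_def emeasure_eq_measure)
    then show ?thesis by (rule AE_mp) (auto intro!: AE_I2 simp: B_def not_le)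
  qed
  then have "AE \<omega> in M. \<forall>N::nat. \<exists>k. real N < spent [] k \<omega>" by (simp add: AE_all_countable)
  then show ?thesis
  proof eventually_elim
    case (elim \<omega>)
    then show ?case by (meson less_trans reals_Archimedean2)
  qed
qed

end

section \<open>Laplace transform of the local times\<close>

lemma exponential_law_Ico:
  assumes d: "0 < d" and a: "0 \<le> a" "a \<le> c"
  shows "emeasure (exponential_law d) {a..<c} = ennreal (exp (- d * a) - exp (- d * c))"
proof -
  interpret prob_space "exponential_law d" using d by (rule prob_space_exponential_density)
  have ae: "AE x in lborel. x \<noteq> a \<and> x \<noteq> c" using AE_lborel_singleton[of a] AE_lborel_singleton[of c] by eventually_elim simp
  have "AE x in exponential_law d. x \<noteq> a \<and> x \<noteq> c" by (subst AE_density, simp) (rule eventually_mono[OF ae], simp)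
  then have "emeasure (exponential_law d) {a..<c} = emeasure (exponential_law d) ({a<..} - {c<..})"
    by (intro emeasure_eq_AE) (auto elim!: eventually_mono simp del: AE_conj_iff)
  also have "\<dots> = emeasure (exponential_law d) {a<..} - emeasure (exponential_law d) {c<..}"
    using a by (intro emeasure_Diff) auto
  also have "\<dots> = ennreal (exp (- d * a) - exp (- d * c))"
    using a by (simp add: exponential_law_tail[OF d] ennreal_minus)
  finally show ?thesis .
qed

text \<open>Makes the averages of \<open>f\<close> under the exponential laws of rate
  \<open>1 + k\<close> into, up to a factor, the Laplace transform at \<open>k\<close> of the
  measure with density \<open>f\<close> relative to the law of rate 1.\<close>

lemma exponential_law_tilt:
  assumes k: "0 \<le> k" and [measurable]: "f \<in> borel_measurable borel"
  shows "(\<integral>\<^sup>+x. f x * ennreal (exp (- k * x)) \<partial>exponential_law 1) = ennreal (1 / (1 + k)) * (\<integral>\<^sup>+x. f x \<partial>exponential_law (1 + k))"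
proof -
  have e: "exponential_density 1 x * exp (- k * x) = 1 / (1 + k) * exponential_density (1 + k) x" for x
    using k by (simp add: erlang_density_def mult_exp_exp algebra_simps add_divide_distrib[symmetric])
      (simp add: field_simps)
  have "(\<integral>\<^sup>+x. f x * ennreal (exp (- k * x)) \<partial>exponential_law 1) =
      (\<integral>\<^sup>+x. ennreal (exponential_density 1 x * exp (- k * x)) * f x \<partial>lborel)"
    by (subst nn_integral_density) (auto simp: ennreal_mult mult_ac intro!: nn_integral_cong)
  also have "\<dots> = (\<integral>\<^sup>+x. ennreal (1 / (1 + k)) * (ennreal (exponential_density (1 + k) x) * f x) \<partial>lborel)"
    unfolding e using k by (subst ennreal_mult) (auto simp: mult_ac)
  also have "\<dots> = ennreal (1 / (1 + k)) * (\<integral>\<^sup>+x. f x \<partial>exponential_law (1 + k))"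
    by (subst nn_integral_cmult) (auto simp: nn_integral_density)
  finally show ?thesis .
qed

text \<open>Supplies times just to the right of a given one at which an almost-everywhere identity
  holds.\<close>

lemma AE_lborel_dense:
  assumes P: "AE x in lborel. P x" and ab: "a < (b :: real)"
  shows "\<exists>x. a < x \<and> x < b \<and> P x"
proof (rule ccontr)
  assume "\<not> ?thesis"
  then have sub: "{a<..<b} \<subseteq> {x \<in> space lborel. \<not> P x}" by auto
  obtain N where N: "{x \<in> space lborel. \<not> P x} \<subseteq> N" "emeasure lborel N = 0" "N \<in> sets lborel"
    using P by (rule AE_E)
  have "emeasure lborel {a<..<b} \<le> emeasure lborel N"
    using sub N by (intro emeasure_mono) auto
  then show False using N ab by simp
qed

context tree_path
begin

lemma finite_V: "finite V" by (rule finite_tree_vertices)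

lemma local_time_measurable_max:
  assumes x: "x \<noteq> []"
  shows "(\<lambda>(t, \<omega>). local_time X (max 0 t) x \<omega>) \<in> borel_measurable (borel \<Otimes>\<^sub>M M)"
proof -
  have "(\<lambda>(t, \<omega>). (max 0 t, \<omega>)) \<in> (borel :: real measure) \<Otimes>\<^sub>M M \<rightarrow>\<^sub>M restrict_space borel {0..} \<Otimes>\<^sub>M M"
    unfolding split_beta by (intro measurable_Pair measurable_restrict_space2 measurable_snd) auto
  from measurable_compose[OF this local_time_measurable_pair[OF x]] show ?thesis by (simp add: split_beta)
qed

lemma local_time_right_const: "AE \<omega> in M. \<forall>t\<ge>0. \<exists>u>t. \<forall>s x. t \<le> s \<longrightarrow> s < u \<longrightarrow> x \<noteq> [] \<longrightarrow> local_time X s x \<omega> = local_time X t x \<omega>"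
proof (use root_time_unbounded AE_space in eventually_elim, intro allI impI)
  fix \<omega> t assume un: "\<forall>t. \<exists>k. t < spent [] k \<omega>" and o: "\<omega> \<in> space M" and t: "0 \<le> (t::real)"
  obtain K where "t < spent [] K \<omega>" using un by blast
  from spent_interval[OF t this] obtain k where k: "spent [] k \<omega> \<le> t" "t < spent [] (Suc k) \<omega>" by blast
  show "\<exists>u>t. \<forall>s x. t \<le> s \<longrightarrow> s < u \<longrightarrow> x \<noteq> [] \<longrightarrow> local_time X s x \<omega> = local_time X t x \<omega>"
    using k by (intro exI[of _ "spent [] (Suc k) \<omega>"]) (auto simp: local_time_eq[OF o, where k=k])
qed

lemma sum_spent:
  assumes o: "\<omega> \<in> space M"
  shows "(\<Sum>x\<in>V. l x * spent x k \<omega>) = (\<Sum>i<k. l (Y i \<omega>) * S i \<omega>)"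
proof -
  have "(\<Sum>x\<in>V. l x * spent x k \<omega>) = (\<Sum>x\<in>V. \<Sum>i<k. if Y i \<omega> = x then l x * S i \<omega> else 0)"
    unfolding spent_def sum_distrib_left by (intro sum.cong) auto
  also have "\<dots> = (\<Sum>i<k. \<Sum>x\<in>V. if Y i \<omega> = x then l x * S i \<omega> else 0)" by (rule sum.swap)
  also have "\<dots> = (\<Sum>i<k. l (Y i \<omega>) * S i \<omega>)"
    using Y_in[OF o] by (intro sum.cong) (auto simp: finite_V)
  finally show ?thesis .
qed

text \<open>The root is left out because its local time serves as the clock; \<open>max 0 t\<close>
  extends the sum to all real \<open>t\<close> for joint measurability.\<close>

definition weighted :: "(nat list \<Rightarrow> real) \<Rightarrow> real \<Rightarrow> 'a \<Rightarrow> real" where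
  "weighted l t \<omega> = (\<Sum>x\<in>V - {[]}. l x * local_time X (max 0 t) x \<omega>)"

lemma weighted_measurable: "(\<lambda>(t, \<omega>). weighted l t \<omega>) \<in> borel_measurable (borel \<Otimes>\<^sub>M M)"
  unfolding weighted_def split_beta
  by (intro borel_measurable_sum borel_measurable_times borel_measurable_const local_time_measurable_max[unfolded split_beta]) auto

lemma weighted_measurable'[measurable]: "weighted l t \<in> borel_measurable M"
  using measurable_Pair_compose_split[OF weighted_measurable[of l], of "\<lambda>_. t" M "\<lambda>\<omega>. \<omega>"] by simp

text \<open>The weighted sum is constant while the clock runs through one stay at the root, and the
  exponential law of rate \<alpha> gives the interval from \<open>a\<close> to \<open>c\<close> the
  mass \<open>exp (- \<alpha> * a) - exp (- \<alpha> * c)\<close>. Killing at rate \<alpha> at the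
  root produces the same weights, whence the updated rates on the right.\<close>

lemma laplace_in_time_pathwise:
  assumes a: "0 < \<alpha>" and o: "\<omega> \<in> space M" and un: "\<forall>t. \<exists>k. t < spent [] k \<omega>"
  shows "(\<integral>\<^sup>+t. ennreal (exp (- weighted l t \<omega>)) \<partial>exponential_law \<alpha>) =
    (\<Sum>k. indicator {\<omega>\<in>space M. Y k \<omega> = []} \<omega> * killed (l([] := \<alpha>)) k \<omega> * ennreal (1 - exp (- (l([] := \<alpha>)) [] * S k \<omega>)))"
proof -
  define c where "c k = (\<Sum>x\<in>V - {[]}. l x * spent x k \<omega>)" for k
  let ?R = "\<lambda>k. spent [] k \<omega>"
  have pt: "ennreal (exp (- weighted l t \<omega>)) = (\<Sum>k. ennreal (exp (- c k)) * indicator {?R k..<?R (Suc k)} t)" if t: "0 \<le> t" for t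
  proof -
    obtain K where "t < ?R K" using un by blast
    from spent_interval[OF t this] obtain k where k: "?R k \<le> t" "t < ?R (Suc k)" by blast
    have "(\<Sum>k. ennreal (exp (- c k)) * indicator {?R k..<?R (Suc k)} t) = (\<Sum>k\<in>{k}. ennreal (exp (- c k)) * indicator {?R k..<?R (Suc k)} t)"
      by (rule suminf_finite) (use spent_interval_unique[OF o k] in \<open>auto simp: indicator_def\<close>)
    also have "\<dots> = ennreal (exp (- c k))" using k by simp
    also have "c k = weighted l t \<omega>"
      unfolding c_def weighted_def using t k by (intro sum.cong) (auto simp: local_time_eq[OF o k] max_def)
    finally show ?thesis by simp
  qed
  have "(\<integral>\<^sup>+t. ennreal (exp (- weighted l t \<omega>)) \<partial>exponential_law \<alpha>) = (\<integral>\<^sup>+t. (\<Sum>k. ennreal (exp (- c k)) * indicator {?R k..<?R (Suc k)} t) \<partial>exponential_law \<alpha>)"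
  proof (rule nn_integral_cong_AE)
    have "AE x in exponential_law \<alpha>. 0 \<le> x" by (subst AE_density) (auto simp: erlang_density_def)
    then show "AE t in exponential_law \<alpha>. ennreal (exp (- weighted l t \<omega>)) = (\<Sum>k. ennreal (exp (- c k)) * indicator {?R k..<?R (Suc k)} t)"
      by eventually_elim (rule pt)
  qed
  also have "\<dots> = (\<Sum>k. \<integral>\<^sup>+t. ennreal (exp (- c k)) * indicator {?R k..<?R (Suc k)} t \<partial>exponential_law \<alpha>)"
    by (rule nn_integral_suminf) measurable
  also have "\<dots> = (\<Sum>k. ennreal (exp (- c k)) * ennreal (exp (- \<alpha> * ?R k) - exp (- \<alpha> * ?R (Suc k))))"
  proof (rule suminf_cong)
    fix k
    have "(\<integral>\<^sup>+t. ennreal (exp (- c k)) * indicator {?R k..<?R (Suc k)} t \<partial>exponential_law \<alpha>) = ennreal (exp (- c k)) * emeasure (exponential_law \<alpha>) {?R k..<?R (Suc k)}"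
      by (rule nn_integral_cmult_indicator) simp
    also have "emeasure (exponential_law \<alpha>) {?R k..<?R (Suc k)} = ennreal (exp (- \<alpha> * ?R k) - exp (- \<alpha> * ?R (Suc k)))"
      by (rule exponential_law_Ico[OF a spent_nonneg[OF o] spent_mono[OF o]]) simp
    finally show "(\<integral>\<^sup>+t. ennreal (exp (- c k)) * indicator {?R k..<?R (Suc k)} t \<partial>exponential_law \<alpha>) =
      ennreal (exp (- c k)) * ennreal (exp (- \<alpha> * ?R k) - exp (- \<alpha> * ?R (Suc k)))" .
  qed
  also have "\<dots> = (\<Sum>k. indicator {\<omega>\<in>space M. Y k \<omega> = []} \<omega> * killed (l([] := \<alpha>)) k \<omega> * ennreal (1 - exp (- (l([] := \<alpha>)) [] * S k \<omega>)))"
  proof (rule suminf_cong)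
    fix k
    have root: "[] \<in> V" by (simp add: tree_vertices_def)
    have "(\<Sum>i<k. (l([] := \<alpha>)) (Y i \<omega>) * S i \<omega>) = (\<Sum>x\<in>V. (l([] := \<alpha>)) x * spent x k \<omega>)" by (rule sum_spent[OF o, symmetric])
    also have "\<dots> = \<alpha> * ?R k + (\<Sum>x\<in>V - {[]}. (l([] := \<alpha>)) x * spent x k \<omega>)"
      by (subst sum.remove[OF finite_V root]) simp
    also have "(\<Sum>x\<in>V - {[]}. (l([] := \<alpha>)) x * spent x k \<omega>) = c k" unfolding c_def by (rule sum.cong) auto
    finally have kl: "killed (l([] := \<alpha>)) k \<omega> = ennreal (exp (- (\<alpha> * ?R k + c k)))"
      unfolding killed_def by (simp add: prod_ennreal exp_sum[symmetric] sum_negf)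
    show "ennreal (exp (- c k)) * ennreal (exp (- \<alpha> * ?R k) - exp (- \<alpha> * ?R (Suc k))) =
      indicator {\<omega>\<in>space M. Y k \<omega> = []} \<omega> * killed (l([] := \<alpha>)) k \<omega> * ennreal (1 - exp (- (l([] := \<alpha>)) [] * S k \<omega>))"
    proof (cases "Y k \<omega> = []")
      case True
      have p: "0 \<le> 1 - exp (- \<alpha> * S k \<omega>)" using a S_pos[OF o, of k] by simp
      have e: "exp (- \<alpha> * ?R k) - exp (- \<alpha> * ?R (Suc k)) = exp (- \<alpha> * ?R k) * (1 - exp (- \<alpha> * S k \<omega>))"
        using True by (simp add: spent_Suc right_diff_distrib mult_exp_exp algebra_simps)
      have "ennreal (exp (- c k)) * ennreal (exp (- \<alpha> * ?R k) - exp (- \<alpha> * ?R (Suc k))) = ennreal (exp (- c k) * exp (- \<alpha> * ?R k)) * ennreal (1 - exp (- \<alpha> * S k \<omega>))"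
        unfolding e using p by (simp add: ennreal_mult mult.assoc)
      also have "exp (- c k) * exp (- \<alpha> * ?R k) = exp (- (\<alpha> * ?R k + c k))" by (simp add: mult_exp_exp)
      finally show ?thesis using True o kl by simp
    qed (simp add: spent_Suc)
  qed
  finally show ?thesis .
qed

text \<open>With \<Lambda> the exponent for root rate 0, the value is also the mean of
  \<open>exp (- \<Lambda> * T)\<close> for an exponential \<open>T\<close> of rate \<alpha>, which
  is how \<Lambda> is recognised as the decay rate in \<open>t\<close>.\<close>

lemma laplace_in_time:
  assumes a: "0 < \<alpha>" and l: "\<And>x. \<delta> \<le> l x" and d: "0 < \<delta>"
  shows "(\<integral>\<^sup>+t. (\<integral>\<^sup>+\<omega>. ennreal (exp (- weighted l t \<omega>)) \<partial>M) \<partial>exponential_law \<alpha>) =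
    ennreal (\<alpha> / (\<alpha> + Phi b n (l([] := 0))))"
proof -
  interpret E: prob_space "exponential_law \<alpha>" using a by (rule prob_space_exponential_density)
  interpret pair_sigma_finite "exponential_law \<alpha>" M ..
  have "(\<integral>\<^sup>+t. (\<integral>\<^sup>+\<omega>. ennreal (exp (- weighted l t \<omega>)) \<partial>M) \<partial>exponential_law \<alpha>) =
    (\<integral>\<^sup>+\<omega>. (\<integral>\<^sup>+t. ennreal (exp (- weighted l t \<omega>)) \<partial>exponential_law \<alpha>) \<partial>M)"
    using weighted_measurable[of l] by (intro Fubini'[symmetric]) (simp add: split_beta cong: measurable_cong_sets)
  also have "\<dots> = (\<integral>\<^sup>+\<omega>. (\<Sum>k. indicator {\<omega>\<in>space M. Y k \<omega> = []} \<omega> * killed (l([] := \<alpha>)) k \<omega> * ennreal (1 - exp (- (l([] := \<alpha>)) [] * S k \<omega>))) \<partial>M)"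
    using root_time_unbounded AE_space
    by (intro nn_integral_cong_AE, eventually_elim) (rule laplace_in_time_pathwise[OF a])
  \<comment> \<open>Once the root rate is \<alpha>, all rates are bounded below by the smaller of
    \<alpha> and \<delta>.\<close>
  also have "\<dots> = ennreal ((l([] := \<alpha>)) [] / Phi b n (l([] := \<alpha>)))"
    using l a d by (intro green_root[where \<delta>="min \<alpha> \<delta>"]) (auto simp: min_def intro: order_trans)
  also have "Phi b n (l([] := \<alpha>)) = \<alpha> + Phi b n (l([] := 0))"
    by (subst Phi_root) simp
  finally show ?thesis by simp
qed

lemma laplace_local_time_aux:
  assumes l: "\<And>x. \<delta> \<le> l x" and d: "0 < \<delta>" and t: "0 \<le> t"
  shows "(\<integral>\<^sup>+\<omega>. ennreal (exp (- weighted l t \<omega>)) \<partial>M) = ennreal (exp (- t * Phi b n (l([] := 0))))"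
proof -
  define \<Lambda> where "\<Lambda> = Phi b n (l([] := 0))"
  have l0: "0 \<le> l x" for x using l[of x] d by linarith
  have L: "0 \<le> \<Lambda>" unfolding \<Lambda>_def using l0 by (intro Phi_nonneg) auto
  define F where "F t = (\<integral>\<^sup>+\<omega>. ennreal (exp (- weighted l t \<omega>)) \<partial>M)" for t
  define G where "G t = ennreal (exp (- \<Lambda> * t))" for t
  have [measurable]: "F \<in> borel_measurable borel"
    unfolding F_def using weighted_measurable[of l]
    by (intro borel_measurable_nn_integral) (simp add: split_beta)
  have [measurable]: "G \<in> borel_measurable borel" unfolding G_def by measurable
  have w0: "0 \<le> weighted l t \<omega>" for t \<omega>
    unfolding weighted_def using l0 local_time_nonneg by (intro sum_nonneg mult_nonneg_nonneg)
  have F1: "F t \<le> 1" for t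
  proof -
    have "F t \<le> (\<integral>\<^sup>+\<omega>. 1 \<partial>M)" unfolding F_def using w0 by (intro nn_integral_mono) simp
    then show ?thesis by (simp add: emeasure_space_1)
  qed
  interpret E: prob_space "exponential_law 1" by (rule prob_space_exponential_density) simp
  have Epos: "AE x in exponential_law 1. 0 \<le> x" by (subst AE_density) (auto simp: erlang_density_def)
  have G1: "AE x in exponential_law 1. G x \<le> 1" using Epos by eventually_elim (use L in \<open>simp add: G_def\<close>)
  \<comment> \<open>The true transform \<open>F\<close> and its claimed value \<open>G\<close> are
    treated as densities of finite measures, so that equality of the measures gives equality of the
    functions almost everywhere.\<close>
  have "density (exponential_law 1) F = density (exponential_law 1) G"
  proof (rule laplace_determines_measure)
    have "(\<integral>\<^sup>+x. F x \<partial>exponential_law 1) \<le> (\<integral>\<^sup>+x. 1 \<partial>exponential_law 1)" using F1 by (intro nn_integral_mono)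
    then have f: "(\<integral>\<^sup>+x. F x \<partial>exponential_law 1) \<le> 1" using E.emeasure_space_1 by simp
    have "(\<integral>\<^sup>+x. G x \<partial>exponential_law 1) \<le> (\<integral>\<^sup>+x. 1 \<partial>exponential_law 1)" using G1 by (intro nn_integral_mono_AE)
    then have g: "(\<integral>\<^sup>+x. G x \<partial>exponential_law 1) \<le> 1" using E.emeasure_space_1 by simp
    show "finite_measure (density (exponential_law 1) F)"
      using f by (intro finite_measureI) (auto simp: emeasure_density top_unique)
    show "finite_measure (density (exponential_law 1) G)"
      using g by (intro finite_measureI) (auto simp: emeasure_density top_unique)
    have n: "emeasure (exponential_law 1) {..<0} = 0"
      using Epos by (subst AE_iff_measurable[symmetric, where P="\<lambda>x. 0 \<le> x"]) auto
    then have "{..<0} \<in> null_sets (exponential_law 1)" by auto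
    then show "emeasure (density (exponential_law 1) F) {..<0} = 0" "emeasure (density (exponential_law 1) G) {..<0} = 0"
      by (auto simp: emeasure_density nn_integral_null_set mult.commute)
    fix k :: nat
    have "(\<integral>\<^sup>+y. ennreal (exp (- real k * y)) \<partial>density (exponential_law 1) F) = (\<integral>\<^sup>+y. F y * ennreal (exp (- real k * y)) \<partial>exponential_law 1)"
      by (subst nn_integral_density) auto
    also have "\<dots> = ennreal (1 / (1 + real k)) * (\<integral>\<^sup>+y. F y \<partial>exponential_law (1 + real k))"
      by (rule exponential_law_tilt) auto
    also have "(\<integral>\<^sup>+y. F y \<partial>exponential_law (1 + real k)) = ennreal ((1 + real k) / ((1 + real k) + \<Lambda>))"
      unfolding F_def \<Lambda>_def by (rule laplace_in_time[OF _ l d]) simp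
    also have "\<dots> = (\<integral>\<^sup>+y. G y \<partial>exponential_law (1 + real k))"
      unfolding G_def by (rule exponential_law_laplace[symmetric]) (auto simp: L)
    also have "ennreal (1 / (1 + real k)) * \<dots> = (\<integral>\<^sup>+y. G y * ennreal (exp (- real k * y)) \<partial>exponential_law 1)"
      by (rule exponential_law_tilt[symmetric]) auto
    also have "\<dots> = (\<integral>\<^sup>+y. ennreal (exp (- real k * y)) \<partial>density (exponential_law 1) G)"
      by (subst nn_integral_density) auto
    finally show "(\<integral>\<^sup>+y. ennreal (exp (- real k * y)) \<partial>density (exponential_law 1) F) = (\<integral>\<^sup>+y. ennreal (exp (- real k * y)) \<partial>density (exponential_law 1) G)" .
  qed simp_all
  then have "AE x in exponential_law 1. F x = G x"
    by (intro E.density_unique) auto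
  then have ae: "AE x in lborel. 0 \<le> x \<longrightarrow> F x = G x"
    by (subst (asm) AE_density) (auto simp: erlang_density_def elim!: eventually_mono)
  \<comment> \<open>Times with equality are taken strictly to the right of \<open>t\<close>, where
    the local times eventually coincide with those at \<open>t\<close>.\<close>
  have "\<exists>x. t < x \<and> x < t + 1 / real (Suc m) \<and> (0 \<le> x \<longrightarrow> F x = G x)" for m
    using ae by (rule AE_lborel_dense) simp
  then obtain s where s: "\<And>m. t < s m" "\<And>m. s m < t + 1 / real (Suc m)" "\<And>m. 0 \<le> s m \<Longrightarrow> F (s m) = G (s m)" by metis
  have s0: "0 \<le> s m" for m using s(1)[of m] t by linarith
  have "s \<longlonglongrightarrow> t"
  proof (rule tendsto_sandwich)
    show "\<forall>\<^sub>F m in sequentially. t \<le> s m" "\<forall>\<^sub>F m in sequentially. s m \<le> t + 1 / real (Suc m)"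
      using s by (auto intro!: always_eventually less_imp_le)
    show "(\<lambda>m. t + 1 / real (Suc m)) \<longlonglongrightarrow> t"
      using tendsto_add[OF tendsto_const[of t] LIMSEQ_inverse_real_of_nat] by (simp add: inverse_eq_divide)
  qed simp
  have "(\<lambda>m. F (s m)) \<longlonglongrightarrow> F t"
    unfolding F_def
  proof (rule nn_integral_dominated_convergence[where w="\<lambda>_. 1"])
    show "AE \<omega> in M. (\<lambda>m. ennreal (exp (- weighted l (s m) \<omega>))) \<longlonglongrightarrow> ennreal (exp (- weighted l t \<omega>))"
      using local_time_right_const
    proof eventually_elim
      case (elim \<omega>)
      then obtain u where u: "u > t" "\<And>s x. t \<le> s \<Longrightarrow> s < u \<Longrightarrow> x \<noteq> [] \<Longrightarrow> local_time X s x \<omega> = local_time X t x \<omega>"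
        using t by blast
      have "\<forall>\<^sub>F m in sequentially. s m < u" using \<open>s \<longlonglongrightarrow> t\<close> u(1) by (rule order_tendstoD)
      then have "\<forall>\<^sub>F m in sequentially. ennreal (exp (- weighted l (s m) \<omega>)) = ennreal (exp (- weighted l t \<omega>))"
      proof eventually_elim
        case (elim m)
        have "weighted l (s m) \<omega> = weighted l t \<omega>"
          unfolding weighted_def using elim s(1)[of m] s0[of m] t u(2)[of "s m"] by (intro sum.cong) (auto simp: max_def)
        then show ?case by simp
      qed
      then show ?case by (rule tendsto_eventually)
    qed
  qed (auto simp: w0 emeasure_space_1)
  moreover have "(\<lambda>m. F (s m)) \<longlonglongrightarrow> G t"
    unfolding s(3)[OF s0] G_def by (intro tendsto_intros \<open>s \<longlonglongrightarrow> t\<close>)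
  ultimately have "F t = G t" by (rule LIMSEQ_unique)
  then show ?thesis by (simp add: F_def G_def \<Lambda>_def mult.commute)
qed

text \<open>Adding \<open>1 / real (Suc m)\<close> to every rate reaches the strictly positive case,
  and both sides are continuous in the rates. Vanishing rates at inner vertices are what the leaf
  field requires.\<close>

lemma laplace_local_time:
  assumes l: "\<And>x. 0 \<le> l x" and t: "0 \<le> t"
  shows "(\<integral>\<^sup>+\<omega>. ennreal (exp (- (\<Sum>x\<in>V - {[]}. l x * local_time X t x \<omega>))) \<partial>M) = ennreal (exp (- t * Phi b n (l([] := 0))))"
proof -
  define lm where "lm m = (\<lambda>x. l x + 1 / real (Suc m))" for m
  have lim: "(\<lambda>m. lm m x) \<longlonglongrightarrow> l x" for x
    using tendsto_add[OF tendsto_const[of "l x"] LIMSEQ_inverse_real_of_nat] by (simp add: inverse_eq_divide lm_def)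
  have "(\<lambda>m. \<integral>\<^sup>+\<omega>. ennreal (exp (- weighted (lm m) t \<omega>)) \<partial>M) \<longlonglongrightarrow> (\<integral>\<^sup>+\<omega>. ennreal (exp (- weighted l t \<omega>)) \<partial>M)"
  proof (rule nn_integral_dominated_convergence[where w="\<lambda>_. 1"])
    have "0 \<le> weighted (lm m) t \<omega>" for m \<omega>
      unfolding weighted_def lm_def using l local_time_nonneg by (intro sum_nonneg mult_nonneg_nonneg) (auto simp: add_nonneg_nonneg)
    then show "AE \<omega> in M. ennreal (exp (- weighted (lm m) t \<omega>)) \<le> 1" for m by auto
    show "AE \<omega> in M. (\<lambda>m. ennreal (exp (- weighted (lm m) t \<omega>))) \<longlonglongrightarrow> ennreal (exp (- weighted l t \<omega>))"
      unfolding weighted_def by (intro AE_I2 tendsto_intros lim)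
  qed (auto simp: emeasure_space_1)
  moreover have "(\<integral>\<^sup>+\<omega>. ennreal (exp (- weighted (lm m) t \<omega>)) \<partial>M) = ennreal (exp (- t * Phi b n ((lm m)([] := 0))))" for m
    by (rule laplace_local_time_aux[where \<delta>="1 / real (Suc m)", OF _ _ t]) (auto simp: lm_def l)
  moreover have "(\<lambda>m. ennreal (exp (- t * Phi b n ((lm m)([] := 0))))) \<longlonglongrightarrow> ennreal (exp (- t * Phi b n (l([] := 0))))"
    using lim l by (intro tendsto_intros Phi_tendsto) auto
  ultimately have "(\<integral>\<^sup>+\<omega>. ennreal (exp (- weighted l t \<omega>)) \<partial>M) = ennreal (exp (- t * Phi b n (l([] := 0))))"
    by (auto intro: LIMSEQ_unique simp only:)
  then show ?thesis using t by (simp add: weighted_def max_def)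
qed

end

section \<open>Compound Poisson-Exponential variables\<close>

lemma prob_space_exponential_law: "prob_space (exponential_law 1)"
  by (rule prob_space_exponential_density) simp

abbreviation exponential_sequence :: "(nat \<Rightarrow> real) measure" where
  "exponential_sequence \<equiv> \<Pi>\<^sub>M i\<in>UNIV. exponential_law 1"

lemma prob_space_exponential_sequence: "prob_space exponential_sequence"
  by (rule prob_space_PiM) (rule prob_space_exponential_law)

lemma sets_exponential_sequence[measurable_cong]: "sets exponential_sequence = sets (\<Pi>\<^sub>M i\<in>UNIV. borel)"
  by (rule sets_PiM_cong) auto

lemma distr_exponential_sequence: "distr exponential_sequence borel (\<lambda>U. U i) = exponential_law 1"
proof -
  have "distr exponential_sequence (exponential_law 1) (\<lambda>U. U i) = exponential_law 1"
    by (rule distr_PiM_component) (auto intro: prob_space_exponential_law)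
  moreover have "distr exponential_sequence (exponential_law 1) (\<lambda>U. U i) = distr exponential_sequence borel (\<lambda>U. U i)"
    by (rule distr_cong) auto
  ultimately show ?thesis by simp
qed

lemma indep_exponential_sequence: "prob_space.indep_vars exponential_sequence (\<lambda>_. borel) (\<lambda>i U. U i) I"
proof -
  interpret prob_space exponential_sequence by (rule prob_space_exponential_sequence)
  have "indep_vars (\<lambda>_. borel) (\<lambda>i U. U i) UNIV"
    by (subst indep_vars_iff_distr_eq_PiM)
      (auto simp: distr_exponential_sequence restrict_UNIV intro!: distr_id2 sets_exponential_sequence[symmetric])
  then show ?thesis by (rule indep_vars_subset) auto
qed

lemma cpe_measurable: "(\<lambda>(N :: nat, U :: nat \<Rightarrow> real). \<Sum>i=1..N. U i) \<in> borel_measurable (measure_pmf p \<Otimes>\<^sub>M exponential_sequence)"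
proof -
  have "(\<lambda>(N :: nat, U :: nat \<Rightarrow> real). \<Sum>i=1..N. U i) \<in> borel_measurable (count_space UNIV \<Otimes>\<^sub>M exponential_sequence)"
    by (rule measurable_pair_measure_countable1) auto
  then show ?thesis by (simp cong: measurable_cong_sets)
qed

lemma prob_space_cpe: "prob_space (cpe_law t)"
proof -
  interpret p: prob_space "measure_pmf (poisson_pmf t)" by (rule prob_space_measure_pmf)
  interpret e: prob_space exponential_sequence by (rule prob_space_exponential_sequence)
  interpret pair_prob_space "measure_pmf (poisson_pmf t)" exponential_sequence ..
  show ?thesis unfolding cpe_law_def by (rule prob_space_distr[OF cpe_measurable])
qed

lemma sets_cpe[simp, measurable_cong]: "sets (cpe_law t) = sets borel"
  by (simp add: cpe_law_def)

lemma nn_integral_cpe: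
  assumes [measurable]: "f \<in> borel_measurable borel" and t: "0 < t"
  shows "(\<integral>\<^sup>+y. f y \<partial>cpe_law t) =
    (\<Sum>k. ennreal (t ^ k / fact k * exp (- t)) * (\<integral>\<^sup>+U. f (\<Sum>i=1..k. U i) \<partial>exponential_sequence))"
proof -
  interpret e: prob_space exponential_sequence by (rule prob_space_exponential_sequence)
  note [measurable] = cpe_measurable
  have "(\<integral>\<^sup>+y. f y \<partial>cpe_law t) = (\<integral>\<^sup>+z. f ((\<lambda>(N, U). \<Sum>i=1..N. U i) z) \<partial>(measure_pmf (poisson_pmf t) \<Otimes>\<^sub>M exponential_sequence))"
    unfolding cpe_law_def by (rule nn_integral_distr) auto
  also have "\<dots> = (\<integral>\<^sup>+k. \<integral>\<^sup>+U. f (\<Sum>i=1..k. U i) \<partial>exponential_sequence \<partial>measure_pmf (poisson_pmf t))"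
    by (subst e.nn_integral_fst[symmetric]) auto
  also have "\<dots> = (\<Sum>k. ennreal (pmf (poisson_pmf t) k) * (\<integral>\<^sup>+U. f (\<Sum>i=1..k. U i) \<partial>exponential_sequence))"
    by (simp add: nn_integral_measure_pmf nn_integral_count_space_nat)
  finally show ?thesis using t by simp
qed

lemma exponential_sum_laplace:
  assumes l: "0 \<le> l"
  shows "(\<integral>\<^sup>+U. ennreal (exp (- l * (\<Sum>i=1..k. U i))) \<partial>exponential_sequence) = ennreal ((1 / (1 + l)) ^ k)"
proof -
  interpret e: prob_space exponential_sequence by (rule prob_space_exponential_sequence)
  have "(\<integral>\<^sup>+U. ennreal (exp (- l * (\<Sum>i=1..k. U i))) \<partial>exponential_sequence) =
      (\<integral>\<^sup>+U. (\<Prod>i=1..k. ennreal (exp (- l * U i))) \<partial>exponential_sequence)"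
    by (simp add: prod_ennreal exp_sum[symmetric] sum_distrib_left sum_negf)
  also have "\<dots> = (\<Prod>i=1..k. \<integral>\<^sup>+U. ennreal (exp (- l * U i)) \<partial>exponential_sequence)"
    by (intro e.indep_vars_nn_integral e.indep_vars_compose2[OF indep_exponential_sequence]) auto
  also have "\<dots> = (\<Prod>i=1..k. ennreal (1 / (1 + l)))"
  proof (rule prod.cong)
    fix i
    have "(\<integral>\<^sup>+U. ennreal (exp (- l * U i)) \<partial>exponential_sequence) = (\<integral>\<^sup>+x. ennreal (exp (- l * x)) \<partial>distr exponential_sequence borel (\<lambda>U. U i))"
      by (subst nn_integral_distr) auto
    then show "(\<integral>\<^sup>+U. ennreal (exp (- l * U i)) \<partial>exponential_sequence) = ennreal (1 / (1 + l))"
      unfolding distr_exponential_sequence using exponential_law_laplace[of 1 l] l by simp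
  qed simp
  finally show ?thesis using l by (simp add: ennreal_power)
qed

lemma suminf_exp_ennreal:
  assumes "0 \<le> z"
  shows "(\<Sum>k. ennreal (z ^ k / fact k)) = ennreal (exp z)"
  using assms exp_converges[of z]
  by (intro suminf_ennreal_eq) (auto simp: scaleR_conv_of_real field_simps)

text \<open>The Poisson mixture of the powers of \<open>1 / (1 + l)\<close> sums to
  \<open>exp (- t + t / (1 + l))\<close>, and this exponent is \<open>- t\<close> times a unit edge
  in series with conductance \<open>l\<close>.\<close>

lemma cpe_laplace:
  assumes t: "0 < t" and l: "0 \<le> l"
  shows "(\<integral>\<^sup>+y. ennreal (exp (- l * y)) \<partial>cpe_law t) = ennreal (exp (- t * (l / (1 + l))))"
proof -
  have "(\<integral>\<^sup>+y. ennreal (exp (- l * y)) \<partial>cpe_law t) = (\<Sum>k. ennreal (t ^ k / fact k * exp (- t)) * ennreal ((1 / (1 + l)) ^ k))"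
    by (subst nn_integral_cpe) (auto simp: t exponential_sum_laplace[OF l, simplified])
  also have "\<dots> = (\<Sum>k. ennreal (exp (- t)) * ennreal ((t / (1 + l)) ^ k / fact k))"
    using t l by (intro suminf_cong) (simp add: ennreal_mult[symmetric] power_divide mult_ac)
  also have "\<dots> = ennreal (exp (- t)) * ennreal (exp (t / (1 + l)))"
    using t l by (subst ennreal_suminf_cmult, subst suminf_exp_ennreal) auto
  also have "\<dots> = ennreal (exp (- t + t / (1 + l)))" by (simp add: ennreal_mult[symmetric] exp_add[symmetric])
  also have "- t + t / (1 + l) = - t * (l / (1 + l))" using l by (simp add: field_simps)
  finally show ?thesis .
qed

lemma cpe_nonneg:
  assumes t: "0 < t"
  shows "AE y in cpe_law t. 0 \<le> y"
proof -
  have "emeasure (cpe_law t) {..<0} = (\<integral>\<^sup>+y. indicator {..<0} y \<partial>cpe_law t)" by simp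
  also have "\<dots> = (\<Sum>k. ennreal (t ^ k / fact k * exp (- t)) * (\<integral>\<^sup>+U. indicator {..<0} (\<Sum>i=1..k. U i) \<partial>exponential_sequence))"
    by (rule nn_integral_cpe) (auto simp: t)
  also have "\<dots> = (\<Sum>k. 0)"
  proof (rule suminf_cong)
    fix k
    have "AE x in exponential_law 1. 0 \<le> x" by (subst AE_density) (auto simp: erlang_density_def)
    then have "AE U in exponential_sequence. 0 \<le> U i" for i
      by (rule AE_PiM_component[rotated 2]) (auto intro: prob_space_exponential_law)
    then have "AE U in exponential_sequence. \<forall>i. 0 \<le> U i" by (simp add: AE_all_countable)
    then have "AE U in exponential_sequence. indicator {..<0::real} (\<Sum>i=1..k. U i) = (0 :: ennreal)"
      by eventually_elim (auto simp: indicator_def not_less sum_nonneg)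
    then have "(\<integral>\<^sup>+U. indicator {..<0} (\<Sum>i=1..k. U i) \<partial>exponential_sequence) = (\<integral>\<^sup>+U. 0 \<partial>exponential_sequence)"
      by (rule nn_integral_cong_AE)
    then show "ennreal (t ^ k / fact k * exp (- t)) * (\<integral>\<^sup>+U. indicator {..<0} (\<Sum>i=1..k. U i) \<partial>exponential_sequence) = 0" by simp
  qed
  finally have "emeasure (cpe_law t) {..<0} = 0" by simp
  then show ?thesis by (intro AE_I[where N="{..<0}"]) auto
qed

text \<open>With Poisson number 0 the variable is 0 and contributes nothing beyond
  \<open>s \<ge> 0\<close>; this leaves the factor \<open>t\<close>. The exponent is crude, but the
  bound is meant for \<open>t / n\<close> in place of \<open>t\<close> and \<open>s\<close> of order
  \<open>n\<close>, where \<open>t / n * (1 + s)\<close> stays bounded.\<close>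

lemma cpe_tail:
  assumes t: "0 < t" and s: "0 \<le> s"
  shows "emeasure (cpe_law t) {s<..} \<le> ennreal (t * exp (t * (1 + s) - s))"
proof -
  interpret e: prob_space exponential_sequence by (rule prob_space_exponential_sequence)
  have erl: "emeasure exponential_sequence {U \<in> space exponential_sequence. s < (\<Sum>i=1..Suc k. U i)} \<le> ennreal (exp (- s) * (1 + s) ^ k)" for k
  proof -
    have "distributed exponential_sequence lborel (\<lambda>U. U i) (exponential_density 1)" for i
      unfolding distributed_def using distr_exponential_sequence[of i] by (auto cong: distr_cong)
    then have "distributed exponential_sequence lborel (\<lambda>U. \<Sum>i\<in>{1..Suc k}. U i) (erlang_density (card {1..Suc k} - 1) 1)"
      by (intro e.exponential_distributed_sum indep_exponential_sequence) auto
    from e.erlang_distributed_gt[OF this _ s]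
    have "e.prob {U \<in> space exponential_sequence. s < (\<Sum>i=1..Suc k. U i)} = (\<Sum>j\<le>k. s ^ j * exp (- s) / fact j)"
      using s by (simp add: erlang_CDF_def)
    \<comment> \<open>The reciprocal factorial is at most 1, hence at most the binomial coefficient;
      the Erlang tail is thus dominated by a binomial sum, whose Poisson mixture is an exponential
      series.\<close>
    also have "\<dots> \<le> (\<Sum>j\<le>k. exp (- s) * (real (k choose j) * s ^ j))"
    proof (rule sum_mono)
      fix j assume "j \<in> {..k}"
      then have "1 \<le> real (k choose j)" by (simp add: Suc_leI zero_less_binomial)
      moreover have "1 / fact j \<le> (1 :: real)" by simp
      ultimately have "1 / fact j \<le> real (k choose j)" by linarith
      then have "(s ^ j * exp (- s)) * (1 / fact j) \<le> (s ^ j * exp (- s)) * real (k choose j)"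
        using s by (intro mult_left_mono) auto
      then show "s ^ j * exp (- s) / fact j \<le> exp (- s) * (real (k choose j) * s ^ j)" by (simp add: mult_ac)
    qed
    also have "\<dots> = exp (- s) * (1 + s) ^ k"
      using binomial_ring[of s 1 k] by (simp add: sum_distrib_left[symmetric] add.commute)
    finally show ?thesis unfolding e.emeasure_eq_measure by (rule ennreal_leI)
  qed
  have "emeasure (cpe_law t) {s<..} = (\<integral>\<^sup>+y. indicator {s<..} y \<partial>cpe_law t)" by simp
  also have "\<dots> = (\<Sum>k. ennreal (t ^ k / fact k * exp (- t)) * (\<integral>\<^sup>+U. indicator {s<..} (\<Sum>i=1..k. U i) \<partial>exponential_sequence))"
    by (rule nn_integral_cpe) (auto simp: t)
  also have "\<dots> = (\<Sum>k. ennreal (t ^ Suc k / fact (Suc k) * exp (- t)) * (\<integral>\<^sup>+U. indicator {s<..} (\<Sum>i=1..Suc k. U i) \<partial>exponential_sequence))"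
    using s by (subst suminf_offset[where i=1]) simp_all
  also have "\<dots> \<le> (\<Sum>k. ennreal (t * exp (- s)) * ennreal ((t * (1 + s)) ^ k / fact k))"
  proof (intro suminf_le summableI allI)
    fix k
    have "(\<integral>\<^sup>+U. indicator {s<..} (\<Sum>i=1..Suc k. U i) \<partial>exponential_sequence) = emeasure exponential_sequence {U \<in> space exponential_sequence. s < (\<Sum>i=1..Suc k. U i)}"
    proof -
      have "(\<integral>\<^sup>+U. indicator {s<..} (\<Sum>i=1..Suc k. U i) \<partial>exponential_sequence) =
        (\<integral>\<^sup>+U. indicator {U \<in> space exponential_sequence. s < (\<Sum>i=1..Suc k. U i)} U \<partial>exponential_sequence)"
        by (rule nn_integral_cong) (simp add: indicator_def)
      then show ?thesis by simp
    qed
    also note erl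
    finally have "ennreal (t ^ Suc k / fact (Suc k) * exp (- t)) * (\<integral>\<^sup>+U. indicator {s<..} (\<Sum>i=1..Suc k. U i) \<partial>exponential_sequence)
       \<le> ennreal (t ^ Suc k / fact (Suc k) * exp (- t)) * ennreal (exp (- s) * (1 + s) ^ k)"
      by (intro mult_left_mono) auto
    also have "\<dots> = ennreal (t ^ Suc k / fact (Suc k) * exp (- t) * (exp (- s) * (1 + s) ^ k))"
      using t s by (intro ennreal_mult[symmetric]) auto
    also have "\<dots> \<le> ennreal (t * exp (- s) * ((t * (1 + s)) ^ k / fact k))"
    proof (rule ennreal_leI)
      have "exp (- t) / fact (Suc k) \<le> 1 / fact k" 
        using t by (intro frac_le) (auto simp: fact_mono)
      then have "(t ^ Suc k * (exp (- s) * (1 + s) ^ k)) * (exp (- t) / fact (Suc k)) \<le> (t ^ Suc k * (exp (- s) * (1 + s) ^ k)) * (1 / fact k)"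
        using t s by (intro mult_left_mono) auto
      then show "t ^ Suc k / fact (Suc k) * exp (- t) * (exp (- s) * (1 + s) ^ k) \<le> t * exp (- s) * ((t * (1 + s)) ^ k / fact k)"
        by (simp add: power_mult_distrib mult_ac)
    qed
    also have "\<dots> = ennreal (t * exp (- s)) * ennreal ((t * (1 + s)) ^ k / fact k)"
      using t s by (intro ennreal_mult) auto
    finally show "ennreal (t ^ Suc k / fact (Suc k) * exp (- t)) * (\<integral>\<^sup>+U. indicator {s<..} (\<Sum>i=1..Suc k. U i) \<partial>exponential_sequence)
       \<le> ennreal (t * exp (- s)) * ennreal ((t * (1 + s)) ^ k / fact k)" .
  qed
  also have "\<dots> = ennreal (t * exp (- s)) * ennreal (exp (t * (1 + s)))"
    using t s by (subst ennreal_suminf_cmult, subst suminf_exp_ennreal) auto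
  also have "\<dots> = ennreal (t * exp (t * (1 + s) - s))"
    using t by (simp add: ennreal_mult[symmetric] mult_exp_exp mult.assoc)
  finally show ?thesis .
qed

section \<open>The kernel\<close>

lemma finite_tree_leaves: "finite (tree_leaves b n)"
  unfolding tree_leaves_def using finite_lists_length_eq[of "{..<b}" n] by (simp add: conj_commute)

section \<open>The variables Z_n as functions of the leaf field\<close>

text \<open>The level \<open>m\<close> in the linear factor is kept apart from the depth of the
  tree, because the cascade compares the levels \<open>n\<close> and \<open>n + 1\<close> at the
  same leaf.\<close>

definition zterm :: "nat \<Rightarrow> nat \<Rightarrow> real \<Rightarrow> real" where
  "zterm b m y = max 0 (real m * sqrt (ln (real b)) - sqrt y) * y powr (1 / 4) * exp (2 * sqrt (ln (real b)) * sqrt y)"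

definition zsum :: "nat \<Rightarrow> nat \<Rightarrow> (nat list \<Rightarrow> real) \<Rightarrow> real" where
  "zsum b n f = (1 / real b ^ (2 * n)) * (\<Sum>x\<in>tree_leaves b n. zterm b n (f x))"

lemma zterm_measurable[measurable]: "zterm b m \<in> borel_measurable borel"
  unfolding zterm_def by measurable

lemma zterm_0[simp]: "zterm b m 0 = 0"
  by (simp add: zterm_def)

lemma zterm_nonneg: "0 \<le> zterm b m y"
  unfolding zterm_def by (intro mult_nonneg_nonneg) auto

lemma zsum_nonneg: "0 \<le> zsum b n f"
  unfolding zsum_def by (intro mult_nonneg_nonneg sum_nonneg zterm_nonneg) auto

lemma zsum_measurable:
  assumes "\<And>x. x \<in> tree_leaves b n \<Longrightarrow> (\<lambda>\<omega>. f \<omega> x) \<in> borel_measurable N"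
  shows "(\<lambda>\<omega>. zsum b n (f \<omega>)) \<in> borel_measurable N"
  unfolding zsum_def
  by (intro borel_measurable_times borel_measurable_const borel_measurable_sum measurable_compose[OF assms zterm_measurable])

lemma zsum_cong: "(\<And>x. x \<in> tree_leaves b n \<Longrightarrow> f x = g x) \<Longrightarrow> zsum b n f = zsum b n g"
  unfolding zsum_def by simp

lemma Zn_eq: "Zn b n X t \<omega> = (if t = 0 then 0 else zsum b n (\<lambda>x. local_time X t x \<omega>))"
  by (simp add: Zn_def zsum_def zterm_def)

lemma Zn_nonneg: "0 \<le> Zn b n X t \<omega>"
  by (simp add: Zn_eq zsum_nonneg)

context tree_path
begin

lemma leaf_ne: "x \<in> tree_leaves b n \<Longrightarrow> x \<noteq> []"
  using n by (auto simp: tree_leaves_def)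

lemma leaves_subset: "tree_leaves b n \<subseteq> V - {[]}"
  using n by (auto simp: tree_leaves_def tree_vertices_def)

lemma local_time_0: "AE \<omega> in M. \<forall>x. x \<noteq> [] \<longrightarrow> local_time X 0 x \<omega> = 0"
proof -
  have "prob {\<omega>\<in>space M. \<forall>i\<le>0. Y i \<omega> = [] \<and> 0 < S i \<omega>} = 1"
    using skeleton_law[of 0 "\<lambda>_. 0" "\<lambda>_. []"] by simp
  then have "AE \<omega> in M. \<forall>i\<le>0. Y i \<omega> = [] \<and> 0 < S i \<omega>"
    by (subst (asm) prob_Collect_eq_1) auto
  then show ?thesis
    using AE_space
  proof eventually_elim
    case (elim \<omega>)
    then show ?case using local_time_eq[OF elim(2), of 0 0] by (auto simp: spent_def)
  qed
qed

text \<open>The walk almost surely begins with a stay at the root of positive length, so no leaf has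
  local time at \<open>t = 0\<close> and the convention for \<open>Zn\<close> at 0 agrees with its
  formula.\<close>

lemma Zn_AE: "AE \<omega> in M. \<forall>t\<ge>0. Zn b n X t \<omega> = zsum b n (\<lambda>x. local_time X t x \<omega>)"
  using local_time_0
proof eventually_elim
  case (elim \<omega>)
  then have "zsum b n (\<lambda>x. local_time X 0 x \<omega>) = 0"
    using leaf_ne unfolding zsum_def by simp
  then show ?case by (auto simp: Zn_eq)
qed

lemma Zn_right_const: "AE \<omega> in M. \<forall>t\<ge>0. \<exists>u>t. \<forall>s. t \<le> s \<longrightarrow> s < u \<longrightarrow> Zn b n X s \<omega> = Zn b n X t \<omega>"
  using Zn_AE local_time_right_const
proof eventually_elim
  case (elim \<omega>)
  show ?case
  proof (intro allI impI)
    fix t :: real assume t: "0 \<le> t"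
    then obtain u where u: "u > t" "\<And>s x. t \<le> s \<Longrightarrow> s < u \<Longrightarrow> x \<noteq> [] \<Longrightarrow> local_time X s x \<omega> = local_time X t x \<omega>"
      using elim(2) by blast
    have "Zn b n X s \<omega> = Zn b n X t \<omega>" if "t \<le> s" "s < u" for s
    proof -
      have "zsum b n (\<lambda>x. local_time X s x \<omega>) = zsum b n (\<lambda>x. local_time X t x \<omega>)"
        using u(2)[OF that] leaf_ne by (intro zsum_cong) auto
      then show ?thesis using elim(1) t that by auto
    qed
    with u(1) show "\<exists>u>t. \<forall>s. t \<le> s \<longrightarrow> s < u \<longrightarrow> Zn b n X s \<omega> = Zn b n X t \<omega>" by blast
  qed
qed

lemma Zn_measurable_pair: "(\<lambda>(t, \<omega>). Zn b n X (max 0 t) \<omega>) \<in> borel_measurable (borel \<Otimes>\<^sub>M M)"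
proof -
  have [measurable]: "(\<lambda>z. zsum b n (\<lambda>x. local_time X (max 0 (fst z)) x (snd z))) \<in> borel_measurable (borel \<Otimes>\<^sub>M M)"
    using local_time_measurable_max[OF leaf_ne] by (intro zsum_measurable) (simp add: split_beta)
  show ?thesis unfolding Zn_eq split_beta by measurable
qed

lemma Zn_measurable: "(\<lambda>\<omega>. Zn b n X (max 0 t) \<omega>) \<in> borel_measurable M"
  using measurable_Pair_compose_split[OF Zn_measurable_pair, of "\<lambda>_. t" M "\<lambda>\<omega>. \<omega>"] by simp

lemma Zn_measurable': "0 \<le> t \<Longrightarrow> Zn b n X t \<in> borel_measurable M"
  using Zn_measurable[of t] by (simp add: max_def)

lemma Zn_kernel: "(\<lambda>t. distr M borel (Zn b n X (max 0 t))) \<in> borel \<rightarrow>\<^sub>M prob_algebra borel"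
  by (rule measurable_distr_prob_space2[OF _ Zn_measurable_pair])
    (auto simp: space_prob_algebra prob_space_axioms)

lemma laplace_leaves:
  assumes l: "\<And>x. 0 \<le> l x" and t: "0 \<le> t"
  shows "(\<integral>\<^sup>+\<omega>. ennreal (exp (- (\<Sum>x\<in>tree_leaves b n. l x * local_time X t x \<omega>))) \<partial>M) =
    ennreal (exp (- t * Phi b n (\<lambda>x. if x \<in> tree_leaves b n then l x else 0)))"
proof -
  let ?l = "\<lambda>x. if x \<in> tree_leaves b n then l x else 0"
  have "(\<Sum>x\<in>V - {[]}. ?l x * local_time X t x \<omega>) = (\<Sum>x\<in>tree_leaves b n. l x * local_time X t x \<omega>)" for \<omega>
    using leaves_subset by (intro sum.mono_neutral_cong_right) (auto simp: finite_V)
  moreover have "?l([] := 0) = ?l" using leaf_ne by auto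
  ultimately show ?thesis using laplace_local_time[of ?l t] l t by simp
qed

end

lemma tree_path_law_unique:
  assumes "tree_path b n M X Y S" "tree_path b n M' X' Y' S'" and t: "0 \<le> t"
  shows "distr M (\<Pi>\<^sub>M x\<in>tree_leaves b n. borel) (\<lambda>\<omega>. \<lambda>x\<in>tree_leaves b n. local_time X t x \<omega>) =
    distr M' (\<Pi>\<^sub>M x\<in>tree_leaves b n. borel) (\<lambda>\<omega>. \<lambda>x\<in>tree_leaves b n. local_time X' t x \<omega>)"
proof -
  interpret A: tree_path b n M X Y S by fact
  interpret B: tree_path b n M' X' Y' S' by fact
  show ?thesis
    using t by (intro laplace_determines_joint_law finite_tree_leaves)
      (auto simp: A.laplace_leaves B.laplace_leaves local_time_nonneg A.finite_measure_axioms B.finite_measure_axioms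
        intro: A.local_time_measurable[OF A.leaf_ne] B.local_time_measurable[OF B.leaf_ne])
qed

text \<open>All realisations share the Laplace transform of the leaf field. This carries the
  convergence assumed along one family of walks over to the arbitrary walks of the independent-time
  claim.\<close>

lemma tree_walk_Zn_law_unique:
  assumes W: "tree_walk b n M X" "tree_walk b n M' X'" and b: "2 \<le> b" "1 \<le> n" and t: "0 \<le> t"
  shows "distr M borel (Zn b n X t) = distr M' borel (Zn b n X' t)"
proof -
  obtain Y S where "tree_path b n M X Y S" using W(1) b by (rule tree_walkE)
  then interpret A: tree_path b n M X Y S .
  obtain Y' S' where "tree_path b n M' X' Y' S'" using W(2) b by (rule tree_walkE)
  then interpret B: tree_path b n M' X' Y' S' .
  let ?L = "tree_leaves b n"
  have z: "zsum b n \<in> borel_measurable (\<Pi>\<^sub>M x\<in>?L. borel)" by (rule zsum_measurable) auto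
  have A: "distr M borel (Zn b n X t) = distr (distr M (\<Pi>\<^sub>M x\<in>?L. borel) (\<lambda>\<omega>. \<lambda>x\<in>?L. local_time X t x \<omega>)) borel (zsum b n)"
  proof -
    have m: "(\<lambda>\<omega>. \<lambda>x\<in>?L. local_time X t x \<omega>) \<in> M \<rightarrow>\<^sub>M (\<Pi>\<^sub>M x\<in>?L. borel)"
      using t by (intro measurable_restrict A.local_time_measurable A.leaf_ne)
    have "distr M borel (Zn b n X t) = distr M borel (\<lambda>\<omega>. zsum b n (\<lambda>x\<in>?L. local_time X t x \<omega>))"
      using A.Zn_measurable'[OF t] measurable_compose[OF m z] A.Zn_AE t
      by (intro distr_cong_AE) (auto elim!: eventually_mono intro!: zsum_cong)
    then show ?thesis using m z by (simp add: distr_distr comp_def)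
  qed
  have B: "distr M' borel (Zn b n X' t) = distr (distr M' (\<Pi>\<^sub>M x\<in>?L. borel) (\<lambda>\<omega>. \<lambda>x\<in>?L. local_time X' t x \<omega>)) borel (zsum b n)"
  proof -
    have m: "(\<lambda>\<omega>. \<lambda>x\<in>?L. local_time X' t x \<omega>) \<in> M' \<rightarrow>\<^sub>M (\<Pi>\<^sub>M x\<in>?L. borel)"
      using t by (intro measurable_restrict B.local_time_measurable B.leaf_ne)
    have "distr M' borel (Zn b n X' t) = distr M' borel (\<lambda>\<omega>. zsum b n (\<lambda>x\<in>?L. local_time X' t x \<omega>))"
      using B.Zn_measurable'[OF t] measurable_compose[OF m z] B.Zn_AE t
      by (intro distr_cong_AE) (auto elim!: eventually_mono intro!: zsum_cong)
    then show ?thesis using m z by (simp add: distr_distr comp_def)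
  qed
  show ?thesis
    unfolding A B using tree_path_law_unique[OF A.tree_path_axioms B.tree_path_axioms t] by simp
qed

section \<open>Measurable kernels as pointwise weak limits\<close>

lemma real_distribution_kernel:
  assumes "\<kappa> \<in> borel \<rightarrow>\<^sub>M prob_algebra borel"
  shows "real_distribution (\<kappa> t)"
  using measurable_space[OF assms, of t]
  by (auto simp: space_prob_algebra real_distribution_def real_distribution_axioms_def intro: sets_eq_imp_space_eq)

text \<open>Distribution functions need not converge at atoms. Measurability is therefore obtained
  for integrals of continuous ramps, which converge for each \<open>t\<close>; shrinking the ramps
  gives the half-lines, and these generate the Borel sets.\<close>

lemma weak_limit_kernel:
  fixes K :: "nat \<Rightarrow> real \<Rightarrow> real measure" and \<kappa> :: "real \<Rightarrow> real measure"
  assumes K: "\<And>n. K n \<in> borel \<rightarrow>\<^sub>M prob_algebra borel"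
    and \<kappa>: "\<And>t. real_distribution (\<kappa> t)" and w: "\<And>t. weak_conv_m (\<lambda>n. K n t) (\<kappa> t)"
  shows "\<kappa> \<in> borel \<rightarrow>\<^sub>M prob_algebra borel"
proof (rule measurable_prob_algebra_generated[where \<Omega>=UNIV and G="range atMost"])
  interpret \<kappa>: real_distribution "\<kappa> t" for t by (rule \<kappa>)
  note Kd = real_distribution_kernel[OF K]
  show "sets borel = sigma_sets UNIV (range (atMost :: real \<Rightarrow> _))" by (simp add: borel_eq_atMost)
  show "Int_stable (range (atMost :: real \<Rightarrow> _))" by (auto simp: Int_stable_def)
  show "prob_space (\<kappa> t)" for t by (rule \<kappa>.prob_space_axioms)
  show "sets (\<kappa> t) = sets borel" for t by simp
  have step_le: "norm (cts_step a c x) \<le> 1" if "a < c" for a c x using that by (auto simp: cts_step_def)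
  have step: "(\<lambda>t. \<integral>x. cts_step a c x \<partial>\<kappa> t) \<in> borel_measurable borel" if "a < c" for a c
  proof (rule borel_measurable_LIMSEQ_metric)
    show "(\<lambda>t. \<integral>x. cts_step a c x \<partial>K n t) \<in> borel_measurable borel" for n
      by (rule measurable_compose[OF measurable_prob_algebraD[OF K] integral_measurable_subprob_algebra])
        (simp add: cts_step_def[abs_def])
    show "(\<lambda>n. \<integral>x. cts_step a c x \<partial>K n t) \<longlonglongrightarrow> (\<integral>x. cts_step a c x \<partial>\<kappa> t)" for t
    proof (rule weak_conv_imp_integral_bdd_continuous_conv[OF Kd \<kappa> w])
      show "isCont (cts_step a c) x" for x
        using uniformly_continuous_imp_continuous[OF cts_step_uniformly_continuous[OF that]]
        by (simp add: continuous_on_eq_continuous_at)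
      show "norm (cts_step a c x) \<le> 1" for x using that by (rule step_le)
    qed
  qed
  fix A :: "real set" assume "A \<in> range atMost"
  then obtain a where A: "A = {..a}" by auto
  have "(\<lambda>t. measure (\<kappa> t) {..a}) \<in> borel_measurable borel"
  proof (rule borel_measurable_LIMSEQ_metric)
    show "(\<lambda>t. \<integral>x. cts_step a (a + 1 / real (Suc j)) x \<partial>\<kappa> t) \<in> borel_measurable borel" for j
      by (rule step) simp
    show "(\<lambda>j. \<integral>x. cts_step a (a + 1 / real (Suc j)) x \<partial>\<kappa> t) \<longlonglongrightarrow> measure (\<kappa> t) {..a}" for t
    proof -
      have "(\<lambda>j. \<integral>x. cts_step a (a + 1 / real (Suc j)) x \<partial>\<kappa> t) \<longlonglongrightarrow> (\<integral>x. indicator {..a} x \<partial>\<kappa> t)"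
      proof (rule integral_dominated_convergence[where w="\<lambda>_. 1"])
        show "cts_step a (a + 1 / real (Suc j)) \<in> borel_measurable (\<kappa> t)" for j
          unfolding cts_step_def[abs_def] by measurable
        show "AE x in \<kappa> t. norm (cts_step a (a + 1 / real (Suc j)) x) \<le> 1" for j
          by (intro AE_I2 step_le) simp
        show "AE x in \<kappa> t. (\<lambda>j. cts_step a (a + 1 / real (Suc j)) x) \<longlonglongrightarrow> indicator {..a} x"
        proof (rule AE_I2)
          fix x
          show "(\<lambda>j. cts_step a (a + 1 / real (Suc j)) x) \<longlonglongrightarrow> indicator {..a} x"
          proof (cases "x \<le> a")
            case False
            have "(\<lambda>j. a + 1 / real (Suc j)) \<longlonglongrightarrow> a"
              using tendsto_add[OF tendsto_const[of a] LIMSEQ_inverse_real_of_nat] by (simp add: inverse_eq_divide)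
            then have "\<forall>\<^sub>F j in sequentially. a + 1 / real (Suc j) < x" using False by (intro order_tendstoD) auto
            then have "\<forall>\<^sub>F j in sequentially. cts_step a (a + 1 / real (Suc j)) x = indicator {..a} x"
              by eventually_elim (use False in \<open>auto simp: cts_step_def\<close>)
            then show ?thesis by (rule tendsto_eventually)
          qed (simp add: cts_step_def)
        qed
      qed auto
      then show ?thesis by simp
    qed
  qed
  then show "(\<lambda>t. emeasure (\<kappa> t) A) \<in> borel_measurable borel"
    unfolding A \<kappa>.emeasure_eq_measure by measurable
qed auto


lemma local_time_neg: "t < 0 \<Longrightarrow> local_time X t x \<omega> = 0"
proof -
  assume t: "t < 0"
  have "{s. 0 \<le> s \<and> t < occupation_time X s [] \<omega>} = {0..}"
    using t occupation_time_nonneg[of X _ "[]" \<omega>] by (auto intro: less_le_trans)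
  then have "inverse_local_time X t \<omega> = 0" by (simp add: inverse_local_time_def)
  moreover have "(LBINT s:{0..0}. indicat_real {x} (X s \<omega>)) = 0"
    unfolding set_lebesgue_integral_def
    by (rule integral_eq_zero_AE, use AE_lborel_singleton[of "0::real"] in eventually_elim) (simp add: indicator_def)
  ultimately show ?thesis by (simp add: local_time_def occupation_time_def)
qed

text \<open>For \<open>t < 0\<close> the infimum in the inverse local time is 0 and all local times
  vanish, so \<open>t\<close> may range over the whole line, on which the kernels are
  stated.\<close>

lemma Zn_max: "Zn b n X (max 0 t) \<omega> = Zn b n X t \<omega>"
  by (auto simp: Zn_eq max_def local_time_neg zsum_def)

text \<open>
  Rounding the random time up to a grid reduces evaluation at an independent time to the
  one-dimensional marginals of the process; right-continuity then removes the grid.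
\<close>

definition grid_right :: "nat \<Rightarrow> real \<Rightarrow> real" where
  "grid_right m s = (of_int \<lfloor>s * real m\<rfloor> + 1) / real m"

definition grid_eval :: "nat \<Rightarrow> real \<Rightarrow> (real \<Rightarrow> real) \<Rightarrow> real" where
  "grid_eval m s \<phi> = (if 0 \<le> s \<and> s < real m then \<phi> (grid_right m s) else 0)"

lemma grid_right_bounds:
  assumes "0 < m"
  shows "s < grid_right m s" "grid_right m s \<le> s + 1 / real m"
proof -
  have "s * real m < of_int \<lfloor>s * real m\<rfloor> + 1" by linarith
  then show "s < grid_right m s" using assms by (simp add: grid_right_def field_simps)
  have "of_int \<lfloor>s * real m\<rfloor> \<le> s * real m" by linarith
  then show "grid_right m s \<le> s + 1 / real m" using assms by (simp add: grid_right_def field_simps)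
qed

lemma grid_right_tendsto: "(\<lambda>m. grid_right m s) \<longlonglongrightarrow> s"
proof (rule tendsto_sandwich)
  show "\<forall>\<^sub>F m in sequentially. s \<le> grid_right m s" "\<forall>\<^sub>F m in sequentially. grid_right m s \<le> s + 1 / real m"
    using eventually_gt_at_top[of 0] by (eventually_elim, use grid_right_bounds less_imp_le in blast)+
  show "(\<lambda>m. s + 1 / real m) \<longlonglongrightarrow> s"
    using tendsto_add[OF tendsto_const[of s] lim_1_over_n] by simp
qed simp

lemma grid_eval_tendsto:
  assumes s: "0 \<le> s" and \<phi>: "(\<lambda>m. \<phi> (grid_right m s)) \<longlonglongrightarrow> \<phi> s"
  shows "(\<lambda>m. grid_eval m s \<phi>) \<longlonglongrightarrow> \<phi> s"
proof (rule Lim_transform_eventually[OF \<phi>])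
  obtain N :: nat where "s < real N" using reals_Archimedean2 by blast
  have "\<forall>\<^sub>F m in sequentially. s < real m"
    by (rule eventually_mono[OF eventually_ge_at_top[of N]]) (use \<open>s < real N\<close> in \<open>auto intro: less_le_trans\<close>)
  then show "\<forall>\<^sub>F m in sequentially. \<phi> (grid_right m s) = grid_eval m s \<phi>"
    by eventually_elim (use s in \<open>simp add: grid_eval_def\<close>)
qed

text \<open>The cut-off at \<open>m\<close> leaves \<open>m * m\<close> cells of width
  \<open>1 / m\<close>; on each of them the evaluated time is a constant, its right end, so that
  independence is called for at fixed times only.\<close>

lemma grid_eval_sum:
  "grid_eval m s \<phi> = (\<Sum>j<m * m. indicator {real j / real m..<(real j + 1) / real m} s * \<phi> ((real j + 1) / real m))"
proof (cases "0 \<le> s \<and> s < real m")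
  case True
  then have m: "0 < real m" by linarith
  define k where "k = nat \<lfloor>s * real m\<rfloor>"
  have k: "real k = of_int \<lfloor>s * real m\<rfloor>" unfolding k_def using True by (simp add: of_nat_nat)
  have mem: "s \<in> {real j / real m..<(real j + 1) / real m} \<longleftrightarrow> j = k" for j
  proof -
    have "s \<in> {real j / real m..<(real j + 1) / real m} \<longleftrightarrow> real j \<le> s * real m \<and> s * real m < real j + 1"
      using m by (auto simp: field_simps)
    also have "\<dots> \<longleftrightarrow> \<lfloor>s * real m\<rfloor> = int j" by (auto simp: floor_eq_iff)
    also have "\<dots> \<longleftrightarrow> j = k" using True by (auto simp: k_def)
    finally show ?thesis .
  qed
  have "real k \<le> s * real m" using k by linarith
  also have "\<dots> < real m * real m" using True m by (intro mult_strict_right_mono) auto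
  finally have "k < m * m" by (metis of_nat_less_iff of_nat_mult)
  then have "(\<Sum>j<m * m. indicator {real j / real m..<(real j + 1) / real m} s * \<phi> ((real j + 1) / real m)) =
    (\<Sum>j\<in>{k}. indicator {real j / real m..<(real j + 1) / real m} s * \<phi> ((real j + 1) / real m))"
    by (intro sum.mono_neutral_right) (auto simp: mem indicator_def simp del: atLeastLessThan_iff)
  also have "\<dots> = \<phi> ((real k + 1) / real m)" using mem[of k] by simp
  finally show ?thesis using True k by (simp add: grid_eval_def grid_right_def)
next
  case False
  have "s \<notin> {real j / real m..<(real j + 1) / real m}" if "j < m * m" for j
  proof
    assume s: "s \<in> {real j / real m..<(real j + 1) / real m}"
    have m: "0 < real m" using that by (cases m) auto
    have "0 \<le> real j / real m" by simp
    then have "0 \<le> s" using s unfolding atLeastLessThan_iff by (blast intro: order_trans)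
    moreover have "(real j + 1) / real m \<le> real (m * m) / real m"
      using that m by (intro divide_right_mono) (auto simp del: of_nat_mult)
    then have "s < real m" using s m by auto
    ultimately show False using False by simp
  qed
  then show ?thesis using False by (auto simp: grid_eval_def simp del: atLeastLessThan_iff)
qed

text \<open>One coordinate is measurable for the product sigma-algebra, so its preimages are among
  those of the whole process.\<close>

lemma indep_of_process_indep_var:
  assumes M: "prob_space M" and i: "indep_of_process M T W" and [measurable]: "T \<in> borel_measurable M"
    and W: "W t \<in> borel_measurable M" and t: "0 \<le> t"
  shows "prob_space.indep_var M borel T borel (W t)"
proof -
  interpret prob_space M by fact
  let ?P = "\<lambda>\<omega>. \<lambda>t\<in>{0..}. W t \<omega>"
  let ?A = "sigma_sets (space M) {T -` A \<inter> space M |A. A \<in> sets borel}"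
  let ?B = "sigma_sets (space M) {W t -` A \<inter> space M |A. A \<in> sets borel}"
  have ind: "indep_set ?A (sets (vimage_algebra (space M) ?P (\<Pi>\<^sub>M t\<in>{0..}. borel)))"
    using i unfolding indep_of_process_def by (simp add: sets_vimage_algebra)
  have "?B \<subseteq> sets (vimage_algebra (space M) ?P (\<Pi>\<^sub>M t\<in>{0..}. borel))"
    unfolding sets_vimage_algebra
  proof (rule sigma_sets_mono', safe)
    fix A :: "real set" assume A: "A \<in> sets borel"
    let ?A' = "{f \<in> space (\<Pi>\<^sub>M t\<in>{0..}. borel). f t \<in> A}"
    have "?A' \<in> sets (\<Pi>\<^sub>M t\<in>{0..}. borel)"
      using A t by (intro sets_Collect_single) auto
    moreover have "W t -` A \<inter> space M = ?P -` ?A' \<inter> space M"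
      using t by (auto simp: space_PiM)
    ultimately show "\<exists>A'. W t -` A \<inter> space M = ?P -` A' \<inter> space M \<and> A' \<in> sets (\<Pi>\<^sub>M t\<in>{0..}. borel)" by blast
  qed
  then have "indep_set ?A ?B"
    using ind unfolding indep_set_def by (rule_tac indep_sets_mono_sets) (auto split: bool.split)
  then show ?thesis unfolding indep_var_eq using W by simp
qed

lemma (in prob_space) expectation_independent_time:
  fixes f :: "real \<Rightarrow> real"
  assumes T[measurable]: "T \<in> borel_measurable M" and Tpos: "AE \<omega> in M. 0 \<le> T \<omega>"
    and W: "\<And>t. 0 \<le> t \<Longrightarrow> W t \<in> borel_measurable M" and Wp: "(\<lambda>(t, \<omega>). W t \<omega>) \<in> borel_measurable (borel \<Otimes>\<^sub>M M)"
    and right: "AE \<omega> in M. \<forall>t\<ge>0. \<exists>u>t. \<forall>s. t \<le> s \<longrightarrow> s < u \<longrightarrow> W s \<omega> = W t \<omega>"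
    and ind: "\<And>t. 0 \<le> t \<Longrightarrow> indep_var borel T borel (W t)"
    and f[measurable]: "f \<in> borel_measurable borel" and f1: "\<And>x. \<bar>f x\<bar> \<le> 1"
  shows "(\<integral>\<omega>. f (W (T \<omega>) \<omega>) \<partial>M) = (\<integral>t. (\<integral>\<omega>. f (W t \<omega>) \<partial>M) \<partial>distr M borel T)"
proof -
  have Wm[measurable]: "W t \<in> borel_measurable M" for t
    using measurable_Pair_compose_split[OF Wp, of "\<lambda>_. t" M "\<lambda>\<omega>. \<omega>"] by simp
  interpret D: prob_space "distr M borel T" by (rule prob_space_distr) measurable
  define h where "h t = (\<integral>\<omega>. f (W t \<omega>) \<partial>M)" for t
  have h1: "\<bar>h t\<bar> \<le> 1" for t
  proof -
    have "\<bar>h t\<bar> \<le> (\<integral>\<omega>. \<bar>f (W t \<omega>)\<bar> \<partial>M)" unfolding h_def by (rule integral_abs_bound)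
    also have "\<dots> \<le> (\<integral>\<omega>. 1 \<partial>M)"
      using f1 by (intro integral_mono integrable_const_bound[where B=1]) auto
    finally show ?thesis by (simp add: prob_space)
  qed
  have hm[measurable]: "h \<in> borel_measurable borel"
    unfolding h_def using measurable_compose[OF Wp f] by (intro borel_measurable_lebesgue_integral) (simp add: split_beta)
  have ge1: "\<bar>grid_eval m s \<phi>\<bar> \<le> 1" if "\<And>x. \<bar>\<phi> x\<bar> \<le> 1" for m s \<phi> using that by (simp add: grid_eval_def)
  have gm: "(\<lambda>\<omega>. grid_eval m (T \<omega>) (\<lambda>t. f (W t \<omega>))) \<in> borel_measurable M" for m
    unfolding grid_eval_sum by measurable
  have gm': "(\<lambda>s. grid_eval m s h) \<in> borel_measurable borel" for m
    unfolding grid_eval_sum by measurable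
  \<comment> \<open>On each cell, independence of \<open>T\<close> and of \<open>W\<close> at the
    right end factors the expectation.\<close>
  have eq: "(\<integral>\<omega>. grid_eval m (T \<omega>) (\<lambda>t. f (W t \<omega>)) \<partial>M) = (\<integral>s. grid_eval m s h \<partial>distr M borel T)" for m
  proof -
    let ?I = "\<lambda>j. {real j / real m..<(real j + 1) / real m}" and ?t = "\<lambda>j. (real j + 1) / real m"
    have int: "integrable M (\<lambda>\<omega>. indicator (?I j) (T \<omega>) * f (W (?t j) \<omega>))" for j
      using f1 by (intro integrable_const_bound[where B=1]) (auto simp: indicator_def abs_mult)
    have ij: "(\<integral>\<omega>. indicator (?I j) (T \<omega>) * f (W (?t j) \<omega>) \<partial>M) = (\<integral>s. indicator (?I j) s * h (?t j) \<partial>distr M borel T)" for j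
    proof -
      have "indep_var borel (indicat_real (?I j) \<circ> T) borel (f \<circ> W (?t j))"
        by (rule indep_var_compose[OF ind]) auto
      then have "(\<integral>\<omega>. indicator (?I j) (T \<omega>) * f (W (?t j) \<omega>) \<partial>M) = (\<integral>\<omega>. indicator (?I j) (T \<omega>) \<partial>M) * h (?t j)"
        unfolding h_def comp_def using f1
        by (intro indep_var_lebesgue_integral integrable_const_bound[where B=1]) (auto simp: indicator_def)
      also have "(\<integral>\<omega>. indicator (?I j) (T \<omega>) \<partial>M) = (\<integral>s. indicat_real (?I j) s \<partial>distr M borel T)"
        by (rule integral_distr[symmetric]) auto
      finally show ?thesis by simp
    qed
    have int': "integrable (distr M borel T) (\<lambda>s. indicator (?I j) s * h (?t j))" for j
      using h1 by (intro D.integrable_const_bound[where B=1]) (auto simp: indicator_def abs_mult)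
    show ?thesis unfolding grid_eval_sum
      using int int' ij by (subst (1 2) Bochner_Integration.integral_sum) auto
  qed
  have "(\<lambda>m. \<integral>\<omega>. grid_eval m (T \<omega>) (\<lambda>t. f (W t \<omega>)) \<partial>M) \<longlonglongrightarrow> (\<integral>\<omega>. f (W (T \<omega>) \<omega>) \<partial>M)"
  proof (rule integral_dominated_convergence[where w="\<lambda>_. 1"])
    show "(\<lambda>\<omega>. f (W (T \<omega>) \<omega>)) \<in> borel_measurable M"
      using measurable_compose[OF measurable_Pair_compose_split[OF Wp T measurable_ident_sets] f] by simp
    show "AE \<omega> in M. (\<lambda>m. grid_eval m (T \<omega>) (\<lambda>t. f (W t \<omega>))) \<longlonglongrightarrow> f (W (T \<omega>) \<omega>)"
      using Tpos right
    proof eventually_elim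
      case (elim \<omega>)
      then obtain u where u: "u > T \<omega>" "\<And>s. T \<omega> \<le> s \<Longrightarrow> s < u \<Longrightarrow> W s \<omega> = W (T \<omega>) \<omega>" by blast
      have "\<forall>\<^sub>F m in sequentially. grid_right m (T \<omega>) < u" using grid_right_tendsto u(1) by (rule order_tendstoD)
      then have "\<forall>\<^sub>F m in sequentially. f (W (grid_right m (T \<omega>)) \<omega>) = f (W (T \<omega>) \<omega>)"
        using eventually_gt_at_top[of 0]
        by eventually_elim (use u(2) grid_right_bounds(1)[of _ "T \<omega>"] in \<open>auto simp: less_imp_le\<close>)
      then show ?case using elim by (intro grid_eval_tendsto tendsto_eventually)
    qed
  qed (use gm ge1 f1 in auto)
  moreover have "(\<lambda>m. \<integral>s. grid_eval m s h \<partial>distr M borel T) \<longlonglongrightarrow> (\<integral>s. h s \<partial>distr M borel T)"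
  proof (rule integral_dominated_convergence[where w="\<lambda>_. 1"])
    \<comment> \<open>The averaged function \<open>h\<close> need not be a step function any more,
      but it inherits right-continuity by dominated convergence.\<close>
    have "(\<lambda>m. h (grid_right m s)) \<longlonglongrightarrow> h s" if s: "0 \<le> s" for s
      unfolding h_def
    proof (rule integral_dominated_convergence[where w="\<lambda>_. 1"])
      show "AE \<omega> in M. (\<lambda>m. f (W (grid_right m s) \<omega>)) \<longlonglongrightarrow> f (W s \<omega>)"
        using right
      proof eventually_elim
        case (elim \<omega>)
        then obtain u where u: "u > s" "\<And>r. s \<le> r \<Longrightarrow> r < u \<Longrightarrow> W r \<omega> = W s \<omega>" using s by blast
        have "\<forall>\<^sub>F m in sequentially. grid_right m s < u" using grid_right_tendsto u(1) by (rule order_tendstoD)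
        then have "\<forall>\<^sub>F m in sequentially. f (W (grid_right m s) \<omega>) = f (W s \<omega>)"
          using eventually_gt_at_top[of 0]
          by eventually_elim (use u(2) grid_right_bounds(1)[of _ s] in \<open>auto simp: less_imp_le\<close>)
        then show ?case by (rule tendsto_eventually)
      qed
    qed (use f1 in auto)
    moreover have "AE s in distr M borel T. 0 \<le> s" using Tpos by (subst AE_distr_iff) auto
    ultimately show "AE s in distr M borel T. (\<lambda>m. grid_eval m s h) \<longlonglongrightarrow> h s"
      by (auto elim!: eventually_mono intro: grid_eval_tendsto)
  qed (use gm' ge1 h1 in auto)
  ultimately show ?thesis
    unfolding eq h_def by (rule LIMSEQ_unique)
qed

section \<open>Mixtures over the kernel\<close>

text \<open>Obtained from the cylinders \<open>UNIV \<times> A\<close> in the joint law, on which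
  the time is integrated out.\<close>

lemma coupled_mixture:
  assumes c: "coupled \<zeta> M T Z" and k: "\<kappa> \<in> borel \<rightarrow>\<^sub>M prob_algebra borel"
    and eq: "\<And>t. 0 \<le> t \<Longrightarrow> \<kappa> t = \<zeta> t"
  shows "distr M borel Z = distr M borel T \<bind> \<kappa>"
proof (rule measure_eqI)
  from c have M: "prob_space M" and [measurable]: "T \<in> borel_measurable M" "Z \<in> borel_measurable M"
    and T0: "AE \<omega> in M. 0 \<le> T \<omega>"
    and E: "\<And>E. E \<in> sets borel \<Longrightarrow> emeasure M {\<omega>\<in>space M. (T \<omega>, Z \<omega>) \<in> E} = (\<integral>\<^sup>+t\<in>{0..}. emeasure (\<zeta> t) {z. (t, z) \<in> E} \<partial>distr M borel T)"
    unfolding coupled_def by auto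
  have k': "\<kappa> \<in> distr M borel T \<rightarrow>\<^sub>M subprob_algebra borel"
    using measurable_prob_algebraD[OF k] by (simp cong: measurable_cong_sets)
  show "sets (distr M borel Z) = sets (distr M borel T \<bind> \<kappa>)"
    by (subst sets_bind[OF sets_kernel[OF k']]) auto
  fix A assume "A \<in> sets (distr M borel Z)"
  then have A[measurable]: "A \<in> sets borel" by simp
  have ae: "AE t in distr M borel T. 0 \<le> t" using T0 by (subst AE_distr_iff) auto
  have "emeasure (distr M borel Z) A = emeasure M {\<omega>\<in>space M. (T \<omega>, Z \<omega>) \<in> UNIV \<times> A}"
    by (subst emeasure_distr) (auto intro!: arg_cong2[where f=emeasure])
  also have "\<dots> = (\<integral>\<^sup>+t\<in>{0..}. emeasure (\<zeta> t) {z. (t, z) \<in> UNIV \<times> A} \<partial>distr M borel T)"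
    by (rule E) (simp add: borel_prod[symmetric])
  also have "\<dots> = (\<integral>\<^sup>+t. emeasure (\<kappa> t) A \<partial>distr M borel T)"
    using ae by (intro nn_integral_cong_AE) (auto elim!: eventually_mono simp: eq)
  also have "\<dots> = emeasure (distr M borel T \<bind> \<kappa>) A"
    by (rule emeasure_bind[symmetric, OF _ k' A]) simp
  finally show "emeasure (distr M borel Z) A = emeasure (distr M borel T \<bind> \<kappa>) A" .
qed

lemma integral_bind_kernel:
  fixes f :: "real \<Rightarrow> real"
  assumes N: "prob_space N" "sets N = sets borel" and k: "\<kappa> \<in> borel \<rightarrow>\<^sub>M prob_algebra borel"
    and f[measurable]: "f \<in> borel_measurable borel" and f1: "\<And>x. \<bar>f x\<bar> \<le> 1"
  shows "(\<integral>x. f x \<partial>(N \<bind> \<kappa>)) = (\<integral>t. (\<integral>x. f x \<partial>\<kappa> t) \<partial>N)"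
proof -
  interpret prob_space N by fact
  have k': "\<kappa> \<in> N \<rightarrow>\<^sub>M subprob_algebra borel"
    using measurable_prob_algebraD[OF k] N(2) by (simp cong: measurable_cong_sets)
  show ?thesis
    using f1 by (intro integral_bind[where K=borel and B'=1 and B=1] k' finite_measure_axioms)
      (auto intro: subprob_space.emeasure_space_le_1 subprob_space_kernel[OF k'])
qed

lemma (in real_distribution) integrable_char: "integrable M (\<lambda>x. iexp (t * x))"
  by (rule integrable_const_bound[where B=1]) auto

text \<open>Reduces to the bounded real functions cosine and sine.\<close>

lemma char_bind_kernel:
  assumes N: "prob_space N" "sets N = sets borel" and k: "\<kappa> \<in> borel \<rightarrow>\<^sub>M prob_algebra borel"
  shows "char (N \<bind> \<kappa>) \<theta> = (\<integral>t. char (\<kappa> t) \<theta> \<partial>N)"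
proof -
  interpret prob_space N by fact
  note [measurable_cong] = N(2)
  note d = real_distribution_kernel[OF k]
  have k': "\<kappa> \<in> N \<rightarrow>\<^sub>M subprob_algebra borel"
    using measurable_prob_algebraD[OF k] N(2) by (simp cong: measurable_cong_sets)
  have sb: "sets (N \<bind> \<kappa>) = sets borel" by (rule sets_bind[OF sets_kernel[OF k'] not_empty])
  have "prob_space (N \<bind> \<kappa>)"
    using d by (intro prob_space_bind[OF _ k']) (auto simp: real_distribution_def)
  then interpret B: real_distribution "N \<bind> \<kappa>"
    using sb by (auto simp: real_distribution_def real_distribution_axioms_def intro: sets_eq_imp_space_eq)
  have cm[measurable]: "(\<lambda>t. char (\<kappa> t) \<theta>) \<in> borel_measurable N"
    unfolding char_def by (rule measurable_compose[OF k' integral_measurable_subprob_algebra]) measurable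
  have ci: "integrable N (\<lambda>t. char (\<kappa> t) \<theta>)"
    by (rule integrable_const_bound[where B=1]) (auto intro!: AE_I2 real_distribution.cmod_char_le_1 d)
  have re: "Re (char \<nu> \<theta>) = (\<integral>x. cos (\<theta> * x) \<partial>\<nu>)" "Im (char \<nu> \<theta>) = (\<integral>x. sin (\<theta> * x) \<partial>\<nu>)" if "real_distribution \<nu>" for \<nu>
    unfolding char_def using integral_Re[OF real_distribution.integrable_char[OF that]] integral_Im[OF real_distribution.integrable_char[OF that]] by (simp_all add: Re_exp Im_exp)
  show ?thesis
  proof (rule complex_eqI)
    show "Re (char (N \<bind> \<kappa>) \<theta>) = Re (\<integral>t. char (\<kappa> t) \<theta> \<partial>N)"
      using integral_bind_kernel[OF N k, of "\<lambda>x. cos (\<theta> * x)"] integral_Re[OF ci]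
      by (simp add: re[OF B.real_distribution_axioms] re[OF d])
    show "Im (char (N \<bind> \<kappa>) \<theta>) = Im (\<integral>t. char (\<kappa> t) \<theta> \<partial>N)"
      using integral_bind_kernel[OF N k, of "\<lambda>x. sin (\<theta> * x)"] integral_Im[OF ci]
      by (simp add: re[OF B.real_distribution_axioms] re[OF d])
  qed
qed

section \<open>The cascade\<close>

text \<open>Only the path to \<open>x\<close> matters: for positive \<mu> it is a conductance \<mu>
  in series with \<open>n\<close> unit edges, of total resistance
  \<open>1 / \<mu> + n\<close>.\<close>

lemma Phi_leaf:
  assumes "0 \<le> \<mu>" "x \<in> tree_leaves b n"
  shows "Phi b n (\<lambda>z. if z = x then \<mu> else 0) = \<mu> / (1 + real n * \<mu>)"
  using assms(2)
proof (induction n arbitrary: x)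
  case 0
  then show ?case by (simp add: tree_leaves_def)
next
  case (Suc n)
  then obtain j y where x: "x = j # y" "j < b" "y \<in> tree_leaves b n"
    by (auto simp: tree_leaves_def length_Suc_conv)
  have ij: "Phi b n (\<lambda>z. if i # z = x then \<mu> else 0) = (if i = j then \<mu> / (1 + real n * \<mu>) else 0)" for i
    using x Suc.IH[OF x(3)] by (cases "i = j") (auto simp: Phi_zero)
  have "[] \<noteq> x" using x by simp
  then have "Phi b (Suc n) (\<lambda>z. if z = x then \<mu> else 0) =
      0 + (\<Sum>i<b. if i = j then \<mu> / (1 + real n * \<mu>) / (1 + \<mu> / (1 + real n * \<mu>)) else 0)"
    unfolding Phi.simps ij by (simp only: if_False) (intro arg_cong2[where f="(+)"] sum.cong, auto)
  also have "\<dots> = \<mu> / (1 + real n * \<mu>) / (1 + \<mu> / (1 + real n * \<mu>))" using x by simp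
  also have "\<dots> = \<mu> / (1 + real (Suc n) * \<mu>)"
  proof -
    have p: "1 + real n * \<mu> > 0" "1 + real (Suc n) * \<mu> > 0" using assms(1) by (auto intro: add_pos_nonneg)
    have "1 + \<mu> / (1 + real n * \<mu>) = (1 + real (Suc n) * \<mu>) / (1 + real n * \<mu>)" using p by (simp add: field_simps)
    then show ?thesis using p by simp
  qed
  finally show ?case .
qed

context tree_path
begin

text \<open>The exponent \<open>t * k / (1 + n * k)\<close> equals
  \<open>(t / n) * (n * k) / (1 + n * k)\<close>, which shows the Poisson parameter
  \<open>t / n\<close> and the scale \<open>n\<close> of the exponentials.\<close>

lemma leaf_local_time_law:
  assumes t: "0 < t" and x: "x \<in> tree_leaves b n"
  shows "distr M borel (local_time X t x) = distr (cpe_law (t / real n)) borel (\<lambda>y. real n * y)"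
proof (rule laplace_determines_measure)
  have np: "0 < real n" using n by simp
  interpret c: prob_space "cpe_law (t / real n)" by (rule prob_space_cpe)
  have [measurable]: "local_time X t x \<in> borel_measurable M"
    using t by (intro local_time_measurable leaf_ne[OF x]) simp
  have [measurable]: "(\<lambda>y. real n * y) \<in> borel_measurable (cpe_law (t / real n))" by measurable
  have "prob_space (distr M borel (local_time X t x))" by (rule prob_space_distr) measurable
  then show "finite_measure (distr M borel (local_time X t x))" by (rule prob_space.axioms)
  have "prob_space (distr (cpe_law (t / real n)) borel (\<lambda>y. real n * y))" by (rule c.prob_space_distr) measurable
  then show "finite_measure (distr (cpe_law (t / real n)) borel (\<lambda>y. real n * y))" by (rule prob_space.axioms)
  have "AE y in distr M borel (local_time X t x). 0 \<le> y"
    by (subst AE_distr_iff) (auto simp: local_time_nonneg)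
  then show "emeasure (distr M borel (local_time X t x)) {..<0} = 0"
    by (subst AE_iff_measurable[symmetric, where P="\<lambda>x. 0 \<le> x"]) auto
  have "AE y in distr (cpe_law (t / real n)) borel (\<lambda>y. real n * y). 0 \<le> y"
    using cpe_nonneg[of "t / real n"] t np by (subst AE_distr_iff) (auto elim!: eventually_mono)
  then show "emeasure (distr (cpe_law (t / real n)) borel (\<lambda>y. real n * y)) {..<0} = 0"
    by (subst AE_iff_measurable[symmetric, where P="\<lambda>x. 0 \<le> x"]) auto
  fix k :: nat
  have "(\<integral>\<^sup>+y. ennreal (exp (- real k * y)) \<partial>distr M borel (local_time X t x)) = (\<integral>\<^sup>+\<omega>. ennreal (exp (- real k * local_time X t x \<omega>)) \<partial>M)"
    by (rule nn_integral_distr) auto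
  also have "\<dots> = (\<integral>\<^sup>+\<omega>. ennreal (exp (- (\<Sum>z\<in>tree_leaves b n. (if z = x then real k else 0) * local_time X t z \<omega>))) \<partial>M)"
    using x finite_tree_leaves by (simp add: if_distrib[where f="\<lambda>z. z * _"] cong: if_cong)
  also have "\<dots> = ennreal (exp (- t * Phi b n (\<lambda>z. if z = x then real k else 0)))"
  proof -
    have "(\<lambda>z. if z \<in> tree_leaves b n then if z = x then real k else 0 else 0) = (\<lambda>z. if z = x then real k else 0)" using x by auto
    then show ?thesis using laplace_leaves[of "\<lambda>z. if z = x then real k else 0" t] t by simp
  qed
  also have "\<dots> = ennreal (exp (- (t / real n) * ((real k * real n) / (1 + real k * real n))))"
    using np by (simp add: Phi_leaf[OF _ x] mult.commute)
  also have "\<dots> = (\<integral>\<^sup>+y. ennreal (exp (- (real k * real n) * y)) \<partial>cpe_law (t / real n))"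
    by (rule cpe_laplace[symmetric]) (use t np in auto)
  also have "\<dots> = (\<integral>\<^sup>+y. ennreal (exp (- real k * y)) \<partial>distr (cpe_law (t / real n)) borel (\<lambda>y. real n * y))"
    by (subst nn_integral_distr) (auto simp: mult.assoc)
  finally show "(\<integral>\<^sup>+y. ennreal (exp (- real k * y)) \<partial>distr M borel (local_time X t x)) =
      (\<integral>\<^sup>+y. ennreal (exp (- real k * y)) \<partial>distr (cpe_law (t / real n)) borel (\<lambda>y. real n * y))" .
qed simp_all

text \<open>
  A first-moment bound. The atom of the law of \<open>L\<^sub>t(x)\<close> at \<open>0\<close> supplies the factor \<open>1 / n\<close>, which
  the exponential Chebyshev inequality would not see.
\<close>

lemma max_local_time_tail:
  assumes t: "0 < t" and K: "0 \<le> K" "K \<le> real n * sqrt (ln b)"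
  shows "prob {\<omega>\<in>space M. \<exists>x\<in>tree_leaves b n. real n * sqrt (ln b) - K < sqrt (local_time X t x \<omega>)} \<le>
    t / real n * exp (t + t * ln b + 2 * sqrt (ln b) * K)"
proof -
  define c where "c = sqrt (ln (real b))"
  have lb: "0 \<le> ln (real b)" using b by simp
  have c: "0 \<le> c" "c * c = ln b" using lb by (auto simp: c_def)
  have np: "0 < real n" using n by simp
  \<comment> \<open>\<open>y\<close> is the level for the local time itself and \<open>s\<close> the
    same level divided by \<open>n\<close>, on the scale of the Compound Poisson-Exponential
    law.\<close>
  define y where "y = (real n * c - K)\<^sup>2"
  define s where "s = y / real n"
  have y0: "0 \<le> real n * c - K" using K by (simp add: c_def)
  have s0: "0 \<le> s" unfolding s_def y_def using np by simp
  have "y \<le> (real n * c)\<^sup>2" unfolding y_def using y0 K by (intro power_mono) auto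
  then have s1: "s \<le> real n * ln b" using np by (simp add: s_def field_simps power2_eq_square c(2)[symmetric])
  \<comment> \<open>Expanding the square and dropping its last term shows that \<open>s\<close>
    falls short of \<open>n * ln b\<close> by at most \<open>2 * c * K\<close>; this is the origin
    of the last term in the exponent of the bound.\<close>
  have "y = real n * (real n * ln b - 2 * c * K) + K\<^sup>2" unfolding y_def by (simp add: power2_eq_square algebra_simps c(2)[symmetric])
  then have "real n * (real n * ln b - 2 * c * K) \<le> y" by simp
  then have s2: "real n * ln b - 2 * c * K \<le> s" using np by (simp add: s_def field_simps)
  have meas: "{\<omega>\<in>space M. real n * c - K < sqrt (local_time X t x \<omega>)} \<in> sets M" if "x \<in> tree_leaves b n" for x
  proof -
    have [measurable]: "local_time X t x \<in> borel_measurable M"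
      using t by (intro local_time_measurable leaf_ne[OF that]) simp
    show ?thesis by measurable
  qed
  have one: "prob {\<omega>\<in>space M. real n * c - K < sqrt (local_time X t x \<omega>)} \<le> t / real n * exp (t / real n * (1 + s) - s)"
    if x: "x \<in> tree_leaves b n" for x
  proof -
    have [measurable]: "local_time X t x \<in> borel_measurable M"
      using t by (intro local_time_measurable leaf_ne[OF x]) simp
    have "real n * c - K < sqrt (local_time X t x \<omega>) \<longleftrightarrow> y < local_time X t x \<omega>" for \<omega>
      unfolding y_def using y0 local_time_nonneg[of X t x \<omega>]
      by (metis abs_of_nonneg real_sqrt_abs real_sqrt_less_iff)
    then have "emeasure M {\<omega>\<in>space M. real n * c - K < sqrt (local_time X t x \<omega>)} = emeasure (distr M borel (local_time X t x)) {y<..}"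
      by (subst emeasure_distr) (auto intro!: arg_cong2[where f=emeasure])
    also have "\<dots> = emeasure (cpe_law (t / real n)) {s<..}"
      unfolding leaf_local_time_law[OF t x]
    proof (subst emeasure_distr)
      have "(\<lambda>z. real n * z) -` {y<..} \<inter> space (cpe_law (t / real n)) = {s<..}"
        using np sets_eq_imp_space_eq[OF sets_cpe] by (auto simp: s_def field_simps)
      then show "emeasure (cpe_law (t / real n)) ((\<lambda>z. real n * z) -` {y<..} \<inter> space (cpe_law (t / real n))) = emeasure (cpe_law (t / real n)) {s<..}" by simp
    qed auto
    also have "\<dots> \<le> ennreal (t / real n * exp (t / real n * (1 + s) - s))"
      using t np s0 by (intro cpe_tail) auto
    finally show ?thesis using t np by (simp add: emeasure_eq_measure)
  qed
  have "{\<omega>\<in>space M. \<exists>x\<in>tree_leaves b n. real n * c - K < sqrt (local_time X t x \<omega>)} =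
      (\<Union>x\<in>tree_leaves b n. {\<omega>\<in>space M. real n * c - K < sqrt (local_time X t x \<omega>)})" by auto
  then have "prob {\<omega>\<in>space M. \<exists>x\<in>tree_leaves b n. real n * c - K < sqrt (local_time X t x \<omega>)} =
      prob (\<Union>x\<in>tree_leaves b n. {\<omega>\<in>space M. real n * c - K < sqrt (local_time X t x \<omega>)})" by (rule arg_cong)
  also have "\<dots> \<le> (\<Sum>x\<in>tree_leaves b n. prob {\<omega>\<in>space M. real n * c - K < sqrt (local_time X t x \<omega>)})"
    by (rule finite_measure_subadditive_finite[OF finite_tree_leaves]) (rule image_subsetI, rule meas)
  also have "\<dots> \<le> (\<Sum>x\<in>tree_leaves b n. t / real n * exp (t / real n * (1 + s) - s))"
    by (intro sum_mono one)
  \<comment> \<open>The number of leaves, \<open>exp (n * ln b)\<close>, is compensated by the decay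
    \<open>exp (- s)\<close> up to a factor depending on \<open>K\<close> but not on
    \<open>n\<close>.\<close>
  also have "\<dots> = real b ^ n * (t / real n * exp (t / real n * (1 + s) - s))"
    using card_lists_length_eq[of "{..<b}" n] by (simp add: tree_leaves_def conj_commute)
  also have "real b ^ n = exp (real n * ln b)" using b by (simp add: exp_of_nat_mult)
  also have "exp (real n * ln b) * (t / real n * exp (t / real n * (1 + s) - s)) = t / real n * exp (real n * ln b + (t / real n * (1 + s) - s))"
    by (simp add: exp_add)
  also have "\<dots> \<le> t / real n * exp (t + t * ln b + 2 * c * K)"
  proof -
    have "t / real n * (1 + s) \<le> t / real n * (1 + real n * ln b)" using s1 t np by (intro mult_left_mono) auto
    also have "\<dots> = t / real n + t * ln b" using np by (simp add: field_simps)
    also have "\<dots> \<le> t + t * ln b" using t n by (simp add: divide_le_eq)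
    finally show ?thesis using s2 t np by (intro mult_left_mono) auto
  qed
  finally show ?thesis by (simp add: c_def)
qed

end

section \<open>The cascade at finite depth\<close>

lemma tree_leaves_Suc: "tree_leaves b (Suc n) = (\<lambda>(i, y). i # y) ` ({..<b} \<times> tree_leaves b n)"
  by (force simp: tree_leaves_def length_Suc_conv image_iff)

lemma sum_tree_leaves_Suc: "(\<Sum>x\<in>tree_leaves b (Suc n). f x) = (\<Sum>i<b. \<Sum>y\<in>tree_leaves b n. f (i # y))"
  unfolding tree_leaves_Suc by (subst sum.reindex) (auto simp: inj_on_def sum.cartesian_product split_beta)

text \<open>
  \<open>\<eta> i\<close> consists of the local time at the child \<open>i\<close> of the root and of an independent copy of the
  walk on the subtree above it.
\<close>

lemma cascade_law:
  assumes A: "tree_path b (Suc n) M' X' Y' S'" and B: "tree_path b n M X Y S" and t: "0 < t"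
  shows "distr M' (\<Pi>\<^sub>M x\<in>tree_leaves b (Suc n). borel) (\<lambda>\<omega>. \<lambda>x\<in>tree_leaves b (Suc n). local_time X' t x \<omega>) =
    distr (\<Pi>\<^sub>M i\<in>{..<b}. cpe_law t \<Otimes>\<^sub>M M) (\<Pi>\<^sub>M x\<in>tree_leaves b (Suc n). borel)
      (\<lambda>\<eta>. \<lambda>x\<in>tree_leaves b (Suc n). local_time X (max 0 (fst (\<eta> (hd x)))) (tl x) (snd (\<eta> (hd x))))"
proof -
  interpret A: tree_path b "Suc n" M' X' Y' S' by fact
  interpret B: tree_path b n M X Y S by fact
  interpret c: prob_space "cpe_law t" by (rule prob_space_cpe)
  interpret cB: pair_prob_space "cpe_law t" M ..
  interpret N: product_prob_space "\<lambda>_. cpe_law t \<Otimes>\<^sub>M M" "{..<b}" ..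
  have L[measurable]: "(\<lambda>z. local_time X (max 0 (fst z)) y (snd z)) \<in> borel_measurable (cpe_law t \<Otimes>\<^sub>M M)" if "y \<in> tree_leaves b n" for y
    using B.local_time_measurable_max[OF B.leaf_ne[OF that]] by (simp add: split_beta cong: measurable_cong_sets)
  show ?thesis
  proof (rule laplace_determines_joint_law)
    show "finite_measure M'" by (rule A.finite_measure_axioms)
    show "finite_measure (\<Pi>\<^sub>M i\<in>{..<b}. cpe_law t \<Otimes>\<^sub>M M)" by (rule N.P.finite_measure_axioms)
    show "local_time X' t x \<in> borel_measurable M'" if "x \<in> tree_leaves b (Suc n)" for x
      using t by (intro A.local_time_measurable A.leaf_ne[OF that]) simp
    show "(\<lambda>\<eta>. local_time X (max 0 (fst (\<eta> (hd x)))) (tl x) (snd (\<eta> (hd x)))) \<in> borel_measurable (\<Pi>\<^sub>M i\<in>{..<b}. cpe_law t \<Otimes>\<^sub>M M)"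
      if "x \<in> tree_leaves b (Suc n)" for x
    proof -
      have x: "hd x \<in> {..<b}" "tl x \<in> tree_leaves b n" using that by (auto simp: tree_leaves_Suc)
      show ?thesis by (rule measurable_compose[OF measurable_component_singleton[OF x(1)] L[OF x(2)]])
    qed
    fix l :: "nat list \<Rightarrow> real" assume l: "\<And>x. 0 \<le> l x"
    \<comment> \<open>Exponent of the subtree above the child \<open>i\<close>. Run up to time
      \<open>s\<close>, the subtree contributes \<open>exp (- \<Phi> i * s)\<close>, and averaging
      over \<open>s\<close> puts the edge to the root in series.\<close>
    define \<Phi> where "\<Phi> i = Phi b n (\<lambda>y. if y \<in> tree_leaves b n then l (i # y) else 0)" for i
    have Phi0: "0 \<le> \<Phi> i" for i unfolding \<Phi>_def using l by (intro Phi_nonneg) auto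
    let ?g = "\<lambda>i z. ennreal (exp (- (\<Sum>y\<in>tree_leaves b n. l (i # y) * local_time X (max 0 (fst z)) y (snd z))))"
    have gm: "?g i \<in> borel_measurable (cpe_law t \<Otimes>\<^sub>M M)" for i by measurable
    have one: "(\<integral>\<^sup>+z. ?g i z \<partial>(cpe_law t \<Otimes>\<^sub>M M)) = ennreal (exp (- t * (\<Phi> i / (1 + \<Phi> i))))" for i
    proof -
      have "(\<integral>\<^sup>+z. ?g i z \<partial>(cpe_law t \<Otimes>\<^sub>M M)) = (\<integral>\<^sup>+s. \<integral>\<^sup>+\<omega>. ?g i (s, \<omega>) \<partial>M \<partial>cpe_law t)"
        by (rule B.nn_integral_fst[OF gm, symmetric])
      also have "\<dots> = (\<integral>\<^sup>+s. ennreal (exp (- \<Phi> i * s)) \<partial>cpe_law t)"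
      proof (rule nn_integral_cong_AE, use cpe_nonneg[OF t] in eventually_elim)
        case (elim s)
        then show ?case using B.laplace_leaves[of "\<lambda>y. l (i # y)" s] l by (simp add: \<Phi>_def max_def mult.commute)
      qed
      also have "\<dots> = ennreal (exp (- t * (\<Phi> i / (1 + \<Phi> i))))" by (rule cpe_laplace[OF t Phi0])
      finally show ?thesis .
    qed
    have "(\<integral>\<^sup>+\<eta>. ennreal (exp (- (\<Sum>x\<in>tree_leaves b (Suc n). l x * local_time X (max 0 (fst (\<eta> (hd x)))) (tl x) (snd (\<eta> (hd x)))))) \<partial>(\<Pi>\<^sub>M i\<in>{..<b}. cpe_law t \<Otimes>\<^sub>M M)) =
      (\<integral>\<^sup>+\<eta>. (\<Prod>i<b. ?g i (\<eta> i)) \<partial>(\<Pi>\<^sub>M i\<in>{..<b}. cpe_law t \<Otimes>\<^sub>M M))"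
      unfolding sum_tree_leaves_Suc by (simp add: prod_ennreal exp_sum[symmetric] sum_negf)
    also have "\<dots> = (\<Prod>i<b. \<integral>\<^sup>+z. ?g i z \<partial>(cpe_law t \<Otimes>\<^sub>M M))"
      by (rule N.product_nn_integral_prod) (auto intro: gm)
    also have "\<dots> = ennreal (exp (- t * (\<Sum>i<b. \<Phi> i / (1 + \<Phi> i))))"
      unfolding one by (simp add: prod_ennreal exp_sum[symmetric] sum_negf sum_distrib_left)
    also have "(\<Sum>i<b. \<Phi> i / (1 + \<Phi> i)) = Phi b (Suc n) (\<lambda>x. if x \<in> tree_leaves b (Suc n) then l x else 0)"
    proof -
      have "Phi b n (\<lambda>y. if i # y \<in> tree_leaves b (Suc n) then l (i # y) else 0) = \<Phi> i" if "i < b" for i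
        unfolding \<Phi>_def using that by (intro arg_cong[where f="Phi b n"] ext) (simp add: tree_leaves_def)
      moreover have "[] \<notin> tree_leaves b (Suc n)" by (simp add: tree_leaves_def)
      ultimately show ?thesis by simp
    qed
    also have "ennreal (exp (- t * Phi b (Suc n) (\<lambda>x. if x \<in> tree_leaves b (Suc n) then l x else 0))) =
      (\<integral>\<^sup>+\<omega>. ennreal (exp (- (\<Sum>x\<in>tree_leaves b (Suc n). l x * local_time X' t x \<omega>))) \<partial>M')"
      by (rule A.laplace_leaves[symmetric]) (use l t in auto)
    finally show "(\<integral>\<^sup>+\<omega>. ennreal (exp (- (\<Sum>x\<in>tree_leaves b (Suc n). l x * local_time X' t x \<omega>))) \<partial>M') =
      (\<integral>\<^sup>+\<eta>. ennreal (exp (- (\<Sum>x\<in>tree_leaves b (Suc n). l x * local_time X (max 0 (fst (\<eta> (hd x)))) (tl x) (snd (\<eta> (hd x)))))) \<partial>(\<Pi>\<^sub>M i\<in>{..<b}. cpe_law t \<Otimes>\<^sub>M M))"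
      by simp
  qed (auto simp: finite_tree_leaves local_time_nonneg)
qed

text \<open>The cascade before the limit. By \<open>zcascade_eq\<close> it differs from
  \<open>zsum\<close> at depth \<open>n + 1\<close> only in the level of the linear factor, which is
  \<open>n\<close>.\<close>

definition zcascade :: "nat \<Rightarrow> nat \<Rightarrow> (nat list \<Rightarrow> real) \<Rightarrow> real" where
  "zcascade b n f = (\<Sum>i<b. zsum b n (\<lambda>y. f (i # y)) / (real b)\<^sup>2)"

lemma zcascade_eq: "zcascade b n f = (1 / real b ^ (2 * Suc n)) * (\<Sum>x\<in>tree_leaves b (Suc n). zterm b n (f x))"
  unfolding zcascade_def zsum_def sum_tree_leaves_Suc
  by (simp add: sum_distrib_left sum_divide_distrib power2_eq_square mult_ac)

lemma zcascade_measurable: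
  assumes "\<And>x. x \<in> tree_leaves b (Suc n) \<Longrightarrow> (\<lambda>\<omega>. f \<omega> x) \<in> borel_measurable N"
  shows "(\<lambda>\<omega>. zcascade b n (f \<omega>)) \<in> borel_measurable N"
  unfolding zcascade_eq
  by (intro borel_measurable_times borel_measurable_const borel_measurable_sum measurable_compose[OF assms zterm_measurable])

text \<open>Let \<open>u\<close> be the distance of \<open>sqrt (f x)\<close> from
  \<open>(n + 1) * c\<close> with \<open>c = sqrt (ln b)\<close>. Lowering the level changes the
  linear factor by at most \<open>c\<close>, and \<open>c \<le> (c / K) * u\<close> as long as
  \<open>u \<ge> K\<close>. The terms are nonnegative, so this relative error passes to the
  sum.\<close>

lemma zsum_zcascade_close:
  assumes K: "0 < K" and le: "\<And>x. x \<in> tree_leaves b (Suc n) \<Longrightarrow> sqrt (f x) \<le> real (Suc n) * sqrt (ln b) - K"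
    and b: "2 \<le> b"
  shows "\<bar>zsum b (Suc n) f - zcascade b n f\<bar> \<le> sqrt (ln b) / K * zsum b (Suc n) f"
proof -
  define c where "c = sqrt (ln (real b))"
  have c: "0 \<le> c" using b by (simp add: c_def)
  have tm: "\<bar>zterm b (Suc n) y - zterm b n y\<bar> \<le> c / K * zterm b (Suc n) y" if y: "sqrt y \<le> real (Suc n) * c - K" for y
  proof -
    define w where "w = y powr (1 / 4) * exp (2 * c * sqrt y)"
    define u where "u = real (Suc n) * c - sqrt y"
    have w: "0 \<le> w" by (simp add: w_def)
    have u: "K \<le> u" using y by (simp add: u_def)
    have z1: "zterm b (Suc n) y = u * w" using u K by (simp add: zterm_def u_def w_def c_def max_def)
    have z0: "zterm b n y = max 0 (u - c) * w" by (simp add: zterm_def u_def w_def c_def algebra_simps)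
    have "\<bar>u - max 0 (u - c)\<bar> \<le> c" using u K c by (auto simp: max_def)
    also have "c \<le> c / K * u" using mult_left_mono[OF u c] K by (simp add: field_simps)
    finally have "\<bar>u - max 0 (u - c)\<bar> * w \<le> c / K * u * w" using w by (rule mult_right_mono)
    moreover have "\<bar>zterm b (Suc n) y - zterm b n y\<bar> = \<bar>u - max 0 (u - c)\<bar> * w"
      unfolding z1 z0 left_diff_distrib[symmetric] abs_mult using w by simp
    ultimately show ?thesis unfolding z1 by (simp add: mult.assoc)
  qed
  have "\<bar>zsum b (Suc n) f - zcascade b n f\<bar> = (1 / real b ^ (2 * Suc n)) * \<bar>\<Sum>x\<in>tree_leaves b (Suc n). zterm b (Suc n) (f x) - zterm b n (f x)\<bar>"
    unfolding zsum_def zcascade_eq right_diff_distrib[symmetric] sum_subtractf[symmetric] by (simp add: abs_mult)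
  also have "\<dots> \<le> (1 / real b ^ (2 * Suc n)) * (\<Sum>x\<in>tree_leaves b (Suc n). c / K * zterm b (Suc n) (f x))"
    using le by (intro mult_left_mono order_trans[OF sum_abs] sum_mono tm) (auto simp: c_def)
  also have "\<dots> = c / K * zsum b (Suc n) f" by (simp add: zsum_def sum_distrib_left mult_ac)
  finally show ?thesis by (simp add: c_def)
qed

section \<open>Passing to the limit with characteristic functions\<close>

lemma norm_iexp_diff_le: "cmod (iexp x - iexp y) \<le> min 2 \<bar>x - y\<bar>"
proof -
  have "cmod (iexp x - iexp y) \<le> cmod (iexp x) + cmod (iexp y)" by (rule norm_triangle_ineq4)
  moreover have "iexp x - iexp y = iexp y * (iexp (x - y) - 1)"
    by (simp add: right_diff_distrib exp_add[symmetric] algebra_simps)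
  then have "cmod (iexp x - iexp y) = cmod (iexp (x - y) - 1)" by (simp only: norm_mult norm_exp_i_times mult_1)
  moreover have "cmod (iexp (x - y) - 1) \<le> \<bar>x - y\<bar>" using iexp_approx1[of "x - y" 0] by simp
  ultimately show ?thesis by simp
qed

text \<open>Off \<open>B\<close> the relative error is turned into a bounded continuous function of
  \<open>U\<close> alone, which survives weak limits without any moment of \<open>U\<close>; on
  \<open>B\<close> the trivial bound 2 serves.\<close>

lemma (in prob_space) char_diff_le:
  assumes U[measurable]: "U \<in> borel_measurable M" and V[measurable]: "V \<in> borel_measurable M"
    and B[measurable]: "B \<in> sets M" and \<delta>: "0 \<le> \<delta>"
    and close: "AE \<omega> in M. \<omega> \<notin> B \<longrightarrow> \<bar>U \<omega> - V \<omega>\<bar> \<le> \<delta> * \<bar>U \<omega>\<bar>"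
  shows "cmod (char (distr M borel U) \<theta> - char (distr M borel V) \<theta>) \<le>
    2 * prob B + (\<integral>x. min 2 (\<bar>\<theta>\<bar> * \<delta> * \<bar>x\<bar>) \<partial>distr M borel U)"
proof -
  have i: "integrable M (\<lambda>\<omega>. iexp (\<theta> * U \<omega>))" "integrable M (\<lambda>\<omega>. iexp (\<theta> * V \<omega>))"
    by (rule integrable_const_bound[where B=1]; simp)+
  have j: "integrable M (\<lambda>\<omega>. min 2 (\<bar>\<theta>\<bar> * \<delta> * \<bar>U \<omega>\<bar>))"
    using \<delta> by (intro integrable_const_bound[where B=2]) (auto simp: min_def)
  have k: "integrable M (\<lambda>\<omega>. 2 * indicat_real B \<omega>)" by (rule integrable_const_bound[where B=2]) (auto simp: indicator_def)
  have "char (distr M borel U) \<theta> - char (distr M borel V) \<theta> = (\<integral>\<omega>. iexp (\<theta> * U \<omega>) - iexp (\<theta> * V \<omega>) \<partial>M)"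
    unfolding char_def by (subst (1 2) integral_distr) (use i in auto)
  also have "cmod \<dots> \<le> (\<integral>\<omega>. cmod (iexp (\<theta> * U \<omega>) - iexp (\<theta> * V \<omega>)) \<partial>M)" by (rule integral_norm_bound)
  also have "\<dots> \<le> (\<integral>\<omega>. 2 * indicator B \<omega> + min 2 (\<bar>\<theta>\<bar> * \<delta> * \<bar>U \<omega>\<bar>) \<partial>M)"
  proof (rule integral_mono_AE)
    show "AE \<omega> in M. cmod (iexp (\<theta> * U \<omega>) - iexp (\<theta> * V \<omega>)) \<le> 2 * indicator B \<omega> + min 2 (\<bar>\<theta>\<bar> * \<delta> * \<bar>U \<omega>\<bar>)"
      using close
    proof eventually_elim
      case (elim \<omega>)
      have n: "cmod (iexp (\<theta> * U \<omega>) - iexp (\<theta> * V \<omega>)) \<le> min 2 (\<bar>\<theta>\<bar> * \<bar>U \<omega> - V \<omega>\<bar>)"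
        using norm_iexp_diff_le[of "\<theta> * U \<omega>" "\<theta> * V \<omega>"] by (simp only: right_diff_distrib[symmetric] abs_mult)
      show ?case
      proof (cases "\<omega> \<in> B")
        case True
        have "0 \<le> min 2 (\<bar>\<theta>\<bar> * \<delta> * \<bar>U \<omega>\<bar>)" using \<delta> by simp
        moreover have "cmod (iexp (\<theta> * U \<omega>) - iexp (\<theta> * V \<omega>)) \<le> 2" using n by linarith
        ultimately show ?thesis using True by simp
      next
        case False
        then have "\<bar>\<theta>\<bar> * \<bar>U \<omega> - V \<omega>\<bar> \<le> \<bar>\<theta>\<bar> * (\<delta> * \<bar>U \<omega>\<bar>)" using elim by (intro mult_left_mono) auto
        then show ?thesis using n False by (simp add: mult.assoc)
      qed
    qed
  next
    show "integrable M (\<lambda>\<omega>. 2 * indicator B \<omega> + min 2 (\<bar>\<theta>\<bar> * \<delta> * \<bar>U \<omega>\<bar>))" using k j by (rule Bochner_Integration.integrable_add)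
  qed (use i in auto)
  also have "\<dots> = 2 * prob B + (\<integral>x. min 2 (\<bar>\<theta>\<bar> * \<delta> * \<bar>x\<bar>) \<partial>distr M borel U)"
    using j k by (subst integral_distr) (auto simp: Bochner_Integration.integral_add)
  finally show ?thesis .
qed

text \<open>By \<open>cascade_law\<close> the subtrees are independent with a common law, which
  gives a \<open>b\<close>-th power; division by the square of \<open>b\<close> moves into the
  argument, and the random time is integrated out by Fubini.\<close>

lemma cascade_char:
  assumes A: "tree_path b (Suc n) M' X' Y' S'" and B: "tree_path b n M X Y S" and t: "0 < t"
  shows "char (distr M' borel (\<lambda>\<omega>. zcascade b n (\<lambda>x. local_time X' t x \<omega>))) \<theta> =
    (\<integral>s. char (distr M borel (Zn b n X s)) (\<theta> / (real b)\<^sup>2) \<partial>cpe_law t) ^ b"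
proof -
  interpret A: tree_path b "Suc n" M' X' Y' S' by fact
  interpret B: tree_path b n M X Y S by fact
  interpret c: prob_space "cpe_law t" by (rule prob_space_cpe)
  interpret cB: pair_prob_space "cpe_law t" M ..
  interpret N: product_prob_space "\<lambda>_. cpe_law t \<Otimes>\<^sub>M M" "{..<b}" ..
  let ?L = "tree_leaves b (Suc n)" and ?N = "\<Pi>\<^sub>M i\<in>{..<b}. cpe_law t \<Otimes>\<^sub>M M"
  define \<xi> where "\<xi> x \<eta> = local_time X (max 0 (fst (\<eta> (hd x)))) (tl x) (snd (\<eta> (hd x)))" for x and \<eta> :: "nat \<Rightarrow> real \<times> 'b"
  have L: "(\<lambda>z. local_time X (max 0 (fst z)) y (snd z)) \<in> borel_measurable (cpe_law t \<Otimes>\<^sub>M M)" if "y \<in> tree_leaves b n" for y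
    using B.local_time_measurable_max[OF B.leaf_ne[OF that]] by (simp add: split_beta cong: measurable_cong_sets)
  have \<xi>: "\<xi> x \<in> borel_measurable ?N" if "x \<in> ?L" for x
  proof -
    have x: "hd x \<in> {..<b}" "tl x \<in> tree_leaves b n" using that by (auto simp: tree_leaves_Suc)
    show ?thesis unfolding \<xi>_def by (rule measurable_compose[OF measurable_component_singleton[OF x(1)] L[OF x(2)]])
  qed
  have h: "zcascade b n \<in> borel_measurable (\<Pi>\<^sub>M x\<in>?L. borel)" by (rule zcascade_measurable) auto
  have restr: "zcascade b n (\<lambda>x\<in>?L. f x) = zcascade b n f" for f unfolding zcascade_eq by simp
  have mA: "(\<lambda>\<omega>. \<lambda>x\<in>?L. local_time X' t x \<omega>) \<in> M' \<rightarrow>\<^sub>M (\<Pi>\<^sub>M x\<in>?L. borel)"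
    using t by (intro measurable_restrict A.local_time_measurable A.leaf_ne) auto
  have mN: "(\<lambda>\<eta>. \<lambda>x\<in>?L. \<xi> x \<eta>) \<in> ?N \<rightarrow>\<^sub>M (\<Pi>\<^sub>M x\<in>?L. borel)"
    by (intro measurable_restrict \<xi>)
  define G where "G z = zsum b n (\<lambda>y. local_time X (max 0 (fst z)) y (snd z))" for z
  have G[measurable]: "G \<in> borel_measurable (cpe_law t \<Otimes>\<^sub>M M)" unfolding G_def by (rule zsum_measurable) (rule L)
  have "distr M' borel (\<lambda>\<omega>. zcascade b n (\<lambda>x. local_time X' t x \<omega>)) =
    distr (distr M' (\<Pi>\<^sub>M x\<in>?L. borel) (\<lambda>\<omega>. \<lambda>x\<in>?L. local_time X' t x \<omega>)) borel (zcascade b n)"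
    by (subst distr_distr[OF h mA]) (simp add: comp_def restr)
  also have "\<dots> = distr (distr ?N (\<Pi>\<^sub>M x\<in>?L. borel) (\<lambda>\<eta>. \<lambda>x\<in>?L. \<xi> x \<eta>)) borel (zcascade b n)"
    unfolding \<xi>_def using cascade_law[OF A B t] by simp
  also have "\<dots> = distr ?N borel (\<lambda>\<eta>. zcascade b n (\<lambda>x. \<xi> x \<eta>))"
    by (subst distr_distr[OF h mN]) (simp add: comp_def restr)
  finally have "char (distr M' borel (\<lambda>\<omega>. zcascade b n (\<lambda>x. local_time X' t x \<omega>))) \<theta> =
      (\<integral>x. iexp (\<theta> * x) \<partial>distr ?N borel (\<lambda>\<eta>. zcascade b n (\<lambda>x. \<xi> x \<eta>)))"
    by (simp add: char_def)
  also have "\<dots> = (\<integral>\<eta>. iexp (\<theta> * zcascade b n (\<lambda>x. \<xi> x \<eta>)) \<partial>?N)"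
    by (rule integral_distr) (auto intro!: zcascade_measurable \<xi>)
  also have "\<dots> = (\<integral>\<eta>. (\<Prod>i<b. iexp (\<theta> / (real b)\<^sup>2 * G (\<eta> i))) \<partial>?N)"
  proof (rule Bochner_Integration.integral_cong[OF refl])
    fix \<eta>
    have "\<theta> * zcascade b n (\<lambda>x. \<xi> x \<eta>) = (\<Sum>i<b. \<theta> / (real b)\<^sup>2 * G (\<eta> i))"
      by (simp add: zcascade_def \<xi>_def G_def sum_distrib_left)
    then show "iexp (\<theta> * zcascade b n (\<lambda>x. \<xi> x \<eta>)) = (\<Prod>i<b. iexp (\<theta> / (real b)\<^sup>2 * G (\<eta> i)))"
      by (simp only: of_real_sum sum_distrib_left exp_sum finite_lessThan)
  qed
  also have "\<dots> = (\<Prod>i<b. \<integral>z. iexp (\<theta> / (real b)\<^sup>2 * G z) \<partial>(cpe_law t \<Otimes>\<^sub>M M))"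
    by (rule N.product_integral_prod) (auto intro!: cB.P.integrable_const_bound[where B=1])
  also have "\<dots> = (\<integral>z. iexp (\<theta> / (real b)\<^sup>2 * G z) \<partial>(cpe_law t \<Otimes>\<^sub>M M)) ^ b"
    by simp
  also have "(\<integral>z. iexp (\<theta> / (real b)\<^sup>2 * G z) \<partial>(cpe_law t \<Otimes>\<^sub>M M)) = (\<integral>s. \<integral>\<omega>. iexp (\<theta> / (real b)\<^sup>2 * G (s, \<omega>)) \<partial>M \<partial>cpe_law t)"
    by (rule cB.integral_fst'[symmetric]) (auto intro!: cB.P.integrable_const_bound[where B=1])
  also have "\<dots> = (\<integral>s. char (distr M borel (Zn b n X s)) (\<theta> / (real b)\<^sup>2) \<partial>cpe_law t)"
  proof (rule Bochner_Integration.integral_cong[OF refl])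
    fix s
    have Z: "Zn b n X s \<in> borel_measurable M" using B.Zn_measurable[of s] by (simp add: Zn_max)
    have Gs: "(\<lambda>\<omega>. G (s, \<omega>)) \<in> borel_measurable M"
      using sets_eq_imp_space_eq[OF sets_cpe, of t] by (intro measurable_Pair2[OF G]) simp
    have "AE \<omega> in M. G (s, \<omega>) = Zn b n X s \<omega>"
      using B.Zn_AE
    proof eventually_elim
      case (elim \<omega>)
      then have "Zn b n X (max 0 s) \<omega> = G (s, \<omega>)" by (simp add: G_def)
      then show ?case by (simp add: Zn_max)
    qed
    then have "(\<integral>\<omega>. iexp (\<theta> / (real b)\<^sup>2 * G (s, \<omega>)) \<partial>M) = (\<integral>\<omega>. iexp (\<theta> / (real b)\<^sup>2 * Zn b n X s \<omega>) \<partial>M)"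
      using Z Gs by (intro integral_cong_AE) (auto elim!: eventually_mono)
    also have "\<dots> = char (distr M borel (Zn b n X s)) (\<theta> / (real b)\<^sup>2)"
      unfolding char_def using Z by (intro integral_distr[symmetric]) auto
    finally show "(\<integral>\<omega>. iexp (\<theta> / (real b)\<^sup>2 * G (s, \<omega>)) \<partial>M) = char (distr M borel (Zn b n X s)) (\<theta> / (real b)\<^sup>2)" .
  qed
  finally show ?thesis .
qed

lemma tree_walk_Zn_kernel:
  assumes "tree_walk b n M X" "2 \<le> b" "1 \<le> n"
  shows "(\<lambda>t. distr M borel (Zn b n X t)) \<in> borel \<rightarrow>\<^sub>M prob_algebra borel"
proof -
  obtain Y S where "tree_path b n M X Y S" using assms by (rule tree_walkE)
  then interpret tree_path b n M X Y S .
  have "Zn b n X (max 0 t) = Zn b n X t" for t by (rule ext) (rule Zn_max)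
  then show ?thesis using Zn_kernel by simp
qed

lemma char_kernel_measurable:
  assumes "\<kappa> \<in> borel \<rightarrow>\<^sub>M prob_algebra borel"
  shows "(\<lambda>t. char (\<kappa> t) \<theta>) \<in> borel_measurable borel"
  unfolding char_def
  by (rule measurable_compose[OF measurable_prob_algebraD[OF assms] integral_measurable_subprob_algebra]) measurable

lemma char_limit_cascade:
  fixes \<kappa> :: "real \<Rightarrow> real measure"
  assumes b: "2 \<le> b" and walk: "\<And>n. 1 \<le> n \<Longrightarrow> tree_walk b n (P n) (X n)"
    and \<kappa>: "\<kappa> \<in> borel \<rightarrow>\<^sub>M prob_algebra borel"
    and conv: "\<And>s. weak_conv_m (\<lambda>n. distr (P (Suc n)) borel (Zn b (Suc n) (X (Suc n)) s)) (\<kappa> s)"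
    and t: "0 < t"
  shows "char (\<kappa> t) \<theta> = (\<integral>s. char (\<kappa> s) (\<theta> / (real b)\<^sup>2) \<partial>cpe_law t) ^ b"
proof -
  define \<mu> where "\<mu> n s = distr (P (Suc n)) borel (Zn b (Suc n) (X (Suc n)) s)" for n s
  have \<mu>k: "\<mu> n \<in> borel \<rightarrow>\<^sub>M prob_algebra borel" for n
    unfolding \<mu>_def using b by (intro tree_walk_Zn_kernel walk) auto
  note \<mu>d = real_distribution_kernel[OF \<mu>k] and \<kappa>d = real_distribution_kernel[OF \<kappa>]
  note lev = levy_continuity1[OF \<mu>d \<kappa>d conv[folded \<mu>_def]]
  define c where "c = sqrt (ln (real b))"
  have c: "0 < c" using b by (simp add: c_def)
  interpret cpe: prob_space "cpe_law t" by (rule prob_space_cpe)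
  \<comment> \<open>As \<open>\<mu> n\<close> belongs to depth \<open>n + 1\<close>,
    \<open>C m\<close> is taken at depth \<open>m + 2\<close> and \<open>A m\<close> on its subtrees
    of depth \<open>m + 1\<close>.\<close>
  define C where "C m = char (\<mu> (Suc m) t) \<theta>" for m
  define A where "A m = (\<integral>s. char (\<mu> m s) (\<theta> / (real b)\<^sup>2) \<partial>cpe_law t) ^ b" for m
  define A' where "A' = (\<integral>s. char (\<kappa> s) (\<theta> / (real b)\<^sup>2) \<partial>cpe_law t) ^ b"
  have C: "C \<longlonglongrightarrow> char (\<kappa> t) \<theta>" unfolding C_def using lev by (rule LIMSEQ_Suc)
  \<comment> \<open>Convergence at each fixed time is enough, as characteristic functions are
    bounded by 1.\<close>
  have A: "A \<longlonglongrightarrow> A'"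
    unfolding A_def A'_def
  proof (intro tendsto_power integral_dominated_convergence[where w="\<lambda>_. 1"])
    show "(\<lambda>s. char (\<kappa> s) (\<theta> / (real b)\<^sup>2)) \<in> borel_measurable (cpe_law t)" "(\<lambda>s. char (\<mu> m s) (\<theta> / (real b)\<^sup>2)) \<in> borel_measurable (cpe_law t)" for m
      using char_kernel_measurable[OF \<kappa>] char_kernel_measurable[OF \<mu>k] by (simp_all cong: measurable_cong_sets)
    show "AE s in cpe_law t. cmod (char (\<mu> m s) (\<theta> / (real b)\<^sup>2)) \<le> 1" for m
      by (intro AE_I2 real_distribution.cmod_char_le_1 \<mu>d)
  qed (auto intro!: AE_I2 lev)
  \<comment> \<open>The cost of the relative error \<open>c / K\<close>, written as the integral of
    a bounded continuous function so that it converges along with the laws.\<close>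
  define J where "J K \<nu> = (\<integral>x. min 2 (\<bar>\<theta>\<bar> * (c / K) * \<bar>x\<bar>) \<partial>\<nu>)" for K :: real and \<nu> :: "real measure"
  have close: "cmod (C m - A m) \<le> 2 * (t / real (Suc (Suc m)) * exp (t + t * ln b + 2 * c * K)) + J K (\<mu> (Suc m) t)"
    if K: "0 < K" "K \<le> real (Suc (Suc m)) * c" for K m
  proof -
    obtain Y S where "tree_path b (Suc m) (P (Suc m)) (X (Suc m)) Y S"
      using walk[of "Suc m"] b by (auto elim: tree_walkE)
    then interpret B: tree_path b "Suc m" "P (Suc m)" "X (Suc m)" Y S .
    obtain Y' S' where "tree_path b (Suc (Suc m)) (P (Suc (Suc m))) (X (Suc (Suc m))) Y' S'"
      using walk[of "Suc (Suc m)"] b by (auto elim: tree_walkE)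
    then interpret A: tree_path b "Suc (Suc m)" "P (Suc (Suc m))" "X (Suc (Suc m))" Y' S' .
    let ?X = "X (Suc (Suc m))" and ?n = "Suc (Suc m)"
    define U where "U = Zn b ?n ?X t"
    define V where "V \<omega> = zcascade b (Suc m) (\<lambda>x. local_time ?X t x \<omega>)" for \<omega>
    define D where "D = {\<omega>\<in>space (P ?n). \<exists>x\<in>tree_leaves b ?n. real ?n * c - K < sqrt (local_time ?X t x \<omega>)}"
    have L: "local_time ?X t x \<in> borel_measurable (P ?n)" if "x \<in> tree_leaves b ?n" for x
      using t by (intro A.local_time_measurable A.leaf_ne[OF that]) simp
    have "cmod (char (distr (P ?n) borel U) \<theta> - char (distr (P ?n) borel V) \<theta>) \<le>
      2 * A.prob D + (\<integral>x. min 2 (\<bar>\<theta>\<bar> * (c / K) * \<bar>x\<bar>) \<partial>distr (P ?n) borel U)"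
    proof (rule A.char_diff_le)
      show "U \<in> borel_measurable (P ?n)" unfolding U_def using t by (intro A.Zn_measurable') simp
      show "V \<in> borel_measurable (P ?n)" unfolding V_def by (intro zcascade_measurable L)
      show "D \<in> A.events"
      proof -
        have "{\<omega>\<in>space (P ?n). real ?n * c - K < sqrt (local_time ?X t x \<omega>)} \<in> A.events" if "x \<in> tree_leaves b ?n" for x
        proof -
          note [measurable] = L[OF that]
          show ?thesis by measurable
        qed
        moreover have "D = (\<Union>x\<in>tree_leaves b ?n. {\<omega>\<in>space (P ?n). real ?n * c - K < sqrt (local_time ?X t x \<omega>)})"
          unfolding D_def by blast
        ultimately show ?thesis using finite_tree_leaves by (simp only: sets.finite_UN)
      qed
      show "0 \<le> c / K" using c K by simp
      show "AE \<omega> in P ?n. \<omega> \<notin> D \<longrightarrow> \<bar>U \<omega> - V \<omega>\<bar> \<le> c / K * \<bar>U \<omega>\<bar>"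
        using AE_space
      proof eventually_elim
        case (elim \<omega>)
        have U: "U \<omega> = zsum b ?n (\<lambda>x. local_time ?X t x \<omega>)" using t by (simp add: U_def Zn_eq)
        show ?case
        proof
          assume "\<omega> \<notin> D"
          then have "sqrt (local_time ?X t x \<omega>) \<le> real ?n * sqrt (ln b) - K" if "x \<in> tree_leaves b ?n" for x
            using elim that unfolding D_def c_def by (simp only: mem_Collect_eq not_less[symmetric]) blast
          then have "\<bar>U \<omega> - V \<omega>\<bar> \<le> c / K * U \<omega>"
            unfolding U V_def c_def by (intro zsum_zcascade_close K(1) b)
          moreover have "0 \<le> U \<omega>" unfolding U_def by (rule Zn_nonneg)
          ultimately show "\<bar>U \<omega> - V \<omega>\<bar> \<le> c / K * \<bar>U \<omega>\<bar>" by simp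
        qed
      qed
    qed
    also have "char (distr (P ?n) borel V) \<theta> = A m"
      unfolding V_def A_def \<mu>_def by (rule cascade_char[OF A.tree_path_axioms B.tree_path_axioms t])
    also have "char (distr (P ?n) borel U) \<theta> = C m" by (simp add: C_def U_def \<mu>_def)
    also have "(\<integral>x. min 2 (\<bar>\<theta>\<bar> * (c / K) * \<bar>x\<bar>) \<partial>distr (P ?n) borel U) = J K (\<mu> (Suc m) t)"
      by (simp add: J_def U_def \<mu>_def)
    also have "A.prob D \<le> t / real ?n * exp (t + t * ln b + 2 * c * K)"
      unfolding D_def c_def using K by (intro A.max_local_time_tail t) (auto simp: c_def)
    finally show ?thesis by simp
  qed
  have bound: "cmod (char (\<kappa> t) \<theta> - A') \<le> J K (\<kappa> t)" if K: "0 < K" for K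
  proof (rule LIMSEQ_le)
    show "(\<lambda>m. cmod (C m - A m)) \<longlonglongrightarrow> cmod (char (\<kappa> t) \<theta> - A')"
      by (intro tendsto_norm tendsto_diff C A)
    have J: "(\<lambda>m. J K (\<mu> (Suc m) t)) \<longlonglongrightarrow> J K (\<kappa> t)"
    proof -
      have "(\<lambda>m. J K (\<mu> m t)) \<longlonglongrightarrow> J K (\<kappa> t)"
        unfolding J_def
      proof (rule weak_conv_imp_integral_bdd_continuous_conv[OF \<mu>d \<kappa>d conv[folded \<mu>_def]])
        show "isCont (\<lambda>x. min 2 (\<bar>\<theta>\<bar> * (c / K) * \<bar>x\<bar>)) x" for x by (intro continuous_intros)
        have "0 \<le> \<bar>\<theta>\<bar> * (c / K) * \<bar>x\<bar>" for x using c K by simp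
        then show "norm (min 2 (\<bar>\<theta>\<bar> * (c / K) * \<bar>x\<bar>)) \<le> 2" for x by (simp add: min_def)
      qed
      then show ?thesis by (rule LIMSEQ_Suc)
    qed
    have "(\<lambda>m. t / real (Suc (Suc m))) \<longlonglongrightarrow> 0"
      using LIMSEQ_Suc[OF LIMSEQ_Suc[OF lim_const_over_n[of t]]] by simp
    then have "(\<lambda>m. 2 * (t / real (Suc (Suc m)) * exp (t + t * ln b + 2 * c * K)) + J K (\<mu> (Suc m) t)) \<longlonglongrightarrow>
        2 * (0 * exp (t + t * ln b + 2 * c * K)) + J K (\<kappa> t)"
      by (intro tendsto_intros J)
    then show "(\<lambda>m. 2 * (t / real (Suc (Suc m)) * exp (t + t * ln b + 2 * c * K)) + J K (\<mu> (Suc m) t)) \<longlonglongrightarrow> J K (\<kappa> t)"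
      by simp
    \<comment> \<open>The tail bound becomes available once the level \<open>(m + 2) * c\<close> has
      passed \<open>K\<close>.\<close>
    obtain N :: nat where N: "K / c < real N" using reals_Archimedean2 by blast
    have "K \<le> real (Suc (Suc m)) * c" if "N \<le> m" for m
    proof -
      have "K < real N * c" using N c by (simp add: field_simps)
      also have "\<dots> \<le> real (Suc (Suc m)) * c" using that c by (intro mult_right_mono) auto
      finally show ?thesis by simp
    qed
    then show "\<exists>N. \<forall>m\<ge>N. cmod (C m - A m) \<le> 2 * (t / real (Suc (Suc m)) * exp (t + t * ln b + 2 * c * K)) + J K (\<mu> (Suc m) t)"
      using close[OF K] by blast
  qed
  interpret \<kappa>: real_distribution "\<kappa> t" by (rule \<kappa>d)
  \<comment> \<open>As \<open>K\<close> grows the integrand tends to 0 at each point and is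
    dominated by 2.\<close>
  have "(\<lambda>k. J (real (Suc k)) (\<kappa> t)) \<longlonglongrightarrow> (\<integral>x. 0 \<partial>\<kappa> t)"
    unfolding J_def
  proof (rule integral_dominated_convergence[where w="\<lambda>_. 2"])
    show "AE x in \<kappa> t. norm (min 2 (\<bar>\<theta>\<bar> * (c / real (Suc k)) * \<bar>x\<bar>)) \<le> 2" for k
      using c by (intro AE_I2) (auto simp: min_def)
    show "AE x in \<kappa> t. (\<lambda>k. min 2 (\<bar>\<theta>\<bar> * (c / real (Suc k)) * \<bar>x\<bar>)) \<longlonglongrightarrow> 0"
    proof (rule AE_I2)
      fix x
      have "(\<lambda>k. c / real (Suc k)) \<longlonglongrightarrow> 0" using LIMSEQ_Suc[OF lim_const_over_n[of c]] by simp
      then have "(\<lambda>k. min 2 (\<bar>\<theta>\<bar> * (c / real (Suc k)) * \<bar>x\<bar>)) \<longlonglongrightarrow> min 2 (\<bar>\<theta>\<bar> * 0 * \<bar>x\<bar>)"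
        by (intro tendsto_intros)
      then show "(\<lambda>k. min 2 (\<bar>\<theta>\<bar> * (c / real (Suc k)) * \<bar>x\<bar>)) \<longlonglongrightarrow> 0" by simp
    qed
  qed auto
  then have "(\<lambda>k. J (real (Suc k)) (\<kappa> t)) \<longlonglongrightarrow> 0" by simp
  then have "cmod (char (\<kappa> t) \<theta> - A') \<le> 0"
    by (rule LIMSEQ_le_const) (use bound in auto)
  then show ?thesis by (simp add: A'_def)
qed


section \<open>Couplings, independent times and the limiting cascade\<close>

lemma coupled_pair_law:
  assumes c: "coupled \<zeta> \<mu> fst snd" and s: "sets \<mu> = sets borel" and E: "E \<in> sets borel"
  shows "emeasure \<mu> E = (\<integral>\<^sup>+t\<in>{0..}. emeasure (\<zeta> t) {z. (t, z) \<in> E} \<partial>distr \<mu> borel fst)"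
proof -
  have "space \<mu> = UNIV" using sets_eq_imp_space_eq[OF s] by simp
  then have eq: "{\<omega> \<in> space \<mu>. (fst \<omega>, snd \<omega>) \<in> E} = E" by simp
  have "emeasure \<mu> {\<omega> \<in> space \<mu>. (fst \<omega>, snd \<omega>) \<in> E} =
      (\<integral>\<^sup>+t\<in>{0..}. emeasure (\<zeta> t) {z. (t, z) \<in> E} \<partial>distr \<mu> borel fst)"
    using c E unfolding coupled_def by blast
  then show ?thesis unfolding eq .
qed

text \<open>For existence, the images of \<open>\<kappa> t\<close> under \<open>Pair t\<close>, that
  is the laws of (t, Z(t)), are mixed over the law of \<open>T\<close>. For uniqueness, the identity
  in \<open>coupled\<close> expresses the measure of every Borel set through the first marginal,
  which is prescribed.\<close>

lemma coupling_unique: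
  assumes M: "prob_space M" and T[measurable]: "T \<in> borel_measurable M" and T0: "AE \<omega> in M. 0 \<le> T \<omega>"
    and \<kappa>: "\<kappa> \<in> borel \<rightarrow>\<^sub>M prob_algebra borel" and eq: "\<And>t. 0 \<le> t \<Longrightarrow> \<kappa> t = \<zeta> t"
  shows "\<exists>!\<mu> :: (real \<times> real) measure.
    sets \<mu> = sets borel \<and> distr \<mu> borel fst = distr M borel T \<and> coupled \<zeta> \<mu> fst snd"
proof (rule ex_ex1I)
  interpret prob_space M by fact
  interpret D: prob_space "distr M borel T" by (rule prob_space_distr) measurable
  have D0: "AE t in distr M borel T. 0 \<le> t" using T0 by (subst AE_distr_iff) auto
  note \<kappa>d = real_distribution_kernel[OF \<kappa>]
  define H where "H t = distr (\<kappa> t) borel (Pair t)" for t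
  have H: "H \<in> borel \<rightarrow>\<^sub>M prob_algebra borel"
    unfolding H_def by (rule measurable_distr_prob_space2[OF \<kappa>]) (simp add: borel_prod)
  then have H': "H \<in> distr M borel T \<rightarrow>\<^sub>M subprob_algebra borel"
    using measurable_prob_algebraD[OF H] by (simp cong: measurable_cong_sets)
  have Pm: "Pair t \<in> \<kappa> t \<rightarrow>\<^sub>M borel" for t
  proof -
    have "Pair t \<in> borel \<rightarrow>\<^sub>M (borel \<Otimes>\<^sub>M borel :: (real \<times> real) measure)" by measurable
    then show ?thesis using real_distribution.events_eq_borel[OF \<kappa>d] by (simp add: borel_prod cong: measurable_cong_sets)
  qed
  define \<mu> where "\<mu> = distr M borel T \<bind> H"
  have s: "sets \<mu> = sets borel" unfolding \<mu>_def by (rule sets_bind[OF sets_kernel[OF H'] D.not_empty])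
  have sp: "space \<mu> = UNIV" using sets_eq_imp_space_eq[OF s] by simp
  have HE: "emeasure (H t) E = emeasure (\<kappa> t) {z. (t, z) \<in> E}" if "E \<in> sets borel" for t E
    unfolding H_def using real_distribution.space_eq_univ[OF \<kappa>d] by (subst emeasure_distr[OF Pm that]) (simp add: vimage_def)
  have e: "emeasure \<mu> E = (\<integral>\<^sup>+t. emeasure (\<kappa> t) {z. (t, z) \<in> E} \<partial>distr M borel T)" if E: "E \<in> sets borel" for E
    unfolding \<mu>_def by (subst emeasure_bind[OF _ H' E]) (simp_all add: HE[OF E])
  have f[measurable]: "fst \<in> borel_measurable \<mu>" "snd \<in> borel_measurable \<mu>"
    unfolding measurable_cong_sets[OF s refl] borel_prod[symmetric] by measurable
  have "prob_space \<mu>"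
    unfolding \<mu>_def
    by (rule D.prob_space_bind[OF _ H']) (use measurable_space[OF H] in \<open>auto simp: space_prob_algebra\<close>)
  have df: "distr \<mu> borel fst = distr M borel T"
  proof (rule measure_eqI)
    fix A assume "A \<in> sets (distr \<mu> borel fst)"
    then have A[measurable]: "A \<in> sets borel" by simp
    have "A \<times> UNIV \<in> sets (borel :: (real \<times> real) measure)" unfolding borel_prod[symmetric] by measurable
    then have "emeasure (distr \<mu> borel fst) A = (\<integral>\<^sup>+t. emeasure (\<kappa> t) {z. (t, z) \<in> A \<times> UNIV} \<partial>distr M borel T)"
      using e sp by (subst emeasure_distr) (auto simp: fst_vimage_eq_Times)
    also have "\<dots> = (\<integral>\<^sup>+t. indicator A t \<partial>distr M borel T)"
    proof (rule nn_integral_cong)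
      fix t
      interpret \<kappa>: real_distribution "\<kappa> t" by (rule \<kappa>d)
      show "emeasure (\<kappa> t) {z. (t, z) \<in> A \<times> UNIV} = indicator A t"
        using \<kappa>.emeasure_space_1 by (simp add: indicator_def)
    qed
    finally show "emeasure (distr \<mu> borel fst) A = emeasure (distr M borel T) A" by simp
  qed simp
  have "AE \<omega> in \<mu>. 0 \<le> fst \<omega>"
    using D0 unfolding df[symmetric] by (subst (asm) AE_distr_iff) auto
  moreover have "emeasure \<mu> {\<omega>\<in>space \<mu>. (fst \<omega>, snd \<omega>) \<in> E} = (\<integral>\<^sup>+t\<in>{0..}. emeasure (\<zeta> t) {z. (t, z) \<in> E} \<partial>distr \<mu> borel fst)"
    if "E \<in> sets borel" for E
    unfolding df sp using e[OF that] D0 by (simp, intro nn_integral_cong_AE) (auto elim!: eventually_mono simp: eq)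
  ultimately have "coupled \<zeta> \<mu> fst snd" unfolding coupled_def using \<open>prob_space \<mu>\<close> by auto
  then show "\<exists>\<mu> :: (real \<times> real) measure. sets \<mu> = sets borel \<and> distr \<mu> borel fst = distr M borel T \<and> coupled \<zeta> \<mu> fst snd"
    using s df by blast
next
  fix \<mu> \<nu> :: "(real \<times> real) measure"
  assume m: "sets \<mu> = sets borel \<and> distr \<mu> borel fst = distr M borel T \<and> coupled \<zeta> \<mu> fst snd"
    and n: "sets \<nu> = sets borel \<and> distr \<nu> borel fst = distr M borel T \<and> coupled \<zeta> \<nu> fst snd"
  show "\<mu> = \<nu>"
  proof (rule measure_eqI)
    fix E assume "E \<in> sets \<mu>"
    then have "E \<in> sets borel" using m by simp
    then show "emeasure \<mu> E = emeasure \<nu> E"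
      using m n coupled_pair_law[of \<zeta> \<mu> E] coupled_pair_law[of \<zeta> \<nu> E] by simp
  qed (use m n in simp)
qed

lemma coupledD:
  assumes "coupled \<zeta> M T Z"
  shows "prob_space M" "T \<in> borel_measurable M" "Z \<in> borel_measurable M" "AE \<omega> in M. 0 \<le> T \<omega>"
  using assms by (auto simp: coupled_def)

text \<open>Prelimit and limit are mixtures over the same law of \<open>T\<close>, so convergence at
  each fixed time and dominated convergence suffice.\<close>

lemma Zn_independent_time_conv:
  fixes \<kappa> :: "real \<Rightarrow> real measure"
  assumes b: "2 \<le> b" and \<kappa>: "\<kappa> \<in> borel \<rightarrow>\<^sub>M prob_algebra borel" and eq: "\<And>t. 0 \<le> t \<Longrightarrow> \<kappa> t = \<zeta> t"
    and conv: "\<And>t. weak_conv_m (\<lambda>n. distr (P (Suc n)) borel (Zn b (Suc n) (X (Suc n)) t)) (\<kappa> t)"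
    and P: "\<And>n. 1 \<le> n \<Longrightarrow> tree_walk b n (P n) (X n)"
    and c: "coupled \<zeta> M T Z"
    and Q: "\<And>n. 1 \<le> n \<Longrightarrow> tree_walk b n (Q n) (W n)"
    and S: "\<And>n. 1 \<le> n \<Longrightarrow> S n \<in> borel_measurable (Q n)" "\<And>n. 1 \<le> n \<Longrightarrow> distr (Q n) borel (S n) = distr M borel T"
    and ind: "\<And>n. 1 \<le> n \<Longrightarrow> indep_of_process (Q n) (S n) (Zn b n (W n))"
  shows "weak_conv_m (\<lambda>n. distr (Q n) borel (\<lambda>\<omega>. Zn b n (W n) (S n \<omega>) \<omega>)) (distr M borel Z)"
proof -
  note cD = coupledD[OF c]
  note [measurable] = cD(2,3)
  interpret M: prob_space M by (rule cD)
  interpret D: prob_space "distr M borel T" by (rule M.prob_space_distr) measurable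
  have D0: "AE t in distr M borel T. 0 \<le> t" using cD(4) by (subst AE_distr_iff) auto
  have mix: "distr M borel Z = distr M borel T \<bind> \<kappa>" by (rule coupled_mixture[OF c \<kappa>]) (rule eq)
  define \<mu> where "\<mu> n t = distr (P (Suc n)) borel (Zn b (Suc n) (X (Suc n)) t)" for n t
  have \<mu>k: "\<mu> n \<in> borel \<rightarrow>\<^sub>M prob_algebra borel" for n
    unfolding \<mu>_def using b by (intro tree_walk_Zn_kernel P) auto
  note \<mu>d = real_distribution_kernel[OF \<mu>k] and \<kappa>d = real_distribution_kernel[OF \<kappa>]
  have Zmax: "Zn b n X (max 0 t) = Zn b n X t" for n t and X :: "real \<Rightarrow> 'x \<Rightarrow> nat list" by (rule ext) (rule Zn_max)
  have key: "(\<lambda>\<omega>. Zn b n (W n) (S n \<omega>) \<omega>) \<in> borel_measurable (Q n)"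
      "\<And>f :: real \<Rightarrow> real. f \<in> borel_measurable borel \<Longrightarrow> (\<And>x. \<bar>f x\<bar> \<le> 1) \<Longrightarrow>
        (\<integral>\<omega>. f (Zn b n (W n) (S n \<omega>) \<omega>) \<partial>Q n) = (\<integral>t. (\<integral>x. f x \<partial>distr (Q n) borel (Zn b n (W n) t)) \<partial>distr M borel T)"
    if n: "1 \<le> n" for n
  proof -
    obtain Y U where "tree_path b n (Q n) (W n) Y U" using Q[OF n] b n by (rule tree_walkE)
    then interpret W: tree_path b n "Q n" "W n" Y U .
    note [measurable] = S(1)[OF n]
    have Zp: "(\<lambda>(t, \<omega>). Zn b n (W n) t \<omega>) \<in> borel_measurable (borel \<Otimes>\<^sub>M Q n)"
      using W.Zn_measurable_pair by (simp add: Zn_max)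
    have Zt: "Zn b n (W n) t \<in> borel_measurable (Q n)" for t
      using W.Zn_measurable[of t] by (simp add: Zn_max)
    show "(\<lambda>\<omega>. Zn b n (W n) (S n \<omega>) \<omega>) \<in> borel_measurable (Q n)"
      using measurable_Pair_compose_split[OF Zp S(1)[OF n] measurable_ident_sets[OF refl]] by simp
    have S0: "AE \<omega> in Q n. 0 \<le> S n \<omega>"
      using D0 unfolding S(2)[OF n, symmetric] by (subst (asm) AE_distr_iff) auto
    fix f :: "real \<Rightarrow> real" assume f: "f \<in> borel_measurable borel" "\<And>x. \<bar>f x\<bar> \<le> 1"
    have "(\<integral>\<omega>. f (Zn b n (W n) (S n \<omega>) \<omega>) \<partial>Q n) = (\<integral>t. (\<integral>\<omega>. f (Zn b n (W n) t \<omega>) \<partial>Q n) \<partial>distr (Q n) borel (S n))"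
      by (rule W.expectation_independent_time[OF S(1)[OF n] S0 Zt Zp W.Zn_right_const _ f])
        (rule indep_of_process_indep_var[OF W.prob_space_axioms ind[OF n] S(1)[OF n] Zt])
    also have "(\<lambda>t. \<integral>\<omega>. f (Zn b n (W n) t \<omega>) \<partial>Q n) = (\<lambda>t. \<integral>x. f x \<partial>distr (Q n) borel (Zn b n (W n) t))"
      using f(1) Zt by (simp add: integral_distr)
    finally show "(\<integral>\<omega>. f (Zn b n (W n) (S n \<omega>) \<omega>) \<partial>Q n) = (\<integral>t. (\<integral>x. f x \<partial>distr (Q n) borel (Zn b n (W n) t)) \<partial>distr M borel T)"
      by (simp add: S(2)[OF n])
  qed
  \<comment> \<open>Only the law at each fixed time enters, and it is the same for every realisation
    of the walk.\<close>
  have law: "distr (Q (Suc n)) borel (Zn b (Suc n) (W (Suc n)) t) = \<mu> n t" for n t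
    using tree_walk_Zn_law_unique[OF Q P b, of "Suc n" "max 0 t"] by (simp add: Zmax \<mu>_def)
  \<comment> \<open>Depth 0 carries no walk, hence the shift by one, to which the limit is
    insensitive.\<close>
  have "weak_conv_m (\<lambda>n. distr (Q (Suc n)) borel (\<lambda>\<omega>. Zn b (Suc n) (W (Suc n)) (S (Suc n) \<omega>) \<omega>)) (distr M borel Z)"
  proof (rule integral_bdd_continuous_conv_imp_weak_conv)
    show "real_distribution (distr (Q (Suc n)) borel (\<lambda>\<omega>. Zn b (Suc n) (W (Suc n)) (S (Suc n) \<omega>) \<omega>))" for n
      using Q[of "Suc n"] key(1)[of "Suc n"] by (intro prob_space.real_distribution_distr) (auto simp: tree_walk_def)
    show "real_distribution (distr M borel Z)" by (rule M.real_distribution_distr) measurable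
    fix f :: "real \<Rightarrow> real" assume f: "\<And>x. isCont f x" "\<And>x. \<bar>f x\<bar> \<le> 1"
    have fm: "f \<in> borel_measurable borel"
      using f(1) by (intro borel_measurable_continuous_onI) (simp add: continuous_at_imp_continuous_on)
    have "(\<lambda>n. \<integral>t. (\<integral>x. f x \<partial>\<mu> n t) \<partial>distr M borel T) \<longlonglongrightarrow> (\<integral>t. (\<integral>x. f x \<partial>\<kappa> t) \<partial>distr M borel T)"
    proof (rule integral_dominated_convergence[where w="\<lambda>_. 1"])
      have im: "(\<lambda>t. \<integral>x. f x \<partial>\<nu> t) \<in> borel_measurable (distr M borel T)" if "\<nu> \<in> borel \<rightarrow>\<^sub>M prob_algebra borel" for \<nu>
        using measurable_compose[OF measurable_prob_algebraD[OF that] integral_measurable_subprob_algebra[OF fm]]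
        by (simp cong: measurable_cong_sets)
      show "(\<lambda>t. \<integral>x. f x \<partial>\<kappa> t) \<in> borel_measurable (distr M borel T)" "(\<lambda>t. \<integral>x. f x \<partial>\<mu> n t) \<in> borel_measurable (distr M borel T)" for n
        using im \<kappa> \<mu>k by auto
      show "AE t in distr M borel T. (\<lambda>n. \<integral>x. f x \<partial>\<mu> n t) \<longlonglongrightarrow> (\<integral>x. f x \<partial>\<kappa> t)"
        using f by (intro AE_I2 weak_conv_imp_integral_bdd_continuous_conv[OF \<mu>d \<kappa>d conv[folded \<mu>_def]]) auto
      have "\<bar>\<integral>x. f x \<partial>\<mu> n t\<bar> \<le> 1" for n t
      proof -
        interpret \<mu>: real_distribution "\<mu> n t" by (rule \<mu>d)
        have "\<bar>\<integral>x. f x \<partial>\<mu> n t\<bar> \<le> (\<integral>x. \<bar>f x\<bar> \<partial>\<mu> n t)" by (rule integral_abs_bound)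
        also have "\<dots> \<le> (\<integral>x. 1 \<partial>\<mu> n t)"
          using f(2) fm by (intro integral_mono \<mu>.integrable_const_bound[where B=1]) auto
        finally show ?thesis using \<mu>.prob_space by simp
      qed
      then show "AE t in distr M borel T. norm (\<integral>x. f x \<partial>\<mu> n t) \<le> 1" for n by simp
    qed simp
    moreover have "(\<integral>x. f x \<partial>distr (Q (Suc n)) borel (\<lambda>\<omega>. Zn b (Suc n) (W (Suc n)) (S (Suc n) \<omega>) \<omega>)) = (\<integral>t. (\<integral>x. f x \<partial>\<mu> n t) \<partial>distr M borel T)" for n
      using key[of "Suc n"] fm f(2) by (subst integral_distr) (auto simp: law)
    moreover have "(\<integral>x. f x \<partial>distr M borel Z) = (\<integral>t. (\<integral>x. f x \<partial>\<kappa> t) \<partial>distr M borel T)"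
      unfolding mix by (rule integral_bind_kernel[OF D.prob_space_axioms _ \<kappa> fm f(2)]) simp
    ultimately show "(\<lambda>n. \<integral>x. f x \<partial>distr (Q (Suc n)) borel (\<lambda>\<omega>. Zn b (Suc n) (W (Suc n)) (S (Suc n) \<omega>) \<omega>)) \<longlonglongrightarrow> (\<integral>x. f x \<partial>distr M borel Z)"
      by simp
  qed
  then show ?thesis
    unfolding weak_conv_m_def weak_conv_def by (auto intro: LIMSEQ_imp_Suc)
qed

text \<open>The sum of independent scaled copies has as characteristic function a power of the mixed
  one, and \<open>char_limit_cascade\<close> identifies this power with that of the limit
  law.\<close>

lemma cascade_relation:
  fixes \<kappa> :: "real \<Rightarrow> real measure"
  assumes b: "2 \<le> b" and walk: "\<And>n. 1 \<le> n \<Longrightarrow> tree_walk b n (P n) (X n)"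
    and \<kappa>: "\<kappa> \<in> borel \<rightarrow>\<^sub>M prob_algebra borel" and eq: "\<And>t. 0 \<le> t \<Longrightarrow> \<kappa> t = \<zeta> t"
    and conv: "\<And>s. weak_conv_m (\<lambda>n. distr (P (Suc n)) borel (Zn b (Suc n) (X (Suc n)) s)) (\<kappa> s)"
    and t: "0 < t" and c: "coupled \<zeta> M T Z" and T: "distr M borel T = cpe_law t"
    and Q: "prob_space Q" and V: "prob_space.indep_vars Q (\<lambda>_. borel) V {1..b}"
    and VZ: "\<And>i. i \<in> {1..b} \<Longrightarrow> distr Q borel (V i) = distr M borel Z"
  shows "\<zeta> t = distr Q borel (\<lambda>\<omega>. \<Sum>i=1..b. V i \<omega> / (real b)\<^sup>2)"
proof -
  interpret Q: prob_space Q by (rule Q)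
  have Vm[measurable]: "V i \<in> borel_measurable Q" if "i \<in> {1..b}" for i
    using V that unfolding Q.indep_vars_def by auto
  have \<kappa>t: "\<kappa> t = \<zeta> t" using t by (intro eq) simp
  have "\<kappa> t = distr Q borel (\<lambda>\<omega>. \<Sum>i=1..b. V i \<omega> / (real b)\<^sup>2)"
  proof (rule Levy_uniqueness)
    show "real_distribution (\<kappa> t)" by (rule real_distribution_kernel[OF \<kappa>])
    show "real_distribution (distr Q borel (\<lambda>\<omega>. \<Sum>i=1..b. V i \<omega> / (real b)\<^sup>2))"
      by (intro Q.real_distribution_distr borel_measurable_sum borel_measurable_divide Vm) auto
    show "char (\<kappa> t) = char (distr Q borel (\<lambda>\<omega>. \<Sum>i=1..b. V i \<omega> / (real b)\<^sup>2))"
    proof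
      fix \<theta>
      have "Q.indep_vars (\<lambda>_. borel) (\<lambda>i \<omega>. V i \<omega> / (real b)\<^sup>2) {1..b}"
        by (rule Q.indep_vars_compose2[OF V]) auto
      then have "char (distr Q borel (\<lambda>\<omega>. \<Sum>i=1..b. V i \<omega> / (real b)\<^sup>2)) \<theta> = (\<Prod>i\<in>{1..b}. char (distr Q borel (\<lambda>\<omega>. V i \<omega> / (real b)\<^sup>2)) \<theta>)"
        by (rule Q.char_distr_sum)
      also have "\<dots> = (\<Prod>i\<in>{1..b}. \<integral>s. char (\<kappa> s) (\<theta> / (real b)\<^sup>2) \<partial>cpe_law t)"
      proof (rule prod.cong)
        fix i assume i: "i \<in> {1..b}"
        note [measurable] = Vm[OF i]
        have "char (distr Q borel (\<lambda>\<omega>. V i \<omega> / (real b)\<^sup>2)) \<theta> = char (distr Q borel (V i)) (\<theta> / (real b)\<^sup>2)"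
          by (simp add: char_def integral_distr)
        also have "\<dots> = char (cpe_law t \<bind> \<kappa>) (\<theta> / (real b)\<^sup>2)"
          using VZ[OF i] coupled_mixture[OF c \<kappa> eq] T by simp
        also have "\<dots> = (\<integral>s. char (\<kappa> s) (\<theta> / (real b)\<^sup>2) \<partial>cpe_law t)"
          by (rule char_bind_kernel[OF prob_space_cpe sets_cpe \<kappa>])
        finally show "char (distr Q borel (\<lambda>\<omega>. V i \<omega> / (real b)\<^sup>2)) \<theta> = (\<integral>s. char (\<kappa> s) (\<theta> / (real b)\<^sup>2) \<partial>cpe_law t)" .
      qed simp
      also have "\<dots> = char (\<kappa> t) \<theta>"
        using char_limit_cascade[OF b walk \<kappa> conv t, of \<theta>] by simp
      finally show "char (\<kappa> t) \<theta> = char (distr Q borel (\<lambda>\<omega>. \<Sum>i=1..b. V i \<omega> / (real b)\<^sup>2)) \<theta>" ..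
    qed
  qed
  then show ?thesis by (simp add: \<kappa>t)
qed

text \<open>Uniqueness of the coupled pair concerns its joint law, so it is phrased for measures on
  the plane with \<open>fst\<close> and \<open>snd\<close> as the pair. The separate type variables
  let the walks, the random times and the copies in the cascade live on unrelated probability
  spaces.\<close>

theorem corollary1p4:
  fixes b :: nat
    and P :: "nat \<Rightarrow> 'a measure" and X :: "nat \<Rightarrow> real \<Rightarrow> 'a \<Rightarrow> nat list"
    and \<zeta> :: "real \<Rightarrow> real measure"
  assumes "b \<ge> 2"
    and "\<And>n. n \<ge> 1 \<Longrightarrow> tree_walk b n (P n) (X n)"
    and "\<And>t. t > 0 \<Longrightarrow> real_distribution (\<zeta> t)"
    and "\<And>t. t > 0 \<Longrightarrow> weak_conv_m (\<lambda>n. distr (P n) borel (Zn b n (X n) t)) (\<zeta> t)"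
    and "\<zeta> 0 = return borel 0"
  shows
    "(\<forall>E\<in>sets (borel :: (real \<times> real) measure).
        (\<lambda>t. measure (\<zeta> t) {z. (t, z) \<in> E}) \<in> borel_measurable (restrict_space borel {0..})) \<and>
     (\<forall>(M :: 'b measure) T.
        prob_space M \<and> T \<in> borel_measurable M \<and> (AE \<omega> in M. 0 \<le> T \<omega>) \<longrightarrow>
        (\<exists>!\<mu> :: (real \<times> real) measure.
           sets \<mu> = sets borel \<and> distr \<mu> borel fst = distr M borel T \<and> coupled \<zeta> \<mu> fst snd)) \<and>
     (\<forall>(M :: 'c measure) T Z (Q :: nat \<Rightarrow> 'd measure) W S.
        coupled \<zeta> M T Z \<and>
        (\<forall>n\<ge>1. tree_walk b n (Q n) (W n) \<and>
           S n \<in> borel_measurable (Q n) \<and> distr (Q n) borel (S n) = distr M borel T \<and>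
           indep_of_process (Q n) (S n) (Zn b n (W n))) \<longrightarrow>
        weak_conv_m (\<lambda>n. distr (Q n) borel (\<lambda>\<omega>. Zn b n (W n) (S n \<omega>) \<omega>)) (distr M borel Z)) \<and>
     (\<forall>t>0. \<forall>(M :: 'e measure) T Z (Q :: 'f measure) V.
        coupled \<zeta> M T Z \<and> distr M borel T = cpe_law t \<and>
        prob_space Q \<and> prob_space.indep_vars Q (\<lambda>_. borel) V {1..b} \<and>
        (\<forall>i\<in>{1..b}. distr Q borel (V i) = distr M borel Z) \<longrightarrow>
        \<zeta> t = distr Q borel (\<lambda>\<omega>. \<Sum>i=1..b. V i \<omega> / (real b)\<^sup>2))"
proof -
  \<comment> \<open>The hypotheses govern \<zeta> for \<open>t \<ge> 0\<close> only; continuing it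
    by the point mass at 0 gives a kernel on the whole line, in agreement with \<open>Zn\<close> at
    negative times.\<close>
  define \<kappa> where "\<kappa> t = \<zeta> (max 0 t)" for t
  have \<kappa>_eq: "\<kappa> t = \<zeta> t" if "0 \<le> t" for t using that by (simp add: \<kappa>_def max_def)
  have \<kappa>_cases: "\<kappa> t = (if 0 < t then \<zeta> t else return borel 0)" for t
    using assms(5) by (auto simp: \<kappa>_def max_def)
  have pP: "prob_space (P (Suc n))" for n using assms(2)[of "Suc n"] by (simp add: tree_walk_def)
  have \<kappa>d: "real_distribution (\<kappa> t)" for t
    using assms(3) by (auto simp: \<kappa>_cases real_distribution_def real_distribution_axioms_def prob_space_return)
  have conv: "weak_conv_m (\<lambda>n. distr (P (Suc n)) borel (Zn b (Suc n) (X (Suc n)) s)) (\<kappa> s)" for s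
  proof (cases "0 < s")
    case True
    then show ?thesis
      using assms(4)[OF True] unfolding weak_conv_m_def weak_conv_def \<kappa>_cases
      by (auto intro!: LIMSEQ_Suc[of "\<lambda>n. cdf (distr (P n) borel (Zn b n (X n) s)) x" for x])
  next
    case False
    have "distr (P (Suc n)) borel (Zn b (Suc n) (X (Suc n)) s) = \<kappa> s" for n
    proof -
      interpret prob_space "P (Suc n)" by (rule pP)
      have "Zn b (Suc n) (X (Suc n)) s = (\<lambda>_. 0)"
        using False by (intro ext) (subst Zn_max[symmetric], simp add: max_def Zn_eq)
      then show ?thesis using False by (simp add: \<kappa>_cases)
    qed
    then show ?thesis by (simp add: weak_conv_m_def weak_conv_def)
  qed
  have walk: "tree_walk b n (P n) (X n)" if "1 \<le> n" for n using assms(2) that by simp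
  have \<kappa>: "\<kappa> \<in> borel \<rightarrow>\<^sub>M prob_algebra borel"
  proof (rule weak_limit_kernel[OF _ \<kappa>d conv])
    show "(\<lambda>t. distr (P (Suc n)) borel (Zn b (Suc n) (X (Suc n)) t)) \<in> borel \<rightarrow>\<^sub>M prob_algebra borel" for n
      by (rule tree_walk_Zn_kernel[OF walk assms(1)]) auto
  qed
  have 1: "(\<lambda>t. measure (\<zeta> t) {z. (t, z) \<in> E}) \<in> borel_measurable (restrict_space borel {0..})"
    if E: "E \<in> sets (borel :: (real \<times> real) measure)" for E
  proof -
    have "E \<in> sets ((borel :: real measure) \<Otimes>\<^sub>M (borel :: real measure))"
      using E unfolding borel_prod .
    moreover have "(SIGMA t:space borel. {z. (t, z) \<in> E}) = E" by auto
    ultimately have "(\<lambda>t. measure (\<kappa> t) {z. (t, z) \<in> E}) \<in> borel_measurable borel"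
      by (intro measure_measurable_prob_algebra2[OF _ \<kappa>]) (simp only:)
    then have "(\<lambda>t. measure (\<kappa> t) {z. (t, z) \<in> E}) \<in> borel_measurable (restrict_space borel {0..})"
      by (rule measurable_restrict_space1)
    then show ?thesis
      by (rule measurable_cong[THEN iffD1, rotated]) (simp add: space_restrict_space \<kappa>_eq)
  qed
  show ?thesis
  proof (intro conjI ballI allI impI)
    fix M :: "'b measure" and T :: "'b \<Rightarrow> real"
    assume "prob_space M \<and> T \<in> borel_measurable M \<and> (AE \<omega> in M. 0 \<le> T \<omega>)"
    then show "\<exists>!\<mu> :: (real \<times> real) measure. sets \<mu> = sets borel \<and> distr \<mu> borel fst = distr M borel T \<and> coupled \<zeta> \<mu> fst snd"
      by (intro coupling_unique[OF _ _ _ \<kappa> \<kappa>_eq]) auto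
  next
    fix M :: "'c measure" and T Z :: "'c \<Rightarrow> real" and Q :: "nat \<Rightarrow> 'd measure"
      and W :: "nat \<Rightarrow> real \<Rightarrow> 'd \<Rightarrow> nat list" and S :: "nat \<Rightarrow> 'd \<Rightarrow> real"
    assume "coupled \<zeta> M T Z \<and> (\<forall>n\<ge>1. tree_walk b n (Q n) (W n) \<and> S n \<in> borel_measurable (Q n) \<and>
      distr (Q n) borel (S n) = distr M borel T \<and> indep_of_process (Q n) (S n) (Zn b n (W n)))"
    then show "weak_conv_m (\<lambda>n. distr (Q n) borel (\<lambda>\<omega>. Zn b n (W n) (S n \<omega>) \<omega>)) (distr M borel Z)"
      by (intro Zn_independent_time_conv[OF assms(1) \<kappa> \<kappa>_eq conv walk, where T=T]) auto
  next
    fix t :: real and M :: "'e measure" and T Z :: "'e \<Rightarrow> real"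
      and Q :: "'f measure" and V :: "nat \<Rightarrow> 'f \<Rightarrow> real"
    assume t: "0 < t" and *: "coupled \<zeta> M T Z \<and> distr M borel T = cpe_law t \<and> prob_space Q \<and>
      prob_space.indep_vars Q (\<lambda>_. borel) V {1..b} \<and> (\<forall>i\<in>{1..b}. distr Q borel (V i) = distr M borel Z)"
    show "\<zeta> t = distr Q borel (\<lambda>\<omega>. \<Sum>i=1..b. V i \<omega> / (real b)\<^sup>2)"
      by (rule cascade_relation[OF assms(1) walk \<kappa> \<kappa>_eq conv t, where M=M and T=T and Z=Z]) (use * in auto)
  qed (rule 1)
qed

end
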